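(* Let $1<p<\infty$ and let $X$ be a (not necessarily complete) metric space equipped with a globally doubling measure $\mu$ supporting a global $p$-Poincaré inequality. If $u\in D^p(X)$ is a quasiharmonic function on $X$ with finite energy, then $u$ is constant.
   Context: Setting. $(X,d)$ is a metric space equipped with a positive complete Borel measure $\mu$ with $0<\mu(B)<\infty$ for all balls $B=B(x,r)=\{y:d(x,y)<r\}$; $\lambda B=B(x,\lambda r)$. $\mu$ is globally doubling if there is $C>0$ with $\mu(2B)\le C\mu(B)$ for all balls $B\subset X$. $\mu$ supports a global $p$-Poincaré inequality if there are $C>0$, $\lambda\ge1$ such that for all balls $B\subset X$ of radius $r_B$, all integrable $u$ on $\lambda B$ and all upper gradients $g$ of $u$ in $\lambda B$, $\frac1{\mu(B)}\int_B|u-u_B|\,d\mu\le C r_B\bigl(\frac1{\mu(\lambda B)}\int_{\lambda B}g^p\,d\mu\bigr)^{1/p}$, where $u_B=\frac1{\mu(B)}\int_Bu\,d\mu$. Curves are nonconstant, compact and rectifiable, parameterized by arc length. The $p$-modulus of a curve family $\Gamma$ is $\mathrm{Mod}_p(\Gamma)=\inf_\rho\int_X\rho^p\,d\mu$, over all nonnegative Borel $\rho$ with $\int_\gamma\rho\,ds\ge1$ for all $\gamma\in\Gamma$. A nonnegative Borel function $g$ is an upper gradient of $u:X\to[-\infty,\infty]$ if $|u(\gamma(0))-u(\gamma(l_\gamma))|\le\int_\gamma g\,ds$ for all curves $\gamma:[0,l_\gamma]\to X$ (left-hand side $=\infty$ if a term is infinite); a nonnegative measurable $g$ is a $p$-weak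 upper gradient if this holds for all curves except for a family of zero $p$-modulus. If $u$ has an upper gradient in $L^p_{\rm loc}$, $g_u$ denotes its minimal $p$-weak upper gradient (minimal a.e. among all $p$-weak upper gradients in $L^p_{\rm loc}$). $N^{1,p}(X)$ is the set of measurable $u:X\to[-\infty,\infty]$ with $\int_X|u|^p\,d\mu+\inf_g\int_Xg^p\,d\mu<\infty$ (inf over upper gradients $g$ of $u$); $D^p(X)$ is the set of measurable functions on $X$ having an upper gradient in $L^p(X)$. $N^{1,p}_{\rm loc}(X)$: every $x\in X$ has $r_x>0$ with $u\in N^{1,p}(B(x,r_x))$. A function $u\in N^{1,p}_{\rm loc}(X)$ is a quasiminimizer on $X$ if there is $Q_u\ge1$ such that $\int_{\{\varphi\ne0\}}g_u^p\,d\mu\le Q_u\int_{\{\varphi\ne0\}}g_{u+\varphi}^p\,d\mu$ for all $\varphi\in N^{1,p}(X)$. A quasiharmonic function on $X$ is a continuous quasiminimizer on $X$. Finite energy means $\int_Xg_u^p\,d\mu<\infty$. *)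

theory Defs
  imports "HOL-Analysis.Analysis"
begin

text \<open>
  A complete Borel measure is understood, as usual in analysis on metric spaces, as the completion
  of a measure on the Borel sigma-algebra.
\<close>

definition complete_borel_measure :: "'a::metric_space measure \<Rightarrow> bool" where
  "complete_borel_measure M \<longleftrightarrow> (\<exists>N. sets N = sets borel \<and> M = completion N)"

text \<open>Balls are open and come with a fixed centre and radius, so \<open>\<lambda>B\<close> is \<open>ball x (\<lambda> * r)\<close>.\<close>

definition globally_doubling :: "'a::metric_space measure \<Rightarrow> bool" where
  "globally_doubling M \<longleftrightarrow>
     (\<exists>C::real. C > 0 \<and>
        (\<forall>x r. r > 0 \<longrightarrow> emeasure M (ball x (2 * r)) \<le> ennreal C * emeasure M (ball x r)))"

text \<open>Powers of extended nonnegative numbers; only used for exponents \<open>a > 0\<close>.\<close>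

definition epowr :: "ennreal \<Rightarrow> real \<Rightarrow> ennreal" where
  "epowr x a = (if x = \<infinity> then \<infinity> else ennreal (enn2real x powr a))"

definition curve_length :: "(real \<Rightarrow> 'a::metric_space) \<Rightarrow> real \<Rightarrow> real \<Rightarrow> ennreal" where
  "curve_length \<gamma> a b =
     (SUP ts \<in> {ts. sorted ts \<and> set ts \<subseteq> {a..b}}.
        \<Sum>i<length ts - 1. ennreal (dist (\<gamma> (ts ! i)) (\<gamma> (ts ! Suc i))))"

text \<open>
  The nonconstant compact rectifiable curves in \<open>A\<close>, parameterized by arc length: a curve is a pair
  \<open>(l, \<gamma>)\<close> of its length \<open>l > 0\<close> and a map \<open>\<gamma>\<close> of which only the restriction to \<open>{0..l}\<close> matters.
\<close>

definition curves_in :: "'a::metric_space set \<Rightarrow> (real \<times> (real \<Rightarrow> 'a)) set" where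
  "curves_in A = {(l, \<gamma>). l > 0 \<and> continuous_on {0..l} \<gamma> \<and> \<gamma> ` {0..l} \<subseteq> A \<and>
     (\<forall>s t. 0 \<le> s \<and> s \<le> t \<and> t \<le> l \<longrightarrow> curve_length \<gamma> s t = ennreal (t - s))}"

definition curve_integral :: "(real \<times> (real \<Rightarrow> 'a)) \<Rightarrow> ('a \<Rightarrow> ennreal) \<Rightarrow> ennreal" where
  "curve_integral c \<rho> = (case c of (l, \<gamma>) \<Rightarrow> \<integral>\<^sup>+t\<in>{0..l}. \<rho> (\<gamma> t) \<partial>lebesgue)"

definition modulus ::
  "'a::metric_space measure \<Rightarrow> real \<Rightarrow> (real \<times> (real \<Rightarrow> 'a)) set \<Rightarrow> ennreal" where
  "modulus M p \<Gamma> =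
     (INF \<rho> \<in> {\<rho> \<in> borel_measurable borel. \<forall>c\<in>\<Gamma>. curve_integral c \<rho> \<ge> 1}.
        \<integral>\<^sup>+x. epowr (\<rho> x) p \<partial>M)"

text \<open>
  The inequality defining upper gradients along one curve. In \<^typ>\<open>ereal\<close> both
  \<open>\<infinity> - \<infinity>\<close> and \<open>(-\<infinity>) - (-\<infinity>)\<close> equal \<open>\<infinity>\<close>, so the left-hand side is \<open>\<infinity>\<close> as soon as one of
  the two terms is infinite.
\<close>

definition ug_ineq ::
  "('a \<Rightarrow> ereal) \<Rightarrow> ('a \<Rightarrow> ennreal) \<Rightarrow> (real \<times> (real \<Rightarrow> 'a)) \<Rightarrow> bool" where
  "ug_ineq u g c \<longleftrightarrow>
     (case c of (l, \<gamma>) \<Rightarrow> \<bar>u (\<gamma> 0) - u (\<gamma> l)\<bar> \<le> enn2ereal (curve_integral c g))"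

definition upper_gradient_on ::
  "'a::metric_space set \<Rightarrow> ('a \<Rightarrow> ereal) \<Rightarrow> ('a \<Rightarrow> ennreal) \<Rightarrow> bool" where
  "upper_gradient_on A u g \<longleftrightarrow>
     g \<in> borel_measurable (restrict_space borel A) \<and> (\<forall>c\<in>curves_in A. ug_ineq u g c)"

definition weak_upper_gradient ::
  "'a::metric_space measure \<Rightarrow> real \<Rightarrow> ('a \<Rightarrow> ereal) \<Rightarrow> ('a \<Rightarrow> ennreal) \<Rightarrow> bool" where
  "weak_upper_gradient M p u g \<longleftrightarrow>
     g \<in> borel_measurable M \<and> modulus M p {c \<in> curves_in UNIV. \<not> ug_ineq u g c} = 0"

definition Lp_loc ::
  "'a::metric_space measure \<Rightarrow> real \<Rightarrow> ('a \<Rightarrow> ennreal) \<Rightarrow> bool" where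
  "Lp_loc M p g \<longleftrightarrow>
     g \<in> borel_measurable M \<and> (\<forall>x. \<exists>r>0. (\<integral>\<^sup>+y\<in>ball x r. epowr (g y) p \<partial>M) < \<infinity>)"

definition is_minimal_weak_upper_gradient ::
  "'a::metric_space measure \<Rightarrow> real \<Rightarrow> ('a \<Rightarrow> ereal) \<Rightarrow> ('a \<Rightarrow> ennreal) \<Rightarrow> bool" where
  "is_minimal_weak_upper_gradient M p u g \<longleftrightarrow>
     weak_upper_gradient M p u g \<and> Lp_loc M p g \<and>
     (\<forall>h. weak_upper_gradient M p u h \<and> Lp_loc M p h \<longrightarrow> (AE x in M. g x \<le> h x))"

text \<open>
  The minimal \<open>p\<close>-weak upper gradient \<open>g\<^sub>u\<close>, unique up to a null set; it is meaningful for functions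
  having an upper gradient in \<open>L\<^sup>p\<^sub>l\<^sub>o\<^sub>c\<close>.
\<close>

definition min_wug ::
  "'a::metric_space measure \<Rightarrow> real \<Rightarrow> ('a \<Rightarrow> ereal) \<Rightarrow> 'a \<Rightarrow> ennreal" where
  "min_wug M p u = (SOME g. is_minimal_weak_upper_gradient M p u g)"

text \<open>
  \<open>N\<^sup>1\<^sup>,\<^sup>p(A)\<close>, with \<open>A\<close> regarded as a metric measure space in its own right (used for open \<open>A\<close>). The
  infimum is \<open>\<infinity>\<close> if \<open>u\<close> has no upper gradient. Values of \<open>u\<close> outside \<open>A\<close> are irrelevant.
\<close>

definition N1p_on ::
  "'a::metric_space measure \<Rightarrow> real \<Rightarrow> 'a set \<Rightarrow> ('a \<Rightarrow> ereal) set" where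
  "N1p_on M p A = {u \<in> borel_measurable (restrict_space M A).
     (\<integral>\<^sup>+x\<in>A. epowr (e2ennreal \<bar>u x\<bar>) p \<partial>M)
       + (INF g \<in> {g. upper_gradient_on A u g}. \<integral>\<^sup>+x\<in>A. epowr (g x) p \<partial>M) < \<infinity>}"

definition N1p_loc :: "'a::metric_space measure \<Rightarrow> real \<Rightarrow> ('a \<Rightarrow> ereal) set" where
  "N1p_loc M p = {u. \<forall>x. \<exists>r>0. u \<in> N1p_on M p (ball x r)}"

definition Dp :: "'a::metric_space measure \<Rightarrow> real \<Rightarrow> ('a \<Rightarrow> ereal) set" where
  "Dp M p = {u \<in> borel_measurable M.
     \<exists>g. upper_gradient_on UNIV u g \<and> (\<integral>\<^sup>+x. epowr (g x) p \<partial>M) < \<infinity>}"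

text \<open>
  Here \<open>B = ball x r\<close>. An integrable function may be infinite on a null set, which
  \<^const>\<open>real_of_ereal\<close> maps to \<open>0\<close> without affecting the mean value.
\<close>

definition mean_on :: "'a measure \<Rightarrow> 'a set \<Rightarrow> ('a \<Rightarrow> ereal) \<Rightarrow> real" where
  "mean_on M B u = (LINT x:B|M. real_of_ereal (u x)) / measure M B"

definition global_Poincare :: "'a::metric_space measure \<Rightarrow> real \<Rightarrow> bool" where
  "global_Poincare M p \<longleftrightarrow>
     (\<exists>(C::real) (L::real). C > 0 \<and> L \<ge> 1 \<and>
       (\<forall>x r u g. r > 0 \<and>
          u \<in> borel_measurable (restrict_space M (ball x (L * r))) \<and>
          (\<integral>\<^sup>+y\<in>ball x (L * r). e2ennreal \<bar>u y\<bar> \<partial>M) < \<infinity> \<and>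
          upper_gradient_on (ball x (L * r)) u g \<longrightarrow>
          (\<integral>\<^sup>+y\<in>ball x r. e2ennreal \<bar>u y - ereal (mean_on M (ball x r) u)\<bar> \<partial>M)
              / emeasure M (ball x r)
            \<le> ennreal (C * r) *
               epowr ((\<integral>\<^sup>+y\<in>ball x (L * r). epowr (g y) p \<partial>M)
                        / emeasure M (ball x (L * r))) (1 / p)))"

text \<open>
  The sum \<open>u + \<phi>\<close> can involve \<open>\<infinity> + (-\<infinity>)\<close> only on a set of zero \<open>p\<close>-capacity; the value
  assigned there does not influence the minimal \<open>p\<close>-weak upper gradient.
\<close>

definition quasiminimizer ::
  "'a::metric_space measure \<Rightarrow> real \<Rightarrow> ('a \<Rightarrow> ereal) \<Rightarrow> bool" where
  "quasiminimizer M p u \<longleftrightarrow>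
     u \<in> N1p_loc M p \<and>
     (\<exists>Q::real. Q \<ge> 1 \<and>
       (\<forall>\<phi>\<in>N1p_on M p UNIV.
          (\<integral>\<^sup>+x\<in>{x. \<phi> x \<noteq> 0}. epowr (min_wug M p u x) p \<partial>M)
            \<le> ennreal Q *
               (\<integral>\<^sup>+x\<in>{x. \<phi> x \<noteq> 0}. epowr (min_wug M p (\<lambda>y. u y + \<phi> y) x) p \<partial>M)))"

text \<open>Continuity is that of a map into \<open>[-\<infinity>, \<infinity>]\<close>, which includes all continuous real-valued \<open>u\<close>.\<close>

definition quasiharmonic ::
  "'a::metric_space measure \<Rightarrow> real \<Rightarrow> ('a \<Rightarrow> ereal) \<Rightarrow> bool" where
  "quasiharmonic M p u \<longleftrightarrow> continuous_on UNIV u \<and> quasiminimizer M p u"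

definition finite_energy ::
  "'a::metric_space measure \<Rightarrow> real \<Rightarrow> ('a \<Rightarrow> ereal) \<Rightarrow> bool" where
  "finite_energy M p u \<longleftrightarrow> (\<integral>\<^sup>+x. epowr (min_wug M p u x) p \<partial>M) < \<infinity>"

end

theory Submission
  imports Defs
begin

text \<open>
  Let \<open>g\<close> be an upper gradient of \<open>u\<close> in \<open>L\<^sup>p\<close>. Telescoping the \<open>p\<close>-Poincare inequality over shrinking
  balls (every point is a Lebesgue point, since \<open>u\<close> is continuous) yields constants \<open>c\<^sub>k\<close> with
  \<open>\<integral>\<^bsub>B(x\<^sub>0, 4R\<^sub>k)\<^esub> |u - c\<^sub>k|\<^sup>p \<le> const * R\<^sub>k\<^sup>p\<close>, where \<open>R\<^sub>k = 8\<^sup>k R\<^sub>0\<close>. Replacing \<open>u\<close> by \<open>c\<^sub>k\<close> inside \<open>B(x\<^sub>0, R\<^sub>k)\<close>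
  with a cutoff function therefore costs a bounded amount of energy. No single \<open>k\<close> gives a good
  competitor, but the cutoff energies live on disjoint annuli, so the average of the first \<open>n\<close>
  modifications has energy at most a constant times the energy of \<open>g\<close> far from \<open>x\<^sub>0\<close> plus \<open>n\<^bsup>1-p\<^esup>\<close>. By
  quasiminimality the energy of \<open>u\<close> on \<open>B(x\<^sub>0, R\<^sub>0)\<close> is bounded by this quantity, hence vanishes. No
  self-improvement of the Poincare inequality is needed.
\<close>

section \<open>Powers of extended nonnegative reals\<close>

text \<open>The scale R cancels in the cost of one modification: a slope 1/R contributes R^(-p),
  against a p-integral of order R^p. The cost is thus bounded but never small, and averaging wins
  only through the strict convexity of t^p for p > 1. The obstacle in the Poincare part is that the
  maximal function of g^p is only weakly integrable. Averages at one fixed scale do integrate, by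
  Fubini and doubling, to at most a constant times the energy, and geometric weights pay for the sum
  over scales. The right-hand side is then the total energy of g rather than that of a dilated ball,
  which is enough because this energy is finite. Three further points shape the text.
  \<open>min_wug\<close> is defined by choice, so a minimal weak upper gradient has to be
  constructed before quasiminimality says anything. The values of u may be infinite, so
  integrability comes from truncation and curves of infinite line integral are treated apart.
  Quasiminimality controls energy only where the test function is nonzero, so a level set of u
  escapes each single test function.\<close>

lemma epowr_0 [simp]: "epowr 0 a = 0"
  by (simp add: epowr_def)

lemma epowr_top [simp]: "epowr top a = top"
  by (simp add: epowr_def)

lemma epowr_ennreal: "0 \<le> r \<Longrightarrow> epowr (ennreal r) a = ennreal (r powr a)"
  by (simp add: epowr_def)

lemma epowr_eq_top_iff [simp]: "epowr x a = top \<longleftrightarrow> x = top"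
  by (auto simp: epowr_def)

lemma epowr_less_top_iff: "epowr x a < top \<longleftrightarrow> x < top"
  by (auto simp: epowr_def less_top)

lemma epowr_mono: "x \<le> y \<Longrightarrow> 0 \<le> a \<Longrightarrow> epowr x a \<le> epowr y a"
  by (cases x; cases y)
     (auto simp: epowr_ennreal powr_mono2 top_unique intro!: ennreal_leI)

lemma epowr_eq_0_iff [simp]: "epowr x a = 0 \<longleftrightarrow> x = 0"
  by (cases x) (auto simp: epowr_ennreal)

lemma epowr_mult:
  assumes "0 < a"
  shows "epowr (x * y) a = epowr x a * epowr y a"
proof (cases "x = top \<or> y = top")
  case True
  then show ?thesis using assms
    by (cases "x = 0 \<or> y = 0") (auto simp: ennreal_mult_top ennreal_top_mult)
next
  case False
  then obtain r s where "x = ennreal r" "y = ennreal s" "0 \<le> r" "0 \<le> s"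
    by (metis ennreal_cases infinity_ennreal_def)
  then show ?thesis
    by (simp add: ennreal_mult[symmetric] epowr_ennreal powr_mult)
qed

lemma epowr_epowr: "epowr (epowr x a) b = epowr x (a * b)"
  by (cases x) (auto simp: epowr_ennreal powr_powr)

lemma epowr_one [simp]: "epowr x 1 = x"
  by (cases x) (auto simp: epowr_ennreal)

lemma epowr_inverse_exponent [simp]:
  assumes "a \<noteq> 0"
  shows "epowr (epowr x a) (1 / a) = x" "epowr (epowr x (1 / a)) a = x"
  using assms by (simp_all add: epowr_epowr)

lemma measurable_epowr [measurable (raw)]:
  assumes [measurable]: "f \<in> borel_measurable N"
  shows "(\<lambda>x. epowr (f x) a) \<in> borel_measurable N"
proof -
  have "(\<lambda>x. ennreal (enn2real (f x) powr a)) \<in> borel_measurable N" by measurable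
  moreover have "{x \<in> space N. f x = \<infinity>} \<in> sets N" by measurable
  ultimately show ?thesis unfolding epowr_def by (intro measurable_If) auto
qed

lemma epowr_le_cancel:
  assumes "0 < a" "epowr x a \<le> epowr y a"
  shows "x \<le> y"
  using epowr_mono[OF assms(2), of "1 / a"] assms(1) by simp

text \<open>Plays the role of Minkowski's inequality for series: countable families are combined
  through suprema, and each term is at most the p-th root of the whole sum of p-th powers.\<close>

lemma epowr_SUP_le:
  assumes "0 < p"
  shows "epowr (SUP n. f n) p \<le> (\<Sum>n::nat. epowr (f n) p)"
proof -
  have "f n \<le> epowr (\<Sum>n. epowr (f n) p) (1 / p)" for n
  proof -
    have "(\<Sum>i\<in>{n}. epowr (f i) p) \<le> (\<Sum>n. epowr (f n) p)"
      by (rule sum_le_suminf) auto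
    then have "epowr (f n) p \<le> (\<Sum>n. epowr (f n) p)" by simp
    from epowr_mono[OF this, of "1 / p"] assms show ?thesis by simp
  qed
  then have "(SUP n. f n) \<le> epowr (\<Sum>n. epowr (f n) p) (1 / p)" by (rule SUP_least)
  from epowr_mono[OF this, of p] assms show ?thesis by simp
qed

lemma epowr_max: "0 \<le> p \<Longrightarrow> epowr (max x y) p = max (epowr x p) (epowr y p)"
  using epowr_mono[of x y p] epowr_mono[of y x p]
  by (cases "x \<le> y") (simp_all add: max_absorb1 max_absorb2)

text \<open>The constant comes from bounding the sum by twice the maximum; throughout, only its
  finiteness matters.\<close>

lemma epowr_add_le:
  assumes "0 < p"
  shows "epowr (x + y) p \<le> ennreal (2 powr p) * (epowr x p + epowr y p)"
proof -
  have "x + y \<le> ennreal 2 * max x y"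
    by (simp add: max_def mult_2 add_mono)
  from epowr_mono[OF this, of p] assms
  have "epowr (x + y) p \<le> ennreal (2 powr p) * max (epowr x p) (epowr y p)"
    by (simp add: epowr_mult epowr_ennreal epowr_max del: ennreal_numeral)
  also have "\<dots> \<le> ennreal (2 powr p) * (epowr x p + epowr y p)"
    by (intro mult_left_mono) (auto simp: max_def add_increasing add_increasing2)
  finally show ?thesis .
qed

text \<open>Meant for functions with disjoint supports, of which at most one is nonzero at any given
  point. This is the source of the gain in the energy of the averaged competitor.\<close>

lemma epowr_sum_single:
  assumes "finite I" "\<And>i j. i \<in> I \<Longrightarrow> j \<in> I \<Longrightarrow> i \<noteq> j \<Longrightarrow> f i = 0 \<or> f j = 0" "0 < p"
  shows "epowr (\<Sum>i\<in>I. f i) p = (\<Sum>i\<in>I. epowr (f i) p)"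
proof (cases "\<exists>i\<in>I. f i \<noteq> 0")
  case True
  then obtain i where i: "i \<in> I" "f i \<noteq> 0" by blast
  then have *: "f j = 0" if "j \<in> I - {i}" for j using assms(2) that by fastforce
  have "(\<Sum>j\<in>I. f j) = f i" "(\<Sum>j\<in>I. epowr (f j) p) = epowr (f i) p"
    using i * assms(1) by (simp_all add: sum.remove[of I i])
  then show ?thesis by simp
qed simp

section \<open>Curves and line integrals\<close>

lemma continuous_real_of_ereal_measurable:
  "continuous_on UNIV u \<Longrightarrow> (\<lambda>x. real_of_ereal (u x)) \<in> borel_measurable borel"
  by (intro borel_measurable_real_of_ereal borel_measurable_continuous_onI)

text \<open>Integrates over any parameter subinterval, so that subcurves are handled without
  reparameterization. Integration against \<open>lborel\<close> gives the same values as against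
  \<open>lebesgue\<close>.\<close>

definition line_integral :: "('a \<Rightarrow> ennreal) \<Rightarrow> (real \<Rightarrow> 'a) \<Rightarrow> real \<Rightarrow> real \<Rightarrow> ennreal" where
  "line_integral g \<gamma> s t = (\<integral>\<^sup>+\<tau>. g (\<gamma> \<tau>) * indicator {s..t} \<tau> \<partial>lborel)"

lemma curve_integral_eq: "curve_integral (l, \<gamma>) g = line_integral g \<gamma> 0 l"
  by (simp add: curve_integral_def line_integral_def nn_integral_completion)

lemma line_integrand_measurable:
  fixes \<gamma> :: "real \<Rightarrow> 'a::topological_space"
  assumes "g \<in> borel_measurable borel" "continuous_on {s..t} \<gamma>"
  shows "(\<lambda>\<tau>. g (\<gamma> \<tau>) * indicator {s..t} \<tau> :: ennreal) \<in> borel_measurable borel"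
proof -
  have "\<gamma> \<in> borel_measurable (restrict_space borel {s..t})"
    by (rule borel_measurable_continuous_on_restrict) fact
  then have "(\<lambda>\<tau>. g (\<gamma> \<tau>)) \<in> borel_measurable (restrict_space borel {s..t})"
    using assms(1) by (rule measurable_compose)
  then show ?thesis
    by (subst (asm) borel_measurable_restrict_space_iff_ennreal) auto
qed

lemma line_integral_mono: "(\<And>x. g x \<le> h x) \<Longrightarrow> line_integral g \<gamma> s t \<le> line_integral h \<gamma> s t"
  unfolding line_integral_def by (intro nn_integral_mono mult_right_mono) auto

lemma line_integral_mono_on:
  "(\<And>\<tau>. s \<le> \<tau> \<Longrightarrow> \<tau> \<le> t \<Longrightarrow> g (\<gamma> \<tau>) \<le> h (\<gamma> \<tau>)) \<Longrightarrow> line_integral g \<gamma> s t \<le> line_integral h \<gamma> s t"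
  unfolding line_integral_def by (intro nn_integral_mono) (auto simp: indicator_def)

lemma line_integral_mono_interval:
  "a \<le> s \<Longrightarrow> t \<le> b \<Longrightarrow> line_integral g \<gamma> s t \<le> line_integral g \<gamma> a b"
  unfolding line_integral_def by (intro nn_integral_mono mult_left_mono) (auto simp: indicator_def)

lemma line_integral_add_interval:
  assumes "s \<le> r" "r \<le> t" "g \<in> borel_measurable borel" "continuous_on {s..t} \<gamma>"
  shows "line_integral g \<gamma> s t = line_integral g \<gamma> s r + line_integral g \<gamma> r t"
proof -
  have *: "(\<lambda>\<tau>. g (\<gamma> \<tau>) * indicator {s..r} \<tau>) \<in> borel_measurable borel"
     "(\<lambda>\<tau>. g (\<gamma> \<tau>) * indicator {r..t} \<tau>) \<in> borel_measurable borel"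
    using assms by (auto intro!: line_integrand_measurable[of g _ _ \<gamma>] intro: continuous_on_subset[OF assms(4)])
  have "line_integral g \<gamma> s t
      = (\<integral>\<^sup>+\<tau>. (g (\<gamma> \<tau>) * indicator {s..r} \<tau> + g (\<gamma> \<tau>) * indicator {r..t} \<tau>) \<partial>lborel)"
    unfolding line_integral_def
    by (intro nn_integral_cong_AE, rule AE_mp[OF AE_lborel_singleton[of r]])
       (use assms(1,2) in \<open>auto simp: indicator_def\<close>)
  then show ?thesis unfolding line_integral_def using * by (simp add: nn_integral_add)
qed

lemma line_integral_add:
  assumes "g \<in> borel_measurable borel" "h \<in> borel_measurable borel" "continuous_on {s..t} \<gamma>"
  shows "line_integral (\<lambda>x. g x + h x) \<gamma> s t = line_integral g \<gamma> s t + line_integral h \<gamma> s t"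
  using line_integrand_measurable[OF assms(1,3)] line_integrand_measurable[OF assms(2,3)]
  unfolding line_integral_def by (simp add: distrib_right nn_integral_add)

lemma line_integral_cmult:
  assumes "g \<in> borel_measurable borel" "continuous_on {s..t} \<gamma>"
  shows "line_integral (\<lambda>x. c * g x) \<gamma> s t = c * line_integral g \<gamma> s t"
  using line_integrand_measurable[OF assms]
  unfolding line_integral_def by (subst nn_integral_cmult[symmetric]) (auto simp: mult.assoc)

lemma line_integral_sum:
  assumes "\<And>i. i \<in> I \<Longrightarrow> g i \<in> borel_measurable borel" "continuous_on {s..t} \<gamma>"
  shows "line_integral (\<lambda>x. \<Sum>i\<in>I. g i x) \<gamma> s t = (\<Sum>i\<in>I. line_integral (g i) \<gamma> s t)"
proof -
  have "(\<lambda>\<tau>. g i (\<gamma> \<tau>) * indicator {s..t} \<tau> :: ennreal) \<in> borel_measurable lborel" if "i \<in> I" for i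
    using line_integrand_measurable[OF assms(1)[OF that] assms(2)] by simp
  then show ?thesis
    unfolding line_integral_def sum_distrib_right by (rule nn_integral_sum)
qed

lemma line_integral_shift:
  assumes "g \<in> borel_measurable borel" "continuous_on {s..t} \<gamma>"
  shows "line_integral g (\<lambda>\<tau>. \<gamma> (s + \<tau>)) 0 (t - s) = line_integral g \<gamma> s t"
proof -
  have "line_integral g \<gamma> s t = (\<integral>\<^sup>+\<tau>. g (\<gamma> (s + 1 * \<tau>)) * indicator {s..t} (s + 1 * \<tau>) \<partial>lborel)"
    unfolding line_integral_def
    by (subst nn_integral_real_affine[OF line_integrand_measurable[OF assms], of 1 s]) simp_all
  also have "\<dots> = line_integral g (\<lambda>\<tau>. \<gamma> (s + \<tau>)) 0 (t - s)"
    unfolding line_integral_def by (intro nn_integral_cong) (auto simp: indicator_def)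
  finally show ?thesis ..
qed

lemma curve_length_shift:
  "curve_length (\<lambda>\<tau>. \<gamma> (s + \<tau>)) a b = curve_length \<gamma> (s + a) (s + b)"
proof (rule antisym)
  have le: "curve_length (\<lambda>\<tau>. \<gamma> (s + \<tau>)) a b \<le> curve_length \<gamma> (s + a) (s + b)"
    for \<gamma> :: "real \<Rightarrow> 'a" and s a b
    unfolding curve_length_def
  proof (rule SUP_mono, safe)
    fix ts :: "real list" assume ts: "sorted ts" "set ts \<subseteq> {a..b}"
    show "\<exists>m\<in>{ts. sorted ts \<and> set ts \<subseteq> {s + a..s + b}}.
       (\<Sum>i<length ts - 1. ennreal (dist (\<gamma> (s + ts ! i)) (\<gamma> (s + ts ! Suc i))))
       \<le> (\<Sum>i<length m - 1. ennreal (dist (\<gamma> (m ! i)) (\<gamma> (m ! Suc i))))"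
      using ts by (intro bexI[of _ "map ((+) s) ts"]) (auto simp: sorted_map)
  qed
  show "curve_length (\<lambda>\<tau>. \<gamma> (s + \<tau>)) a b \<le> curve_length \<gamma> (s + a) (s + b)"
    by (rule le)
  show "curve_length \<gamma> (s + a) (s + b) \<le> curve_length (\<lambda>\<tau>. \<gamma> (s + \<tau>)) a b"
    using le[of "\<lambda>\<tau>. \<gamma> (s + \<tau>)" "- s" "s + a" "s + b"] by simp
qed

lemma subcurve_in_curves_in:
  assumes "(l, \<gamma>) \<in> curves_in A" "0 \<le> s" "s < t" "t \<le> l"
  shows "(t - s, \<lambda>\<tau>. \<gamma> (s + \<tau>)) \<in> curves_in A"
proof -
  have \<gamma>: "continuous_on {0..l} \<gamma>" "\<gamma> ` {0..l} \<subseteq> A"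
    and len: "\<And>a b. 0 \<le> a \<Longrightarrow> a \<le> b \<Longrightarrow> b \<le> l \<Longrightarrow> curve_length \<gamma> a b = ennreal (b - a)"
    using assms(1) by (simp_all add: curves_in_def)
  have sub: "(+) s ` {0..t - s} \<subseteq> {0..l}" using assms by auto
  have "continuous_on {0..t - s} (\<lambda>\<tau>. \<gamma> (s + \<tau>))"
    by (rule continuous_on_compose2[OF \<gamma>(1) _ sub]) (intro continuous_intros)
  moreover have "(\<lambda>\<tau>. \<gamma> (s + \<tau>)) ` {0..t - s} \<subseteq> A"
    using \<gamma>(2) sub by (auto simp: image_subset_iff)
  ultimately show ?thesis
    using assms(2-4) len by (simp add: curves_in_def curve_length_shift)
qed

lemma curves_in_mono: "A \<subseteq> B \<Longrightarrow> curves_in A \<subseteq> curves_in B"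
  unfolding curves_in_def by blast

lemma curve_dist_le:
  assumes "(l, \<gamma>) \<in> curves_in A" "0 \<le> s" "s \<le> t" "t \<le> l"
  shows "dist (\<gamma> s) (\<gamma> t) \<le> t - s"
proof -
  have "(\<Sum>i<length [s, t] - 1. ennreal (dist (\<gamma> ([s, t] ! i)) (\<gamma> ([s, t] ! Suc i))))
      \<le> curve_length \<gamma> s t"
    unfolding curve_length_def using assms by (intro SUP_upper) auto
  then have "ennreal (dist (\<gamma> s) (\<gamma> t)) \<le> curve_length \<gamma> s t" by simp
  also have "curve_length \<gamma> s t = ennreal (t - s)" using assms by (auto simp: curves_in_def)
  finally show ?thesis using assms by (simp add: ennreal_le_iff)
qed

lemma curve_continuous:
  "(l, \<gamma>) \<in> curves_in A \<Longrightarrow> 0 \<le> s \<Longrightarrow> t \<le> l \<Longrightarrow> continuous_on {s..t} \<gamma>"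
  by (rule continuous_on_subset[of "{0..l}"]) (auto simp: curves_in_def)

lemma upper_gradient_measurable:
  "upper_gradient_on UNIV u g \<Longrightarrow> g \<in> borel_measurable borel"
  by (simp add: upper_gradient_on_def measurable_cong_sets[OF sets_restrict_UNIV refl])

text \<open>The inequality on every subcurve, not only between the end points. Arguments that cut a
  curve into pieces need this form, and it costs nothing: exceptional families can be taken closed
  under passing to supercurves.\<close>

definition ug_along :: "('a::metric_space \<Rightarrow> ereal) \<Rightarrow> ('a \<Rightarrow> ennreal) \<Rightarrow> real \<times> (real \<Rightarrow> 'a) \<Rightarrow> bool" where
  "ug_along u g c \<longleftrightarrow> (case c of (l, \<gamma>) \<Rightarrow>
     \<forall>s t. 0 \<le> s \<and> s < t \<and> t \<le> l \<longrightarrow> \<bar>u (\<gamma> s) - u (\<gamma> t)\<bar> \<le> enn2ereal (line_integral g \<gamma> s t))"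

lemma ug_along_of_subcurves:
  assumes "g \<in> borel_measurable borel" "(l, \<gamma>) \<in> curves_in A"
    and "\<And>s t. 0 \<le> s \<Longrightarrow> s < t \<Longrightarrow> t \<le> l \<Longrightarrow> ug_ineq u g (t - s, \<lambda>\<tau>. \<gamma> (s + \<tau>))"
  shows "ug_along u g (l, \<gamma>)"
  unfolding ug_along_def
proof (clarsimp)
  fix s t assume st: "0 \<le> s" "s < t" "t \<le> l"
  have "continuous_on {s..t} \<gamma>" using assms(2) st by (intro curve_continuous) auto
  then show "\<bar>u (\<gamma> s) - u (\<gamma> t)\<bar> \<le> enn2ereal (line_integral g \<gamma> s t)"
    using assms(3)[OF st] assms(1) st(2)
    by (simp add: ug_ineq_def curve_integral_eq line_integral_shift)
qed

lemma ug_along_upper_gradient: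
  assumes "upper_gradient_on UNIV u g" "c \<in> curves_in UNIV"
  shows "ug_along u g c"
proof (cases c)
  case (Pair l \<gamma>)
  with assms show ?thesis
    by (auto intro!: ug_along_of_subcurves[where A = UNIV] subcurve_in_curves_in
        simp: upper_gradient_on_def)
qed

lemma ug_along_imp_ug_ineq:
  "ug_along u g c \<Longrightarrow> c \<in> curves_in A \<Longrightarrow> ug_ineq u g c"
  by (auto simp: ug_along_def ug_ineq_def curves_in_def curve_integral_eq split: prod.splits)

text \<open>By the convention for infinite values, one infinite value of \<open>u\<close> on the
  curve would make the left-hand side of some inequality infinite, against the finite line
  integral.\<close>

lemma ug_along_finite:
  assumes "ug_along u g (l, \<gamma>)" "(l, \<gamma>) \<in> curves_in A" "line_integral g \<gamma> 0 l < \<infinity>"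
    and t: "0 \<le> t" "t \<le> l"
  shows "\<bar>u (\<gamma> t)\<bar> \<noteq> \<infinity>"
proof -
  have l: "0 < l" using assms(2) by (auto simp: curves_in_def)
  \<comment> \<open>The inequality is available only on nondegenerate subintervals, so
    \<open>t\<close> is made an end point of one.\<close>
  obtain a b where ab: "0 \<le> a" "a < b" "b \<le> l" "t = a \<or> t = b"
    using l t by (cases "t = 0") (force, metis order_le_less)
  have "\<bar>u (\<gamma> a) - u (\<gamma> b)\<bar> \<le> enn2ereal (line_integral g \<gamma> a b)"
    using assms(1) ab by (auto simp: ug_along_def)
  also have "\<dots> \<le> enn2ereal (line_integral g \<gamma> 0 l)"
    using ab by (simp add: less_eq_ennreal.rep_eq[symmetric] line_integral_mono_interval)
  also have "\<dots> < \<infinity>" using assms(3) by (metis enn2ereal_top infinity_ennreal_def less_ennreal.rep_eq)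
  finally show ?thesis using ab(4) by (cases "u (\<gamma> a)"; cases "u (\<gamma> b)") auto
qed

lemma ug_along_real:
  assumes "ug_along u g (l, \<gamma>)" "(l, \<gamma>) \<in> curves_in A" "line_integral g \<gamma> 0 l < \<infinity>"
    and st: "0 \<le> s" "s \<le> t" "t \<le> l"
  shows "ennreal \<bar>real_of_ereal (u (\<gamma> t)) - real_of_ereal (u (\<gamma> s))\<bar> \<le> line_integral g \<gamma> s t"
proof (cases "s = t")
  case False
  have "\<bar>u (\<gamma> s)\<bar> \<noteq> \<infinity>" "\<bar>u (\<gamma> t)\<bar> \<noteq> \<infinity>" using ug_along_finite[OF assms(1-3)] st by auto
  moreover have "\<bar>u (\<gamma> s) - u (\<gamma> t)\<bar> \<le> enn2ereal (line_integral g \<gamma> s t)"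
    using assms(1) st False by (auto simp: ug_along_def)
  ultimately have "ereal \<bar>real_of_ereal (u (\<gamma> t)) - real_of_ereal (u (\<gamma> s))\<bar>
      \<le> enn2ereal (line_integral g \<gamma> s t)"
    by (cases "u (\<gamma> s)"; cases "u (\<gamma> t)") (auto simp: abs_minus_commute)
  then show ?thesis by (simp add: less_eq_ennreal.rep_eq enn2ereal_ennreal)
qed simp

lemma ug_alongI_real:
  assumes "(l, \<gamma>) \<in> curves_in A"
    and "\<And>t. 0 \<le> t \<Longrightarrow> t \<le> l \<Longrightarrow> \<bar>u (\<gamma> t)\<bar> \<noteq> \<infinity>"
    and "\<And>s t. 0 \<le> s \<Longrightarrow> s \<le> t \<Longrightarrow> t \<le> l \<Longrightarrow>
      ennreal \<bar>real_of_ereal (u (\<gamma> t)) - real_of_ereal (u (\<gamma> s))\<bar> \<le> line_integral g \<gamma> s t"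
  shows "ug_along u g (l, \<gamma>)"
  unfolding ug_along_def
proof clarsimp
  fix s t assume st: "0 \<le> s" "s < t" "t \<le> l"
  have "\<bar>u (\<gamma> s)\<bar> \<noteq> \<infinity>" "\<bar>u (\<gamma> t)\<bar> \<noteq> \<infinity>" using assms(2) st by auto
  moreover have "ereal \<bar>real_of_ereal (u (\<gamma> t)) - real_of_ereal (u (\<gamma> s))\<bar>
      \<le> enn2ereal (line_integral g \<gamma> s t)"
    using assms(3)[of s t] st by (simp add: less_eq_ennreal.rep_eq enn2ereal_ennreal)
  ultimately show "\<bar>u (\<gamma> s) - u (\<gamma> t)\<bar> \<le> enn2ereal (line_integral g \<gamma> s t)"
    by (cases "u (\<gamma> s)"; cases "u (\<gamma> t)") (auto simp: abs_minus_commute)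
qed

section \<open>The minimum of two upper gradients along a curve\<close>

text \<open>
  On the intervals of a partition which is fine in the sense of Henstock's lemma, the smaller of the
  integrals of \<open>h1\<close> and \<open>h2\<close> is close to the integral of their minimum; no differentiation of \<open>f\<close> is
  involved.
\<close>

lemma abs_diff_le_integral_min:
  fixes f h1 h2 :: "real \<Rightarrow> real"
  assumes "a \<le> b"
    and int: "h1 integrable_on {a..b}" "h2 integrable_on {a..b}"
      "(\<lambda>t. min (h1 t) (h2 t)) integrable_on {a..b}"
    and bound: "\<And>s t. a \<le> s \<Longrightarrow> s \<le> t \<Longrightarrow> t \<le> b \<Longrightarrow> \<bar>f t - f s\<bar> \<le> integral {s..t} h1"
      "\<And>s t. a \<le> s \<Longrightarrow> s \<le> t \<Longrightarrow> t \<le> b \<Longrightarrow> \<bar>f t - f s\<bar> \<le> integral {s..t} h2"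
  shows "\<bar>f b - f a\<bar> \<le> integral {a..b} (\<lambda>t. min (h1 t) (h2 t))"
proof (rule field_le_epsilon)
  fix e :: real assume e: "0 < e"
  define m where "m = (\<lambda>t. min (h1 t) (h2 t))"
  have m: "m integrable_on {a..b}" using int(3) by (simp add: m_def)
  have e3: "0 < e / 3" using e by simp
  define err :: "(real \<Rightarrow> real) \<Rightarrow> real \<times> real set \<Rightarrow> real"
    where "err h = (\<lambda>(x, K). norm (measure lborel K *\<^sub>R h x - integral K h))" for h
  have "\<exists>d. gauge d \<and> (\<forall>q. q tagged_division_of {a..b} \<and> d fine q \<longrightarrow> sum (err h) q < e / 3)"
    if h: "h integrable_on {a..b}" for h
  proof -
    obtain d where "gauge d" "\<And>q. q tagged_partial_division_of (cbox a b) \<Longrightarrow> d fine q \<Longrightarrow>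
             sum (\<lambda>(x,k). norm (measure lborel k *\<^sub>R h x - integral k h)) q < e / 3"
      using Henstock_lemma[of h a b "e / 3"] h e3 by (auto simp: cbox_interval)
    then show ?thesis
      by (intro exI[of _ d]) (auto simp: err_def cbox_interval tagged_division_of_def)
  qed
  from this[OF int(1)] this[OF int(2)] this[OF m]
  obtain d1 d2 d3 where g: "gauge d1" "gauge d2" "gauge d3"
    and d: "\<And>q. q tagged_division_of {a..b} \<Longrightarrow> d1 fine q \<Longrightarrow> sum (err h1) q < e / 3"
      "\<And>q. q tagged_division_of {a..b} \<Longrightarrow> d2 fine q \<Longrightarrow> sum (err h2) q < e / 3"
      "\<And>q. q tagged_division_of {a..b} \<Longrightarrow> d3 fine q \<Longrightarrow> sum (err m) q < e / 3"
    by metis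
  have "gauge (\<lambda>x. d1 x \<inter> d2 x \<inter> d3 x)" using g by (intro gauge_Int)
  then obtain q where q: "q tagged_division_of (cbox a b)" "(\<lambda>x. d1 x \<inter> d2 x \<inter> d3 x) fine q"
    by (rule fine_division_exists)
  have q': "q tagged_division_of {a..b}" using q(1) by (simp add: cbox_interval)
  have fine: "d1 fine q" "d2 fine q" "d3 fine q" using q(2) by (auto simp: fine_Int)
  have "\<bar>f b - f a\<bar> = \<bar>\<Sum>(x, K)\<in>q. f (Sup K) - f (Inf K)\<bar>"
    by (simp add: additive_tagged_division_1[OF assms(1) q'])
  also have "\<dots> \<le> (\<Sum>(x, K)\<in>q. \<bar>f (Sup K) - f (Inf K)\<bar>)"
    by (rule order_trans[OF sum_abs]) (simp add: case_prod_beta)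
  also have "\<dots> \<le> (\<Sum>z\<in>q. integral (snd z) m + (err h1 z + err h2 z + err m z))"
  proof (rule sum_mono, clarify)
    fix x K assume xK: "(x, K) \<in> q"
    then obtain s t where K: "K = cbox s t" "x \<in> K" "K \<subseteq> {a..b}"
      using q' by (metis tagged_division_ofD(2,3,4))
    then have st: "K = {s..t}" "s \<le> t" "a \<le> s" "t \<le> b" by (auto simp: cbox_interval)
    have c: "measure lborel K \<ge> 0" by simp
    have "\<bar>f t - f s\<bar> \<le> integral K h1" "\<bar>f t - f s\<bar> \<le> integral K h2" using bound st by auto
    moreover have "measure lborel K * m x = min (measure lborel K * h1 x) (measure lborel K * h2 x)"
      using c by (simp add: m_def min_mult_distrib_left)
    \<comment> \<open>At the tag \<open>x\<close> the minimum is one of the two values. The bound by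
      the corresponding integral is moved to the integral of \<open>m\<close> through this common
      tag value, at the cost of two Henstock errors.\<close>
    ultimately have "\<bar>f t - f s\<bar> \<le> integral K m + (\<bar>measure lborel K * h1 x - integral K h1\<bar>
        + \<bar>measure lborel K * h2 x - integral K h2\<bar> + \<bar>measure lborel K * m x - integral K m\<bar>)"
      by (auto simp: min_def split: if_splits)
    then show "\<bar>f (Sup K) - f (Inf K)\<bar>
        \<le> integral (snd (x, K)) m + (err h1 (x, K) + err h2 (x, K) + err m (x, K))"
      using st by (simp add: err_def)
  qed
  also have "\<dots> = (\<Sum>(x, K)\<in>q. integral K m) + (sum (err h1) q + sum (err h2) q + sum (err m) q)"
    by (simp add: sum.distrib case_prod_beta)
  also have "(\<Sum>(x, K)\<in>q. integral K m) = integral {a..b} m"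
    using integral_combine_tagged_division_topdown[of m a b q] m q(1) by (simp add: cbox_interval)
  also have "sum (err h1) q + sum (err h2) q + sum (err m) q \<le> e"
    using d[OF q'] fine by fastforce
  finally show "\<bar>f b - f a\<bar> \<le> integral {a..b} (\<lambda>t. min (h1 t) (h2 t)) + e"
    by (simp add: m_def)
qed

text \<open>Bridge from the Lebesgue integral of extended functions to the gauge integral, where
  Henstock's lemma lives. \<open>enn2real\<close> sends infinity to 0, which is harmless because a
  finite integral confines infinite values to a null set.\<close>

lemma finite_nn_integral_imp_integral:
  fixes h :: "real \<Rightarrow> ennreal"
  assumes meas: "(\<lambda>t. h t * indicator {a..b} t) \<in> borel_measurable borel"
    and fin: "(\<integral>\<^sup>+t. h t * indicator {a..b} t \<partial>lborel) < \<infinity>"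
    and st: "a \<le> s" "t \<le> b"
  shows "(\<lambda>x. enn2real (h x)) integrable_on {s..t}"
    and "(\<integral>\<^sup>+x. h x * indicator {s..t} x \<partial>lborel) = ennreal (integral {s..t} (\<lambda>x. enn2real (h x)))"
proof -
  have eq: "h x * indicator {s..t} x = (h x * indicator {a..b} x) * indicator {s..t} x" for x
    using st by (auto simp: indicator_def)
  have meas': "(\<lambda>x. h x * indicator {s..t} x) \<in> borel_measurable borel"
    unfolding eq using meas by measurable
  have "(\<integral>\<^sup>+x. h x * indicator {s..t} x \<partial>lborel) \<le> (\<integral>\<^sup>+x. h x * indicator {a..b} x \<partial>lborel)"
    using st by (intro nn_integral_mono) (auto simp: indicator_def)
  then have fin': "(\<integral>\<^sup>+x. h x * indicator {s..t} x \<partial>lborel) < \<infinity>" using fin by order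
  have "AE x in lborel. h x * indicator {s..t} x \<noteq> \<infinity>"
    by (rule nn_integral_noteq_infinite) (use meas' fin' in auto)
  then have ae: "AE x in lborel. h x * indicator {s..t} x = ennreal (indicator {s..t} x * enn2real (h x))"
    by eventually_elim (auto simp: indicator_def less_top)
  have "(\<integral>\<^sup>+x. ennreal (indicator {s..t} x * enn2real (h x)) \<partial>lborel)
      = (\<integral>\<^sup>+x. h x * indicator {s..t} x \<partial>lborel)"
    using ae by (intro nn_integral_cong_AE) (auto elim: eventually_mono)
  moreover have "(\<lambda>x. indicator {s..t} x * enn2real (h x)) \<in> borel_measurable borel"
  proof -
    have "(\<lambda>x. indicator {s..t} x * enn2real (h x)) = (\<lambda>x. enn2real (h x * indicator {s..t} x))"
      by (auto simp: indicator_def)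
    then show ?thesis using meas' by simp
  qed
  ultimately have int: "integrable lborel (\<lambda>x. indicator {s..t} x * enn2real (h x))"
    and ieq: "(\<integral>x. indicator {s..t} x * enn2real (h x) \<partial>lborel)
      = enn2real (\<integral>\<^sup>+x. h x * indicator {s..t} x \<partial>lborel)"
    using fin' by (auto simp: integrable_iff_bounded integral_eq_nn_integral)
  have set: "set_integrable lborel {s..t} (\<lambda>x. enn2real (h x))"
    using int by (simp add: set_integrable_def)
  show "(\<lambda>x. enn2real (h x)) integrable_on {s..t}"
    using set_borel_integral_eq_integral(1)[OF set] .
  show "(\<integral>\<^sup>+x. h x * indicator {s..t} x \<partial>lborel) = ennreal (integral {s..t} (\<lambda>x. enn2real (h x)))"
  proof -
    have "integral {s..t} (\<lambda>x. enn2real (h x)) = enn2real (\<integral>\<^sup>+x. h x * indicator {s..t} x \<partial>lborel)"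
      using set_borel_integral_eq_integral(2)[OF set] ieq by (simp add: set_lebesgue_integral_def)
    with fin' show ?thesis by simp
  qed
qed

text \<open>The lattice property on one curve. Finite line integrals make both integrands real
  almost everywhere on the parameter interval, as the gauge-integral estimate requires.\<close>

lemma ug_along_min:
  assumes c: "(l, \<gamma>) \<in> curves_in A"
    and ug: "ug_along v g1 (l, \<gamma>)" "ug_along v g2 (l, \<gamma>)"
    and g: "g1 \<in> borel_measurable borel" "g2 \<in> borel_measurable borel"
    and fin: "line_integral g1 \<gamma> 0 l < \<infinity>" "line_integral g2 \<gamma> 0 l < \<infinity>"
  shows "ug_along v (\<lambda>x. min (g1 x) (g2 x)) (l, \<gamma>)"
proof (rule ug_alongI_real[OF c])
  show "\<bar>v (\<gamma> t)\<bar> \<noteq> \<infinity>" if "0 \<le> t" "t \<le> l" for t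
    using ug_along_finite[OF ug(1) c fin(1) that] .
next
  fix s t assume st: "0 \<le> s" "s \<le> t" "t \<le> l"
  have meas: "(\<lambda>\<tau>. g (\<gamma> \<tau>) * indicator {0..l} \<tau> :: ennreal) \<in> borel_measurable borel"
    if "g \<in> borel_measurable borel" for g
    using c that by (intro line_integrand_measurable) (auto simp: curves_in_def)
  have gm: "(\<lambda>x. min (g1 x) (g2 x)) \<in> borel_measurable borel" using g by measurable
  have finm: "line_integral (\<lambda>x. min (g1 x) (g2 x)) \<gamma> 0 l < \<infinity>"
    by (rule le_less_trans[OF line_integral_mono fin(1)]) auto
  define f where "f \<tau> = real_of_ereal (v (\<gamma> \<tau>))" for \<tau>
  have I: "(\<lambda>\<tau>. enn2real (g (\<gamma> \<tau>))) integrable_on {a..b}"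
    "line_integral g \<gamma> a b = ennreal (integral {a..b} (\<lambda>\<tau>. enn2real (g (\<gamma> \<tau>))))"
    if "g \<in> borel_measurable borel" "line_integral g \<gamma> 0 l < \<infinity>" "0 \<le> a" "b \<le> l" for g a b
    using finite_nn_integral_imp_integral[OF meas[OF that(1)] _ that(3,4)] that(2)
    by (simp_all add: line_integral_def)
  have nonneg: "0 \<le> integral {a..b} (\<lambda>\<tau>. enn2real (g (\<gamma> \<tau>)))" for a b g
    by (cases "(\<lambda>\<tau>. enn2real (g (\<gamma> \<tau>))) integrable_on {a..b}")
       (auto intro: integral_nonneg simp: not_integrable_integral)
  \<comment> \<open>\<open>enn2real\<close> does not commute with \<open>min\<close> where one value
    is infinite, since infinity becomes 0. The two integrands therefore agree only off a null
    set.\<close>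
  have fin_eq: "integral {s..t} (\<lambda>\<tau>. enn2real (min (g1 (\<gamma> \<tau>)) (g2 (\<gamma> \<tau>))))
      = integral {s..t} (\<lambda>\<tau>. min (enn2real (g1 (\<gamma> \<tau>))) (enn2real (g2 (\<gamma> \<tau>))))"
    and min_int: "(\<lambda>\<tau>. min (enn2real (g1 (\<gamma> \<tau>))) (enn2real (g2 (\<gamma> \<tau>)))) integrable_on {s..t}"
  proof -
    have ae: "AE \<tau> in lborel. g (\<gamma> \<tau>) * indicator {0..l} \<tau> \<noteq> \<infinity>"
      if "g \<in> borel_measurable borel" "line_integral g \<gamma> 0 l < \<infinity>" for g
      by (rule nn_integral_noteq_infinite)
         (use meas[OF that(1)] that(2) in \<open>auto simp: line_integral_def\<close>)
    have "AE \<tau> in lborel. \<tau> \<in> {s..t} \<longrightarrow> g1 (\<gamma> \<tau>) \<noteq> \<infinity> \<and> g2 (\<gamma> \<tau>) \<noteq> \<infinity>"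
      using ae[OF g(1) fin(1)] ae[OF g(2) fin(2)] by eventually_elim (use st in auto)
    then obtain Z where Z: "Z \<in> null_sets lborel" "{\<tau>. \<not> (\<tau> \<in> {s..t} \<longrightarrow> g1 (\<gamma> \<tau>) \<noteq> \<infinity> \<and> g2 (\<gamma> \<tau>) \<noteq> \<infinity>)} \<subseteq> Z"
      unfolding eventually_ae_filter by auto
    have neg: "negligible Z" using Z(1) null_sets_completionI[of Z lborel] by (simp add: negligible_iff_null_sets)
    have eq: "enn2real (min (g1 (\<gamma> \<tau>)) (g2 (\<gamma> \<tau>))) = min (enn2real (g1 (\<gamma> \<tau>))) (enn2real (g2 (\<gamma> \<tau>)))"
      if "\<tau> \<in> {s..t} - Z" for \<tau>
    proof -
      have "g1 (\<gamma> \<tau>) \<noteq> \<infinity>" "g2 (\<gamma> \<tau>) \<noteq> \<infinity>" using that Z(2) by auto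
      then show ?thesis
        by (cases "g1 (\<gamma> \<tau>)"; cases "g2 (\<gamma> \<tau>)") (auto simp: min_def)
    qed
    show "integral {s..t} (\<lambda>\<tau>. enn2real (min (g1 (\<gamma> \<tau>)) (g2 (\<gamma> \<tau>))))
      = integral {s..t} (\<lambda>\<tau>. min (enn2real (g1 (\<gamma> \<tau>))) (enn2real (g2 (\<gamma> \<tau>))))"
      by (rule integral_spike[OF neg]) (simp add: eq)
    show "(\<lambda>\<tau>. min (enn2real (g1 (\<gamma> \<tau>))) (enn2real (g2 (\<gamma> \<tau>)))) integrable_on {s..t}"
      by (rule integrable_spike[OF I(1)[OF gm finm] neg]) (use st in \<open>simp_all add: eq\<close>)
  qed
  have "\<bar>f t - f s\<bar> \<le> integral {s..t} (\<lambda>\<tau>. min (enn2real (g1 (\<gamma> \<tau>))) (enn2real (g2 (\<gamma> \<tau>))))"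
  proof (rule abs_diff_le_integral_min[OF st(2) I(1)[OF g(1) fin(1) st(1,3)] I(1)[OF g(2) fin(2) st(1,3)] min_int])
    fix a b assume ab: "s \<le> a" "a \<le> b" "b \<le> t"
    have "ennreal \<bar>f b - f a\<bar> \<le> line_integral g1 \<gamma> a b" "ennreal \<bar>f b - f a\<bar> \<le> line_integral g2 \<gamma> a b"
      using ug_along_real[OF ug(1) c fin(1)] ug_along_real[OF ug(2) c fin(2)] ab st
      by (auto simp: f_def)
    then show "\<bar>f b - f a\<bar> \<le> integral {a..b} (\<lambda>\<tau>. enn2real (g1 (\<gamma> \<tau>)))"
      "\<bar>f b - f a\<bar> \<le> integral {a..b} (\<lambda>\<tau>. enn2real (g2 (\<gamma> \<tau>)))"
      using I(2)[OF g(1) fin(1), of a b] I(2)[OF g(2) fin(2), of a b] ab st nonneg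
      by (auto simp: ennreal_le_iff)
  qed
  then show "ennreal \<bar>real_of_ereal (v (\<gamma> t)) - real_of_ereal (v (\<gamma> s))\<bar>
      \<le> line_integral (\<lambda>x. min (g1 x) (g2 x)) \<gamma> s t"
    using I(2)[OF gm finm st(1,3)] fin_eq by (simp add: f_def ennreal_leI)
qed

section \<open>Exceptional curve families and minimal weak upper gradients\<close>

lemma suminf_half_power: "(\<Sum>j. ennreal ((1/2) ^ j)) = ennreal 2"
proof -
  have "(\<Sum>j. ennreal ((1/2) ^ j)) = ennreal (\<Sum>j. (1/2) ^ j)"
    by (intro suminf_ennreal2 summable_geometric) auto
  also have "(\<Sum>j. (1/2 :: real) ^ j) = 2" by (simp add: suminf_geometric)
  finally show ?thesis .
qed

text \<open>Multiplying a function of energy \<open>J\<close> by the p-th root of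
  \<open>a / (J + 1)\<close> brings its energy down to at most \<open>a\<close>; the added 1 covers
  \<open>J = 0\<close>.\<close>

lemma divide_add_one_mult_le:
  fixes a J :: real
  assumes "0 \<le> a" "0 \<le> J"
  shows "a / (J + 1) * J \<le> a"
  using assms by (simp add: divide_le_eq distrib_left)

section \<open>Doubling measures and Borel representatives\<close>

locale doubling_space =
  fixes M :: "'a::metric_space measure" and p C :: real
  assumes p_gt_1: "1 < p"
    and complete_borel: "complete_borel_measure M"
    and ball_measure: "r > 0 \<Longrightarrow> 0 < emeasure M (ball x r) \<and> emeasure M (ball x r) < \<infinity>"
    and C_pos: "0 < C"
    and doubling: "r > 0 \<Longrightarrow> emeasure M (ball x (2 * r)) \<le> ennreal C * emeasure M (ball x r)"
begin

lemma p_pos: "0 < p" and p_nonneg: "0 \<le> p" and p_neq_0: "p \<noteq> 0"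
  using p_gt_1 by auto

abbreviation energy :: "('a \<Rightarrow> ennreal) \<Rightarrow> ennreal" where
  "energy g \<equiv> (\<integral>\<^sup>+x. epowr (g x) p \<partial>M)"

abbreviation energy_on :: "'a set \<Rightarrow> ('a \<Rightarrow> ennreal) \<Rightarrow> ennreal" where
  "energy_on A g \<equiv> (\<integral>\<^sup>+x\<in>A. epowr (g x) p \<partial>M)"

lemma borel_base:
  obtains N where "sets N = sets (borel :: 'a measure)" "M = completion N"
  using complete_borel unfolding complete_borel_measure_def by blast

lemma sets_borel_subset: "sets borel \<subseteq> sets M"
  using complete_borel unfolding complete_borel_measure_def by auto

lemma space_M [simp]: "space M = UNIV"
proof -
  obtain N where N: "sets N = sets (borel :: 'a measure)" "M = completion N"
    by (rule borel_base)
  from sets_eq_imp_space_eq[OF N(1)] N(2) show ?thesis by simp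
qed

lemma borel_imp_measurable: "f \<in> measurable borel A \<Longrightarrow> f \<in> measurable M A"
  using sets_borel_subset unfolding measurable_def by auto

lemma borel_sets_M: "A \<in> sets borel \<Longrightarrow> A \<in> sets M"
  using sets_borel_subset by auto

lemma ball_sets [measurable, simp]: "ball x r \<in> sets M"
  by (intro borel_sets_M) simp

lemma open_sets_M: "open A \<Longrightarrow> A \<in> sets M"
  by (intro borel_sets_M) simp

lemma ball_neq_0: "r > 0 \<Longrightarrow> emeasure M (ball x r) \<noteq> 0"
  and ball_neq_top: "r > 0 \<Longrightarrow> emeasure M (ball x r) \<noteq> top"
  using ball_measure[of r x] by auto

lemma ball_finite: "emeasure M (ball x r) < \<infinity>"
  using ball_measure[of r x] by (cases "r > 0") (auto simp: ball_empty)

lemma measure_ball_pos: "r > 0 \<Longrightarrow> 0 < measure M (ball x r)"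
  using ball_measure[of r x] by (simp add: measure_def enn2real_positive_iff)

lemma emeasure_ball: "emeasure M (ball x r) = ennreal (measure M (ball x r))"
  using ball_finite[of x r] by (intro emeasure_eq_ennreal_measure) auto

lemma sigma_finite: "sigma_finite_measure M"
proof
  fix x :: 'a
  show "\<exists>A. countable A \<and> A \<subseteq> sets M \<and> \<Union> A = space M \<and> (\<forall>a\<in>A. emeasure M a \<noteq> \<infinity>)"
  proof (intro exI[of _ "range (\<lambda>n. ball x (real n))"] conjI ballI)
    show "\<Union> (range (\<lambda>n. ball x (real n))) = space M"
      using reals_Archimedean2 by auto
  qed (use ball_finite[of x] in \<open>auto simp: less_top\<close>)
qed

lemma AE_borel_null_set:
  assumes "AE x in M. P x"
  obtains Z where "Z \<in> sets borel" "emeasure M Z = 0" "\<And>x. x \<notin> Z \<Longrightarrow> P x"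
proof -
  obtain N where N: "sets N = sets (borel :: 'a measure)" "M = completion N"
    by (rule borel_base)
  from assms have "AE x in N. P x" unfolding N(2) AE_completion_iff .
  then obtain Z where "Z \<in> null_sets N" "{x \<in> space N. \<not> P x} \<subseteq> Z"
    unfolding eventually_ae_filter by auto
  moreover have "space N = UNIV" using sets_eq_imp_space_eq[OF N(1)] by simp
  ultimately show thesis
    using N emeasure_completion[of Z N] by (intro that[of Z]) (auto simp: null_sets_def main_part_sets)
qed

text \<open>Composition with a curve preserves Borel measurability but not measurability for the
  completion. A majorant is produced, infinite on a Borel null set, because enlarging a function
  keeps the upper gradient inequality on each curve, while an arbitrary change on a null set might
  not.\<close>

lemma borel_majorant:
  fixes h :: "'a \<Rightarrow> ennreal"
  assumes "h \<in> borel_measurable M"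
  obtains h' where "h' \<in> borel_measurable borel" "\<And>x. h x \<le> h' x" "AE x in M. h x = h' x"
proof -
  obtain N where N: "sets N = sets (borel :: 'a measure)" "M = completion N"
    by (rule borel_base)
  obtain g where g: "g \<in> borel_measurable N" "AE x in N. h x = g x"
    using completion_ex_borel_measurable[OF assms[unfolded N(2)]] by blast
  from g(2) have "AE x in M. h x = g x" unfolding N(2) AE_completion_iff .
  from AE_borel_null_set[OF this] obtain Z
    where Z: "Z \<in> sets borel" "emeasure M Z = 0" "\<And>x. x \<notin> Z \<Longrightarrow> h x = g x" by metis
  have g': "g \<in> borel_measurable borel" using g(1) measurable_cong_sets[OF N(1) refl] by blast
  show thesis
  proof
    show "(\<lambda>x. if x \<in> Z then \<infinity> else g x) \<in> borel_measurable borel"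
      using g' Z(1) by measurable
    show "h x \<le> (if x \<in> Z then \<infinity> else g x)" for x using Z(3)[of x] by auto
    have "AE x in M. x \<notin> Z" using Z(1,2) borel_sets_M by (intro AE_not_in) auto
    then show "AE x in M. h x = (if x \<in> Z then \<infinity> else g x)"
      by eventually_elim (simp add: Z(3))
  qed
qed

section \<open>Properties of almost every curve\<close>

definition Lp :: "('a \<Rightarrow> ennreal) \<Rightarrow> bool" where
  "Lp g \<longleftrightarrow> g \<in> borel_measurable borel \<and> energy g < \<infinity>"

text \<open>
  Families of modulus zero are exactly those on which some \<open>L\<^sup>p\<close> function has infinite line integrals.
  This form is stable under countable unions and under passing to supercurves.
\<close>

definition ae_curve :: "(real \<times> (real \<Rightarrow> 'a) \<Rightarrow> bool) \<Rightarrow> bool" where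
  "ae_curve P \<longleftrightarrow> (\<exists>\<rho>. Lp \<rho> \<and> (\<forall>c\<in>curves_in UNIV. curve_integral c \<rho> < \<infinity> \<longrightarrow> P c))"

lemma LpD: "Lp g \<Longrightarrow> g \<in> borel_measurable borel" "Lp g \<Longrightarrow> energy g < \<infinity>"
  by (auto simp: Lp_def)

lemma Lp_measurable: "Lp g \<Longrightarrow> (\<lambda>x. epowr (g x) p) \<in> borel_measurable M"
  by (intro borel_imp_measurable measurable_epowr LpD)

lemma curve_integral_cmult:
  assumes "c \<in> curves_in UNIV" "g \<in> borel_measurable borel"
  shows "curve_integral c (\<lambda>x. k * g x) = k * curve_integral c g"
proof (cases c)
  case (Pair l \<gamma>)
  with assms show ?thesis
    by (auto simp: curve_integral_eq curves_in_def intro!: line_integral_cmult)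
qed

lemma curve_integral_mono: "(\<And>x. g x \<le> h x) \<Longrightarrow> curve_integral c g \<le> curve_integral c h"
  by (cases c) (simp add: curve_integral_eq line_integral_mono)

lemma Lp_cmult:
  assumes "Lp g" "k < \<infinity>"
  shows "Lp (\<lambda>x. k * g x)" "(\<integral>\<^sup>+x. epowr (k * g x) p \<partial>M) = epowr k p * energy g"
proof -
  show eq: "(\<integral>\<^sup>+x. epowr (k * g x) p \<partial>M) = epowr k p * energy g"
    using Lp_measurable[OF assms(1)] by (simp add: epowr_mult p_pos nn_integral_cmult)
  have "epowr k p * energy g < \<infinity>"
    using assms by (simp add: Lp_def ennreal_mult_less_top epowr_less_top_iff)
  then show "Lp (\<lambda>x. k * g x)"
    using assms(1) eq unfolding Lp_def by auto
qed

lemma Lp_mono: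
  assumes "Lp g" "h \<in> borel_measurable borel" "\<And>x. h x \<le> g x"
  shows "Lp h"
proof -
  have "energy h \<le> energy g"
    by (intro nn_integral_mono epowr_mono assms p_nonneg)
  with assms show ?thesis by (auto simp: Lp_def)
qed

lemma Lp_add:
  assumes "Lp g" "Lp h" shows "Lp (\<lambda>x. g x + h x)"
proof -
  note [measurable] = Lp_measurable[OF assms(1)] Lp_measurable[OF assms(2)]
  have "(\<integral>\<^sup>+x. epowr (g x + h x) p \<partial>M)
      \<le> (\<integral>\<^sup>+x. ennreal (2 powr p) * (epowr (g x) p + epowr (h x) p) \<partial>M)"
    by (intro nn_integral_mono epowr_add_le p_pos)
  also have "\<dots> = ennreal (2 powr p) * (energy g + energy h)"
    by (simp add: nn_integral_cmult nn_integral_add)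
  also have "\<dots> < \<infinity>"
    using assms by (simp add: Lp_def ennreal_mult_less_top)
  finally show ?thesis using assms by (auto simp: Lp_def)
qed

lemma Lp_zero: "Lp (\<lambda>x. 0)"
  by (simp add: Lp_def)

lemma Lp_SUP:
  assumes "\<And>n. \<rho> n \<in> borel_measurable borel"
    and "\<And>n. energy (\<rho> n) \<le> ennreal ((1/2) ^ n)"
  shows "Lp (\<lambda>x. SUP n. \<rho> n x)"
proof -
  have [measurable]: "(\<lambda>x. epowr (\<rho> n x) p) \<in> borel_measurable M" for n
    by (intro borel_imp_measurable measurable_epowr assms)
  have "(\<integral>\<^sup>+x. epowr (SUP n. \<rho> n x) p \<partial>M) \<le> (\<integral>\<^sup>+x. (\<Sum>n. epowr (\<rho> n x) p) \<partial>M)"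
    by (intro nn_integral_mono epowr_SUP_le p_pos)
  also have "\<dots> = (\<Sum>n. \<integral>\<^sup>+x. epowr (\<rho> n x) p \<partial>M)"
    by (simp add: nn_integral_suminf)
  also have "\<dots> \<le> (\<Sum>n. ennreal ((1/2) ^ n))"
    by (intro suminf_le assms) auto
  also have "\<dots> < \<infinity>" by (simp only: suminf_half_power) simp
  finally show ?thesis using assms(1) by (auto simp: Lp_def)
qed

lemma ae_curve_mono: "ae_curve P \<Longrightarrow> (\<And>c. c \<in> curves_in UNIV \<Longrightarrow> P c \<Longrightarrow> Q c) \<Longrightarrow> ae_curve Q"
  unfolding ae_curve_def by blast

lemma ae_curve_I: "Lp \<rho> \<Longrightarrow> (\<And>c. c \<in> curves_in UNIV \<Longrightarrow> curve_integral c \<rho> < \<infinity> \<Longrightarrow> P c) \<Longrightarrow> ae_curve P"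
  unfolding ae_curve_def by blast

lemma ae_curve_finite: "Lp g \<Longrightarrow> ae_curve (\<lambda>c. curve_integral c g < \<infinity>)"
  unfolding ae_curve_def by blast

text \<open>Each witness is multiplied by a positive constant that makes its energy at most
  \<open>(1/2) ^ n\<close>. The supremum then still has finite energy, and a finite line integral of
  it forces finite line integrals of all witnesses.\<close>

lemma ae_curve_all_nat:
  fixes P :: "nat \<Rightarrow> real \<times> (real \<Rightarrow> 'a) \<Rightarrow> bool"
  assumes "\<And>n. ae_curve (P n)"
  shows "ae_curve (\<lambda>c. \<forall>n. P n c)"
proof -
  obtain \<rho> where \<rho>: "\<And>n. Lp (\<rho> n)"
    "\<And>n c. c \<in> curves_in UNIV \<Longrightarrow> curve_integral c (\<rho> n) < \<infinity> \<Longrightarrow> P n c"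
    using assms unfolding ae_curve_def by metis
  define J where "J n = enn2real (energy (\<rho> n))" for n
  have J: "energy (\<rho> n) = ennreal (J n)" "0 \<le> J n" for n
    using LpD(2)[OF \<rho>(1)[of n]] by (simp_all add: J_def)
  define k where "k n = ((1/2) ^ n / (J n + 1)) powr (1 / p)" for n
  have k_pos: "0 < k n" for n using J(2)[of n] by (simp add: k_def)
  define \<sigma> where "\<sigma> x = (SUP n. ennreal (k n) * \<rho> n x)" for x
  have "Lp \<sigma>" unfolding \<sigma>_def
  proof (rule Lp_SUP)
    show "(\<lambda>x. ennreal (k n) * \<rho> n x) \<in> borel_measurable borel" for n
      using LpD(1)[OF \<rho>(1)[of n]] by measurable
    fix n
    have "(\<integral>\<^sup>+x. epowr (ennreal (k n) * \<rho> n x) p \<partial>M) = epowr (ennreal (k n)) p * ennreal (J n)"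
      using Lp_cmult(2)[OF \<rho>(1)[of n], of "ennreal (k n)"] J(1) by simp
    also have "epowr (ennreal (k n)) p = ennreal ((1/2) ^ n / (J n + 1))"
      using J(2)[of n] p_neq_0 by (simp add: epowr_ennreal k_def powr_powr)
    also have "\<dots> * ennreal (J n) = ennreal ((1/2) ^ n / (J n + 1) * J n)"
      using J(2)[of n] by (intro ennreal_mult[symmetric]) auto
    also have "\<dots> \<le> ennreal ((1/2) ^ n)"
      using J(2)[of n] by (intro ennreal_leI divide_add_one_mult_le) auto
    finally show "(\<integral>\<^sup>+x. epowr (ennreal (k n) * \<rho> n x) p \<partial>M) \<le> ennreal ((1/2) ^ n)" .
  qed
  then show ?thesis
  proof (rule ae_curve_I, intro allI)
    fix c n assume c: "c \<in> curves_in UNIV" "curve_integral c \<sigma> < \<infinity>"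
    have "ennreal (k n) * curve_integral c (\<rho> n) = curve_integral c (\<lambda>x. ennreal (k n) * \<rho> n x)"
      by (rule curve_integral_cmult[symmetric]) (use c LpD(1)[OF \<rho>(1)] in auto)
    also have "\<dots> \<le> curve_integral c \<sigma>"
      by (intro curve_integral_mono) (auto simp: \<sigma>_def intro: SUP_upper)
    also have "\<dots> < \<infinity>" by fact
    finally have "curve_integral c (\<rho> n) < \<infinity>"
      using k_pos[of n] by (auto simp: ennreal_mult_less_top)
    then show "P n c" using \<rho>(2) c(1) by blast
  qed
qed

lemma ae_curve_conj:
  assumes "ae_curve P" "ae_curve Q" shows "ae_curve (\<lambda>c. P c \<and> Q c)"
proof -
  have "ae_curve (\<lambda>c. \<forall>n::nat. (if n = 0 then P else Q) c)"
    using assms by (intro ae_curve_all_nat) auto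
  then show ?thesis by (rule ae_curve_mono) (metis zero_neq_one)
qed

text \<open>Admissible functions are chosen with energy so small that the multiple by
  \<open>Suc n\<close> has energy at most \<open>(1/2) ^ n\<close>. The supremum of these multiples
  has line integral at least \<open>Suc n\<close> for every n, hence infinite, on each exceptional
  curve.\<close>

lemma modulus_zero_imp_ae_curve:
  assumes "modulus M p \<Gamma> = 0" "\<Gamma> \<subseteq> curves_in UNIV"
  shows "ae_curve (\<lambda>c. c \<notin> \<Gamma>)"
proof -
  have "\<exists>\<rho>. \<rho> \<in> borel_measurable borel \<and> (\<forall>c\<in>\<Gamma>. curve_integral c \<rho> \<ge> 1) \<and>
      energy \<rho> < ennreal ((1/2) ^ n / real (Suc n) powr p)" for n
  proof -
    have "modulus M p \<Gamma> < ennreal ((1/2) ^ n / real (Suc n) powr p)"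
      using assms(1) by simp
    then show ?thesis unfolding modulus_def INF_less_iff by auto
  qed
  then obtain \<rho> where \<rho>: "\<And>n. \<rho> n \<in> borel_measurable borel"
    "\<And>n c. c \<in> \<Gamma> \<Longrightarrow> curve_integral c (\<rho> n) \<ge> 1"
    "\<And>n. energy (\<rho> n) < ennreal ((1/2) ^ n / real (Suc n) powr p)"
    by metis
  define \<sigma> where "\<sigma> x = (SUP n. ennreal (real (Suc n)) * \<rho> n x)" for x
  have "Lp \<sigma>" unfolding \<sigma>_def
  proof (rule Lp_SUP)
    show "(\<lambda>x. ennreal (real (Suc n)) * \<rho> n x) \<in> borel_measurable borel" for n
      using \<rho>(1)[of n] by measurable
    fix n
    have "Lp (\<rho> n)" using \<rho>(1)[of n] \<rho>(3)[of n] by (auto simp: Lp_def intro: order.strict_trans)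
    then have "(\<integral>\<^sup>+x. epowr (ennreal (real (Suc n)) * \<rho> n x) p \<partial>M)
        = ennreal (real (Suc n) powr p) * energy (\<rho> n)"
      using Lp_cmult(2)[of "\<rho> n" "ennreal (real (Suc n))"] by (simp add: epowr_ennreal del: of_nat_Suc)
    also have "\<dots> \<le> ennreal (real (Suc n) powr p) * ennreal ((1/2) ^ n / real (Suc n) powr p)"
      using \<rho>(3)[of n] by (intro mult_left_mono) auto
    also have "\<dots> = ennreal ((1/2) ^ n)"
      by (subst ennreal_mult[symmetric]) auto
    finally show "(\<integral>\<^sup>+x. epowr (ennreal (real (Suc n)) * \<rho> n x) p \<partial>M) \<le> ennreal ((1/2) ^ n)" .
  qed
  then show ?thesis
  proof (rule ae_curve_I)
    fix c assume c: "c \<in> curves_in UNIV" "curve_integral c \<sigma> < \<infinity>"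
    show "c \<notin> \<Gamma>"
    proof
      assume "c \<in> \<Gamma>"
      have *: "of_nat (Suc n) \<le> curve_integral c \<sigma>" for n
      proof -
        have "of_nat (Suc n) \<le> ennreal (real (Suc n)) * curve_integral c (\<rho> n)"
          using mult_left_mono[OF \<rho>(2)[OF \<open>c \<in> \<Gamma>\<close>, of n], of "ennreal (real (Suc n))"]
          by (simp add: ennreal_of_nat_eq_real_of_nat)
        also have "\<dots> = curve_integral c (\<lambda>x. ennreal (real (Suc n)) * \<rho> n x)"
          by (rule curve_integral_cmult[symmetric]) (use c \<rho>(1) in auto)
        also have "\<dots> \<le> curve_integral c \<sigma>"
          by (intro curve_integral_mono) (auto simp: \<sigma>_def intro: SUP_upper)
        finally show ?thesis .
      qed
      obtain n where "curve_integral c \<sigma> < of_nat n"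
        using c(2) ennreal_Ex_less_of_nat by auto
      also have "of_nat n \<le> (of_nat (Suc n) :: ennreal)" by simp
      finally show False using *[of n] by simp
    qed
  qed
qed

text \<open>A function whose line integrals are infinite on the family stays admissible after
  multiplication by any positive constant, and the energy of the multiple is arbitrarily
  small.\<close>

lemma ae_curve_imp_modulus_zero:
  assumes "ae_curve P" "\<Gamma> \<subseteq> {c \<in> curves_in UNIV. \<not> P c}"
  shows "modulus M p \<Gamma> = 0"
proof -
  obtain \<rho> where \<rho>: "Lp \<rho>" "\<And>c. c \<in> curves_in UNIV \<Longrightarrow> curve_integral c \<rho> < \<infinity> \<Longrightarrow> P c"
    using assms(1) unfolding ae_curve_def by blast
  define J where "J = enn2real (energy \<rho>)"
  have J: "energy \<rho> = ennreal J" "0 \<le> J"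
    using LpD(2)[OF \<rho>(1)] by (simp_all add: J_def)
  have "modulus M p \<Gamma> \<le> 0"
  proof (rule ennreal_le_epsilon)
    fix e :: real assume e: "0 < e"
    define k where "k = (e / (J + 1)) powr (1 / p)"
    have k: "0 < k" using e J(2) by (simp add: k_def)
    have "modulus M p \<Gamma> \<le> (\<integral>\<^sup>+x. epowr (ennreal k * \<rho> x) p \<partial>M)"
      unfolding modulus_def
    proof (rule INF_lower, safe)
      show "(\<lambda>x. ennreal k * \<rho> x) \<in> borel_measurable borel"
        using LpD(1)[OF \<rho>(1)] by measurable
      fix l \<gamma> assume "(l, \<gamma>) \<in> \<Gamma>"
      then have c1: "(l, \<gamma>) \<in> curves_in UNIV" "\<not> P (l, \<gamma>)" using assms(2) by auto
      then have "\<not> curve_integral (l, \<gamma>) \<rho> < \<infinity>" using \<rho>(2) by blast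
      then have "curve_integral (l, \<gamma>) \<rho> = \<infinity>" by (metis less_top infinity_ennreal_def)
      with c1 have c: "(l, \<gamma>) \<in> curves_in UNIV" "curve_integral (l, \<gamma>) \<rho> = \<infinity>"
        by auto
      then show "1 \<le> curve_integral (l, \<gamma>) (\<lambda>x. ennreal k * \<rho> x)"
        using k LpD(1)[OF \<rho>(1)] by (subst curve_integral_cmult) (auto simp: ennreal_mult_top)
    qed
    also have "\<dots> = epowr (ennreal k) p * ennreal J"
      using Lp_cmult(2)[OF \<rho>(1)] J(1) by simp
    also have "epowr (ennreal k) p = ennreal (e / (J + 1))"
      using J(2) p_neq_0 e by (simp add: epowr_ennreal k_def powr_powr)
    also have "\<dots> * ennreal J = ennreal (e / (J + 1) * J)"
      using J(2) e by (intro ennreal_mult[symmetric]) auto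
    also have "\<dots> \<le> ennreal e"
      using J(2) e by (intro ennreal_leI divide_add_one_mult_le) auto
    finally show "modulus M p \<Gamma> \<le> 0 + ennreal e" by simp
  qed
  then show ?thesis by simp
qed

text \<open>A working form of weak upper gradients: Borel, and with the inequality on all subcurves
  of almost every curve. \<open>weak_upper_gradient_majorant\<close> shows that up to a null set
  nothing is lost.\<close>

definition wug :: "('a \<Rightarrow> ereal) \<Rightarrow> ('a \<Rightarrow> ennreal) \<Rightarrow> bool" where
  "wug v g \<longleftrightarrow> g \<in> borel_measurable borel \<and> ae_curve (ug_along v g)"

lemma wug_imp_weak_upper_gradient:
  assumes "wug v g" shows "weak_upper_gradient M p v g"
  unfolding weak_upper_gradient_def
proof
  show "g \<in> borel_measurable M" using assms by (simp add: wug_def borel_imp_measurable)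
  have "ae_curve (ug_along v g)" using assms by (simp add: wug_def)
  then show "modulus M p {c \<in> curves_in UNIV. \<not> ug_ineq v g c} = 0"
    by (rule ae_curve_imp_modulus_zero) (auto dest: ug_along_imp_ug_ineq)
qed

lemma upper_gradient_imp_wug:
  assumes "upper_gradient_on UNIV v g" shows "wug v g"
  unfolding wug_def
proof
  show "g \<in> borel_measurable borel" by (rule upper_gradient_measurable[OF assms])
  show "ae_curve (ug_along v g)"
    by (rule ae_curve_I[OF Lp_zero]) (rule ug_along_upper_gradient[OF assms])
qed

lemma ug_ineq_mono: "ug_ineq v g c \<Longrightarrow> (\<And>x. g x \<le> h x) \<Longrightarrow> ug_ineq v h c"
  unfolding ug_ineq_def
  by (auto split: prod.splits elim!: order_trans simp: less_eq_ennreal.rep_eq[symmetric]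
      intro!: curve_integral_mono)

text \<open>If the witness \<open>\<rho>\<close> of the exceptional family has a finite integral
  along a curve, it has one along each subcurve. So the same witness serves for the inequality on
  all subcurves.\<close>

lemma weak_upper_gradient_majorant:
  assumes "weak_upper_gradient M p v h"
  obtains h' where "wug v h'" "\<And>x. h x \<le> h' x" "AE x in M. h x = h' x"
proof -
  have h: "h \<in> borel_measurable M" "modulus M p {c \<in> curves_in UNIV. \<not> ug_ineq v h c} = 0"
    using assms by (auto simp: weak_upper_gradient_def)
  obtain h' where h': "h' \<in> borel_measurable borel" "\<And>x. h x \<le> h' x" "AE x in M. h x = h' x"
    using borel_majorant[OF h(1)] by blast
  from modulus_zero_imp_ae_curve[OF h(2)]
  have "ae_curve (ug_ineq v h)" by (rule ae_curve_mono[OF _]) auto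
  then obtain \<rho> where \<rho>: "Lp \<rho>" "\<And>c. c \<in> curves_in UNIV \<Longrightarrow> curve_integral c \<rho> < \<infinity> \<Longrightarrow> ug_ineq v h c"
    unfolding ae_curve_def by blast
  have "ae_curve (ug_along v h')"
  proof (rule ae_curve_I[OF \<rho>(1)])
    fix c assume c: "c \<in> curves_in UNIV" "curve_integral c \<rho> < \<infinity>"
    obtain l \<gamma> where [simp]: "c = (l, \<gamma>)" by (cases c)
    have "ug_along v h' (l, \<gamma>)"
    proof (rule ug_along_of_subcurves[OF h'(1)])
      show "(l, \<gamma>) \<in> curves_in UNIV" using c by simp
      fix s t assume st: "0 \<le> s" "s < t" "t \<le> l"
      have cont: "continuous_on {s..t} \<gamma>" using c st by (intro curve_continuous[of l \<gamma> UNIV]) auto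
      have "curve_integral (t - s, \<lambda>\<tau>. \<gamma> (s + \<tau>)) \<rho> = line_integral \<rho> \<gamma> s t"
        unfolding curve_integral_eq by (rule line_integral_shift[OF LpD(1)[OF \<rho>(1)] cont])
      also have "\<dots> \<le> line_integral \<rho> \<gamma> 0 l" using st by (intro line_integral_mono_interval) auto
      also have "\<dots> < \<infinity>" using c(2) by (simp add: curve_integral_eq)
      finally have "ug_ineq v h (t - s, \<lambda>\<tau>. \<gamma> (s + \<tau>))"
        by (intro \<rho>(2) subcurve_in_curves_in[of l]) (use c st in auto)
      then show "ug_ineq v h' (t - s, \<lambda>\<tau>. \<gamma> (s + \<tau>))" by (rule ug_ineq_mono) (rule h'(2))
    qed
    then show "ug_along v h' c" by simp
  qed
  with h' show thesis by (intro that) (auto simp: wug_def)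
qed

section \<open>Separability of doubling spaces\<close>

lemma doubling_power:
  assumes "0 < r"
  shows "emeasure M (ball x (2 ^ k * r)) \<le> ennreal (C ^ k) * emeasure M (ball x r)"
proof (induction k)
  case (Suc k)
  have "emeasure M (ball x (2 ^ Suc k * r)) \<le> ennreal C * emeasure M (ball x (2 ^ k * r))"
    using doubling[of "2 ^ k * r" x] assms by (simp add: mult.assoc)
  also have "\<dots> \<le> ennreal C * (ennreal (C ^ k) * emeasure M (ball x r))"
    by (intro mult_left_mono Suc) auto
  finally show ?case
    using C_pos by (simp add: ennreal_mult mult.assoc)
qed simp

text \<open>Volume counting: balls of radius \<open>e / 2\<close> around an
  \<open>e\<close>-separated subset of \<open>ball z R\<close> are disjoint, lie in
  \<open>ball z (R + e)\<close>, and by doubling have a common positive lower bound for their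
  measures. Cardinalities are thus bounded, and a separated set of maximal cardinality is a
  net.\<close>

lemma finite_net:
  fixes z :: 'a
  assumes "0 < e" "0 < R"
  shows "\<exists>F. finite F \<and> (\<forall>x\<in>ball z R. \<exists>y\<in>F. dist y x < e)"
proof -
  define sep where "sep F \<longleftrightarrow> finite F \<and> F \<subseteq> ball z R \<and> (\<forall>x\<in>F. \<forall>y\<in>F. x \<noteq> y \<longrightarrow> e \<le> dist x y)" for F :: "'a set"
  \<comment> \<open>\<open>k\<close> doublings enlarge the radius \<open>e / 2\<close> beyond
    \<open>2 * R\<close>, so that the ball around any point of \<open>ball z R\<close> swallows
    \<open>ball z R\<close>.\<close>
  obtain k :: nat where k: "2 * R / (e / 2) < 2 ^ k"
    using real_arch_pow[of 2 "2 * R / (e / 2)"] by auto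
  define \<mu> where "\<mu> = measure M (ball z R)"
  define V where "V = measure M (ball z (R + e))"
  have \<mu>: "0 < \<mu>" using measure_ball_pos assms(2) by (simp add: \<mu>_def)
  have low: "\<mu> / C ^ k \<le> measure M (ball x (e / 2))" if "x \<in> ball z R" for x
  proof -
    have "ball z R \<subseteq> ball x (2 * R)"
    proof
      fix y assume "y \<in> ball z R"
      then show "y \<in> ball x (2 * R)"
        using that dist_triangle[of x y z] by (simp add: dist_commute)
    qed
    also have "\<dots> \<subseteq> ball x (2 ^ k * (e / 2))"
      using k assms by (intro subset_ball) (simp add: field_simps)
    finally have "emeasure M (ball z R) \<le> emeasure M (ball x (2 ^ k * (e / 2)))"
      by (intro emeasure_mono) auto
    also have "\<dots> \<le> ennreal (C ^ k) * emeasure M (ball x (e / 2))"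
      using assms by (intro doubling_power) auto
    finally have "\<mu> \<le> C ^ k * measure M (ball x (e / 2))"
      using C_pos unfolding emeasure_ball \<mu>_def
      by (simp add: ennreal_mult[symmetric] ennreal_le_iff)
    then show ?thesis using C_pos by (simp add: divide_le_eq mult.commute)
  qed
  have card_bound: "real (card F) \<le> V * C ^ k / \<mu>" if F: "sep F" for F
  proof -
    have disj: "disjoint_family_on (\<lambda>x. ball x (e / 2)) F"
      unfolding disjoint_family_on_def
    proof (intro ballI impI)
      fix x y assume "x \<in> F" "y \<in> F" "x \<noteq> y"
      then have "e \<le> dist x y" using F by (auto simp: sep_def)
      then show "ball x (e / 2) \<inter> ball y (e / 2) = {}"
        by (auto simp: disjoint_iff) (smt (verit) dist_commute dist_triangle field_sum_of_halves)
    qed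
    have "real (card F) * (\<mu> / C ^ k) = (\<Sum>x\<in>F. \<mu> / C ^ k)" by simp
    also have "\<dots> \<le> (\<Sum>x\<in>F. measure M (ball x (e / 2)))"
      using F low by (intro sum_mono) (auto simp: sep_def)
    also have "\<dots> = measure M (\<Union>x\<in>F. ball x (e / 2))"
      using F disj ball_finite
      by (intro measure_finite_Union[symmetric]) (auto simp: sep_def less_top)
    also have "\<dots> \<le> V"
      unfolding V_def
    proof (rule measure_mono_fmeasurable)
      show "(\<Union>x\<in>F. ball x (e / 2)) \<subseteq> ball z (R + e)"
      proof safe
        fix x y assume "x \<in> F" "y \<in> ball x (e / 2)"
        then have "dist z x < R" "dist x y < e / 2" using F by (auto simp: sep_def)
        then show "y \<in> ball z (R + e)" using dist_triangle[of z y x] assms by simp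
      qed
      show "ball z (R + e) \<in> fmeasurable M" using ball_finite by (intro fmeasurableI) auto
      show "(\<Union>x\<in>F. ball x (e / 2)) \<in> sets M" by (intro open_sets_M open_UN) auto
    qed
    finally show ?thesis using \<mu> C_pos by (simp add: field_simps)
  qed
  have "sep {}" by (simp add: sep_def)
  moreover have "\<forall>F. sep F \<longrightarrow> card F < Suc (nat \<lceil>V * C ^ k / \<mu>\<rceil>)"
    using card_bound by (auto simp: less_Suc_eq_le) (metis le_nat_iff card_bound ceiling_mono ceiling_of_nat of_nat_0_le_iff nat_int nat_mono)
  ultimately obtain F where F: "sep F" "\<And>G. sep G \<Longrightarrow> card G \<le> card F"
    using ex_has_greatest_nat[of sep "{}" card] by blast
  show ?thesis
  proof (intro exI[of _ F] conjI ballI)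
    show "finite F" using F by (simp add: sep_def)
    fix x assume x: "x \<in> ball z R"
    show "\<exists>y\<in>F. dist y x < e"
    proof (rule ccontr)
      assume "\<not> ?thesis"
      then have far: "\<And>y. y \<in> F \<Longrightarrow> e \<le> dist y x" by force
      then have "x \<notin> F" using assms(1) by fastforce
      moreover have "sep (insert x F)"
        using F(1) x far unfolding sep_def by (auto simp: dist_commute)
      ultimately show False using F(2)[of "insert x F"] F(1) by (simp add: sep_def)
    qed
  qed
qed

lemma countable_dense:
  obtains D :: "'a set" where "countable D" "\<And>x e. 0 < e \<Longrightarrow> \<exists>y\<in>D. dist y x < e"
proof -
  fix z :: 'a
  have "\<exists>F. finite F \<and> (\<forall>x\<in>ball z (real (Suc m)). \<exists>y\<in>F. dist y x < 1 / real (Suc n))" for m n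
    by (rule finite_net) auto
  then obtain F where F: "\<And>m n. finite (F m n)"
    "\<And>m n x. x \<in> ball z (real (Suc m)) \<Longrightarrow> \<exists>y\<in>F m n. dist y x < 1 / real (Suc n)"
    by metis
  show thesis
  proof
    show "countable (\<Union>m n. F m n)" by (intro countable_UN countableI_type countable_finite F(1))
    fix x :: 'a and e :: real assume "0 < e"
    then obtain n where n: "1 / real (Suc n) < e" using nat_approx_posE by metis
    obtain m where "dist z x < real m" using reals_Archimedean2 by blast
    then have "x \<in> ball z (real (Suc m))" by simp
    from F(2)[OF this, of n] obtain y where "y \<in> F m n" "dist y x < 1 / real (Suc n)" ..
    with n show "\<exists>y\<in>(\<Union>m n. F m n). dist y x < e" by (intro bexI[of _ y]) auto
  qed
qed

text \<open>The Lindelof property for a local property \<open>P\<close> that passes to subsets. It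
  serves both for local integrability of gradients and for almost everywhere finiteness of
  \<open>u\<close>.\<close>

lemma countable_ball_cover:
  assumes "\<And>x. \<exists>r>0. P (ball x r)" "\<And>A B. A \<subseteq> B \<Longrightarrow> P B \<Longrightarrow> P A"
  shows "\<exists>B :: nat \<Rightarrow> 'a set. (\<forall>n. open (B n) \<and> P (B n)) \<and> (\<Union>n. B n) = UNIV"
proof -
  obtain D :: "'a set" where D: "countable D" "\<And>x e. 0 < e \<Longrightarrow> \<exists>y\<in>D. dist y x < e"
    using countable_dense by blast
  define \<B> where "\<B> = {A. (\<exists>q\<in>D. \<exists>n. A = ball q (1 / real (Suc n))) \<and> P A}"
  have "countable ((\<lambda>(q, n). ball q (1 / real (Suc n))) ` (D \<times> UNIV))"
    using D(1) by (intro countable_image countable_SIGMA) auto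
  then have cnt: "countable \<B>" by (rule countable_subset[rotated]) (auto simp: \<B>_def)
  have cover: "\<exists>A\<in>\<B>. x \<in> A" for x
  proof -
    obtain r where r: "0 < r" "P (ball x r)" using assms(1) by blast
    then obtain n where n: "1 / real (Suc n) < r / 2" using nat_approx_posE[of "r / 2"] by auto
    obtain q where q: "q \<in> D" "dist q x < 1 / real (Suc n)" using D(2)[of "1 / real (Suc n)" x] by auto
    have "ball q (1 / real (Suc n)) \<subseteq> ball x r"
    proof
      fix y assume "y \<in> ball q (1 / real (Suc n))"
      then have "dist q y < 1 / real (Suc n)" by simp
      then show "y \<in> ball x r" using q(2) n dist_triangle[of x y q] by (simp only: mem_ball dist_commute[of x q])
    qed
    then have "P (ball q (1 / real (Suc n)))" using r assms(2) by blast
    then show ?thesis using q by (intro bexI[of _ "ball q (1 / real (Suc n))"]) (auto simp: \<B>_def)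
  qed
  then have ne: "\<B> \<noteq> {}" by blast
  have "open (from_nat_into \<B> n) \<and> P (from_nat_into \<B> n)" for n
    using from_nat_into[OF ne, of n] by (auto simp: \<B>_def)
  moreover have "(\<Union>n. from_nat_into \<B> n) = UNIV"
    using cover range_from_nat_into[OF ne cnt] by blast
  ultimately show ?thesis by blast
qed

text \<open>A compact curve is covered by finitely many of countably many open sets on which
  \<open>g\<close> has finite energy. This is needed because minimality is tested against gradients
  that are only locally in L^p, and taking minima requires finite line integrals.\<close>

lemma Lp_loc_ae_curve_finite:
  assumes g: "g \<in> borel_measurable borel" "Lp_loc M p g"
  shows "ae_curve (\<lambda>c. curve_integral c g < \<infinity>)"
proof -
  define P where "P A \<longleftrightarrow> energy_on A g < \<infinity>" for A
  have "\<exists>r>0. P (ball x r)" for x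
    using g(2) by (simp add: Lp_loc_def P_def)
  moreover have "P A" if "A \<subseteq> B" "P B" for A B
  proof -
    have "energy_on A g \<le> energy_on B g"
      using that(1) by (intro nn_integral_mono) (auto simp: indicator_def)
    with that(2) show ?thesis unfolding P_def by order
  qed
  ultimately have "\<exists>B :: nat \<Rightarrow> 'a set. (\<forall>n. open (B n) \<and> P (B n)) \<and> (\<Union>n. B n) = UNIV"
    by (rule countable_ball_cover)
  then obtain B :: "nat \<Rightarrow> 'a set" where "\<forall>n. open (B n) \<and> P (B n)" "(\<Union>n. B n) = UNIV"
    by (elim exE conjE)
  then have B: "\<And>n. open (B n)" "\<And>n. energy_on (B n) g < \<infinity>" "(\<Union>n. B n) = UNIV"
    by (simp_all add: P_def)
  define h where "h n x = g x * indicator (B n) x" for n x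
  have h_meas: "h n \<in> borel_measurable borel" for n
  proof -
    have [measurable]: "B n \<in> sets borel" using B(1) by simp
    show ?thesis using g(1) unfolding h_def by measurable
  qed
  have "Lp (h n)" for n
  proof -
    have "energy (h n) = energy_on (B n) g"
      by (intro nn_integral_cong) (auto simp: h_def indicator_def)
    then show ?thesis using B(2)[of n] h_meas by (simp add: Lp_def)
  qed
  then have "ae_curve (\<lambda>c. \<forall>n. curve_integral c (h n) < \<infinity>)"
    by (intro ae_curve_all_nat ae_curve_finite)
  then show ?thesis
  proof (rule ae_curve_mono)
    fix c assume c: "c \<in> curves_in UNIV" "\<forall>n. curve_integral c (h n) < \<infinity>"
    obtain l \<gamma> where [simp]: "c = (l, \<gamma>)" by (cases c)
    have cont: "continuous_on {0..l} \<gamma>" using c(1) by (auto simp: curves_in_def)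
    have "compact (\<gamma> ` {0..l})" using cont by (intro compact_continuous_image) auto
    moreover have "\<gamma> ` {0..l} \<subseteq> (\<Union>n. B n)" using B(3) by simp
    ultimately obtain K where K: "K \<subseteq> UNIV" "finite K" "\<gamma> ` {0..l} \<subseteq> (\<Union>n\<in>K. B n)"
      by (rule compactE_image[OF _ B(1)])
    have "curve_integral c g \<le> line_integral (\<lambda>x. \<Sum>n\<in>K. h n x) \<gamma> 0 l"
      unfolding \<open>c = _\<close> curve_integral_eq
    proof (rule line_integral_mono_on)
      fix \<tau> assume "0 \<le> \<tau>" "\<tau> \<le> l"
      then obtain n where "n \<in> K" "\<gamma> \<tau> \<in> B n" using K(3) by fastforce
      then have "g (\<gamma> \<tau>) = h n (\<gamma> \<tau>)" by (simp add: h_def)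
      also have "\<dots> \<le> (\<Sum>n\<in>K. h n (\<gamma> \<tau>))"
        using K(2) \<open>n \<in> K\<close> by (intro member_le_sum) auto
      finally show "g (\<gamma> \<tau>) \<le> (\<Sum>n\<in>K. h n (\<gamma> \<tau>))" .
    qed
    also have "\<dots> = (\<Sum>n\<in>K. line_integral (h n) \<gamma> 0 l)"
      using h_meas cont by (rule line_integral_sum)
    also have "\<dots> < \<infinity>"
      using c(2) K(2) by (simp add: curve_integral_eq)
    finally show "curve_integral c g < \<infinity>" .
  qed
qed

section \<open>Infima and existence of a minimal weak upper gradient\<close>

lemma wug_min:
  assumes "wug v g1" "wug v g2"
    and "ae_curve (\<lambda>c. curve_integral c g1 < \<infinity>)" "ae_curve (\<lambda>c. curve_integral c g2 < \<infinity>)"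
  shows "wug v (\<lambda>x. min (g1 x) (g2 x))"
proof -
  have g: "g1 \<in> borel_measurable borel" "g2 \<in> borel_measurable borel"
    "ae_curve (ug_along v g1)" "ae_curve (ug_along v g2)"
    using assms(1,2) by (auto simp: wug_def)
  have "ae_curve (\<lambda>c. (ug_along v g1 c \<and> ug_along v g2 c) \<and>
      (curve_integral c g1 < \<infinity> \<and> curve_integral c g2 < \<infinity>))"
    by (intro ae_curve_conj g assms)
  then have "ae_curve (ug_along v (\<lambda>x. min (g1 x) (g2 x)))"
    by (rule ae_curve_mono)
       (use g(1,2) in \<open>auto simp: curve_integral_eq intro!: ug_along_min\<close>)
  moreover have "(\<lambda>x. min (g1 x) (g2 x)) \<in> borel_measurable borel"
    using g(1,2) by measurable
  ultimately show ?thesis by (simp add: wug_def)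
qed

text \<open>Finite minima decrease to the infimum. On almost every curve the first of them has a
  finite line integral, so monotone convergence from above carries the inequality to the
  limit.\<close>

lemma wug_INF:
  fixes g :: "nat \<Rightarrow> 'a \<Rightarrow> ennreal"
  assumes wug: "\<And>n. wug v (g n)" and fin: "\<And>n. ae_curve (\<lambda>c. curve_integral c (g n) < \<infinity>)"
  shows "wug v (\<lambda>x. INF n. g n x)"
proof -
  define m where "m n x = (INF i\<in>{..n}. g i x)" for n x
  have g: "g n \<in> borel_measurable borel" for n using wug by (simp add: wug_def)
  have m_meas: "m n \<in> borel_measurable borel" for n
    unfolding m_def using g by measurable
  have m_Suc: "m (Suc n) = (\<lambda>x. min (g (Suc n) x) (m n x))" for n
    unfolding m_def atMost_Suc by (auto simp: inf_min)
  have m_0: "m 0 = g 0" by (auto simp: m_def)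
  have m_le: "m n x \<le> g n x" for n x by (auto simp: m_def intro: INF_lower)
  have m_fin: "ae_curve (\<lambda>c. curve_integral c (m n) < \<infinity>)" for n
    by (rule ae_curve_mono[OF fin[of n]]) (auto intro: le_less_trans curve_integral_mono[OF m_le])
  have m_wug: "wug v (m n)" for n
  proof (induction n)
    case 0 then show ?case using wug m_0 by simp
  next
    case (Suc n)
    show ?case unfolding m_Suc by (intro wug_min wug Suc fin m_fin)
  qed
  have INF_m: "(INF n. g n x) = (INF n. m n x)" for x
    by (rule antisym) (auto simp: m_def intro!: INF_greatest intro: INF_lower INF_lower2)
  have "decseq m"
  proof (rule decseq_SucI)
    show "m (Suc n) \<le> m n" for n unfolding m_Suc by (simp add: le_fun_def)
  qed
  have "ae_curve (\<lambda>c. \<forall>n. ug_along v (m n) c \<and> curve_integral c (m n) < \<infinity>)"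
    using m_wug by (intro ae_curve_all_nat ae_curve_conj m_fin) (auto simp: wug_def)
  then have "ae_curve (ug_along v (\<lambda>x. INF n. g n x))"
  proof (rule ae_curve_mono)
    fix c assume c: "c \<in> curves_in UNIV" "\<forall>n. ug_along v (m n) c \<and> curve_integral c (m n) < \<infinity>"
    obtain l \<gamma> where [simp]: "c = (l, \<gamma>)" by (cases c)
    have fin_m: "line_integral (m n) \<gamma> 0 l < \<infinity>" for n using c(2) by (simp add: curve_integral_eq)
    show "ug_along v (\<lambda>x. INF n. g n x) c"
      unfolding \<open>c = _\<close>
    proof (rule ug_alongI_real[where A = UNIV])
      show "(l, \<gamma>) \<in> curves_in UNIV" using c by simp
      show "\<bar>v (\<gamma> t)\<bar> \<noteq> \<infinity>" if "0 \<le> t" "t \<le> l" for t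
        using ug_along_finite[of v "m 0" l \<gamma> UNIV t] c fin_m that by simp
      fix s t assume st: "0 \<le> s" "s \<le> t" "t \<le> l"
      have cont: "continuous_on {s..t} \<gamma>" using c(1) st by (intro curve_continuous[of l \<gamma> UNIV]) auto
      have "line_integral (\<lambda>x. INF n. g n x) \<gamma> s t
          = (\<integral>\<^sup>+\<tau>. (INF n. m n (\<gamma> \<tau>) * indicator {s..t} \<tau>) \<partial>lborel)"
        unfolding line_integral_def INF_m
        by (intro nn_integral_cong) (auto simp: indicator_def)
      also have "\<dots> = (INF n. line_integral (m n) \<gamma> s t)"
        unfolding line_integral_def
      proof (rule nn_integral_monotone_convergence_INF_decseq[where i = 0])
        show "decseq (\<lambda>n \<tau>. m n (\<gamma> \<tau>) * indicator {s..t} \<tau>)"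
        proof (rule decseq_SucI)
          show "(\<lambda>\<tau>. m (Suc n) (\<gamma> \<tau>) * indicator {s..t} \<tau>) \<le> (\<lambda>\<tau>. m n (\<gamma> \<tau>) * indicator {s..t} \<tau>)" for n
            using decseq_SucD[OF \<open>decseq m\<close>, of n] by (auto simp: le_fun_def intro: mult_right_mono)
        qed
        show "(\<lambda>\<tau>. m n (\<gamma> \<tau>) * indicator {s..t} \<tau>) \<in> borel_measurable lborel" for n
          using line_integrand_measurable[OF m_meas cont] by simp
        have "line_integral (m 0) \<gamma> s t \<le> line_integral (m 0) \<gamma> 0 l"
          using st by (intro line_integral_mono_interval) auto
        then show "(\<integral>\<^sup>+\<tau>. m 0 (\<gamma> \<tau>) * indicator {s..t} \<tau> \<partial>lborel) < \<infinity>"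
          using fin_m[of 0] unfolding line_integral_def by order
      qed
      finally show "ennreal \<bar>real_of_ereal (v (\<gamma> t)) - real_of_ereal (v (\<gamma> s))\<bar>
          \<le> line_integral (\<lambda>x. INF n. g n x) \<gamma> s t"
        using c fin_m st by (auto intro!: INF_greatest ug_along_real[where A = UNIV])
    qed
  qed
  moreover have "(\<lambda>x. INF n. g n x) \<in> borel_measurable borel" using g by measurable
  ultimately show ?thesis by (simp add: wug_def)
qed

lemma Lp_imp_Lp_loc:
  assumes "Lp g" shows "Lp_loc M p g"
  unfolding Lp_loc_def
proof (intro conjI allI)
  show "g \<in> borel_measurable M" by (intro borel_imp_measurable LpD assms)
  fix x
  have "energy_on (ball x 1) g \<le> energy g"
    by (intro nn_integral_mono) (auto simp: indicator_def)
  also have "\<dots> < \<infinity>" by (rule LpD(2)[OF assms])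
  finally show "\<exists>r>0. energy_on (ball x r) g < \<infinity>" by (intro exI[of _ 1]) auto
qed

text \<open>
  Weak upper gradients are stable under countable infima, so one that minimizes the \<open>L\<^sup>p\<close> norm exists.
  This is what makes the choice in \<^const>\<open>min_wug\<close> meaningful.
\<close>

theorem min_wug_minimal:
  assumes "wug v G" "Lp G"
  shows "is_minimal_weak_upper_gradient M p v (min_wug M p v)"
proof -
  define S where "S = {g. wug v g \<and> Lp g}"
  define E where "E g = energy g" for g
  define I where "I = (INF g\<in>S. E g)"
  have "G \<in> S" using assms by (simp add: S_def)
  have I_fin: "I < \<infinity>"
    using INF_lower[OF \<open>G \<in> S\<close>, of E] LpD(2)[OF assms(2)] unfolding I_def E_def by order
  have "\<exists>g\<in>S. E g < I + ennreal (1 / real (Suc n))" for n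
  proof -
    have "I < I + ennreal (1 / real (Suc n))" using I_fin
      by (cases I) (auto simp: ennreal_plus[symmetric] ennreal_less_iff simp del: ennreal_plus)
    then show ?thesis by (subst (asm) (1) I_def) (simp add: INF_less_iff)
  qed
  then obtain g where g: "\<And>n. g n \<in> S" "\<And>n. E (g n) < I + ennreal (1 / real (Suc n))" by metis
  define h where "h x = (INF n. g n x)" for x
  have h_wug: "wug v h" unfolding h_def
    using g(1) by (intro wug_INF ae_curve_finite) (auto simp: S_def)
  have h_le: "h x \<le> g n x" for n x unfolding h_def by (intro INF_lower) auto
  have h_Lp: "Lp h"
    using g(1)[of 0] h_wug by (intro Lp_mono[OF _ _ h_le]) (auto simp: S_def wug_def)
  have "E h \<le> I"
  proof (rule ennreal_le_epsilon)
    fix e :: real assume "0 < e"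
    then obtain n where n: "1 / real (Suc n) < e" using nat_approx_posE by metis
    have "E h \<le> E (g n)" unfolding E_def by (intro nn_integral_mono epowr_mono h_le p_nonneg)
    also have "\<dots> \<le> I + ennreal (1 / real (Suc n))" using g(2)[of n] by simp
    also have "\<dots> \<le> I + ennreal e" using n by (intro add_left_mono ennreal_leI) simp
    finally show "E h \<le> I + ennreal e" .
  qed
  have "is_minimal_weak_upper_gradient M p v h"
    unfolding is_minimal_weak_upper_gradient_def
  proof (intro conjI allI impI)
    show "weak_upper_gradient M p v h" by (rule wug_imp_weak_upper_gradient[OF h_wug])
    show "Lp_loc M p h" by (rule Lp_imp_Lp_loc[OF h_Lp])
    \<comment> \<open>\<open>k\<close> is only locally in L^p and need not belong to
      \<open>S\<close>. Its minimum with \<open>h\<close>, after passing to a Borel majorant, does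
      belong to \<open>S\<close> because it lies below \<open>h\<close>; as \<open>h\<close> attains
      the infimum, the two energies agree and hence \<open>h\<close> equals the minimum almost
      everywhere.\<close>
    fix k assume k: "weak_upper_gradient M p v k \<and> Lp_loc M p k"
    then obtain k' where k': "wug v k'" "\<And>x. k x \<le> k' x" "AE x in M. k x = k' x"
      using weak_upper_gradient_majorant by blast
    have k'_meas: "k' \<in> borel_measurable borel" using k'(1) by (simp add: wug_def)
    have "energy_on A k = energy_on A k'" for A
      using k'(3) by (intro nn_integral_cong_AE) (auto elim: eventually_mono)
    then have "Lp_loc M p k'" using k k'_meas unfolding Lp_loc_def
      by (auto intro: borel_imp_measurable)
    then have "ae_curve (\<lambda>c. curve_integral c k' < \<infinity>)" using k'_meas by (intro Lp_loc_ae_curve_finite)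
    then have m_wug: "wug v (\<lambda>x. min (h x) (k' x))"
      by (intro wug_min h_wug k'(1) ae_curve_finite[OF h_Lp])
    moreover have m_Lp: "Lp (\<lambda>x. min (h x) (k' x))"
      using m_wug by (intro Lp_mono[OF h_Lp]) (auto simp: wug_def)
    ultimately have "I \<le> E (\<lambda>x. min (h x) (k' x))"
      unfolding I_def by (intro INF_lower) (auto simp: S_def)
    with \<open>E h \<le> I\<close> have le: "E h \<le> E (\<lambda>x. min (h x) (k' x))" by order
    note [measurable] = Lp_measurable[OF h_Lp] Lp_measurable[OF m_Lp]
    have m_le: "epowr (min (h x) (k' x)) p \<le> epowr (h x) p" for x
      by (intro epowr_mono p_nonneg) auto
    have "(\<integral>\<^sup>+x. epowr (h x) p - epowr (min (h x) (k' x)) p \<partial>M)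
        = E h - E (\<lambda>x. min (h x) (k' x))"
      unfolding E_def using LpD(2)[OF m_Lp] m_le by (intro nn_integral_diff) auto
    also have "\<dots> = 0"
      using le LpD(2)[OF h_Lp] by (intro diff_eq_0_ennreal) (simp_all add: E_def)
    finally have "AE x in M. epowr (h x) p - epowr (min (h x) (k' x)) p = 0"
      by (subst (asm) nn_integral_0_iff_AE) auto
    moreover have "AE x in M. epowr (h x) p \<noteq> \<infinity>"
      using LpD(2)[OF h_Lp] by (intro nn_integral_noteq_infinite) auto
    ultimately show "AE x in M. h x \<le> k x" using k'(3)
    proof eventually_elim
      case (elim x)
      then have "epowr (h x) p \<le> epowr (min (h x) (k' x)) p"
        by (auto simp: diff_eq_0_iff_ennreal)
      then have "h x \<le> min (h x) (k' x)" by (rule epowr_le_cancel[OF p_pos])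
      then show ?case using elim by simp
    qed
  qed
  then show ?thesis unfolding min_wug_def by (rule someI[of "is_minimal_weak_upper_gradient M p v"])
qed

end

section \<open>A Poincare inequality with the exponent p on both sides\<close>

lemma telescoping_bound:
  fixes a :: "nat \<Rightarrow> real"
  assumes "a \<longlonglongrightarrow> l" "\<And>n. ennreal \<bar>a (Suc n) - a n\<bar> \<le> b n"
  shows "ennreal \<bar>l - a 0\<bar> \<le> (\<Sum>n. b n)"
proof -
  have partial: "ennreal \<bar>a n - a 0\<bar> \<le> (\<Sum>i<n. b i)" for n
  proof (induction n)
    case (Suc n)
    have "ennreal \<bar>a (Suc n) - a 0\<bar> \<le> ennreal (\<bar>a n - a 0\<bar> + \<bar>a (Suc n) - a n\<bar>)"
      by (intro ennreal_leI) auto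
    also have "\<dots> = ennreal \<bar>a n - a 0\<bar> + ennreal \<bar>a (Suc n) - a n\<bar>" by (rule ennreal_plus) auto
    also have "\<dots> \<le> (\<Sum>i<Suc n. b i)" using Suc assms(2)[of n] by (simp add: add_mono)
    finally show ?case .
  qed simp
  have "(\<lambda>n. ennreal \<bar>a n - a 0\<bar>) \<longlonglongrightarrow> ennreal \<bar>l - a 0\<bar>"
    using assms(1) by (intro tendsto_intros tendsto_ennrealI)
  moreover have "\<forall>n\<ge>0. ennreal \<bar>a n - a 0\<bar> \<le> (\<Sum>n. b n)"
    using partial sum_le_suminf[of b] by (meson finite_lessThan order_trans summableI zero_le)
  ultimately show ?thesis by (intro LIMSEQ_le_const2) blast+
qed

text \<open>Spends a geometric factor to turn a sum into a supremum, to which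
  \<open>epowr_SUP_le\<close> then applies.\<close>

lemma suminf_half_power_le_SUP:
  fixes b :: "nat \<Rightarrow> ennreal"
  shows "(\<Sum>j. ennreal ((1/2) ^ j) * b j) \<le> ennreal 2 * (SUP j. b j)"
proof -
  have "(\<Sum>j. ennreal ((1/2) ^ j) * b j) \<le> (\<Sum>j. ennreal ((1/2) ^ j) * (SUP j. b j))"
    by (intro suminf_le mult_left_mono SUP_upper) auto
  also have "\<dots> = (\<Sum>j. ennreal ((1/2) ^ j)) * (SUP j. b j)" by simp
  finally show ?thesis by (simp only: suminf_half_power)
qed

lemma ennreal_divide_mono_ratio:
  fixes I a b D :: ennreal
  assumes "1 / a \<le> D / b" shows "I / a \<le> D * (I / b)"
proof -
  have "I * (1 / a) \<le> I * (D / b)" using assms by (intro mult_left_mono) auto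
  then show ?thesis by (simp add: ennreal_times_divide mult.commute[of I D])
qed

section \<open>Averages over balls of a fixed radius\<close>

context doubling_space begin

lemma doubling_4:
  assumes "0 < r" shows "emeasure M (ball x (4 * r)) \<le> ennreal (C\<^sup>2) * emeasure M (ball x r)"
  using doubling_power[OF assms, of x 2] by simp

text \<open>An open subset of the product need not lie in the product sigma-algebra in general. A
  countable dense set of centres writes this one as a countable union of products of balls, which is
  what Fubini requires.\<close>

lemma dist_less_sets: "{z. dist (fst z) (snd z) < r} \<in> sets (M \<Otimes>\<^sub>M M)"
proof -
  obtain D :: "'a set" where D: "countable D" "\<And>x e. 0 < e \<Longrightarrow> \<exists>y\<in>D. dist y x < e"
    using countable_dense by blast
  have "{z. dist (fst z) (snd z) < r}
      = (\<Union>q\<in>D. \<Union>n. ball q (1 / real (Suc n)) \<times> ball q (r - 1 / real (Suc n)))" (is "_ = ?U")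
  proof (intro set_eqI iffI)
    fix z :: "'a \<times> 'a" assume "z \<in> {z. dist (fst z) (snd z) < r}"
    then have "0 < (r - dist (fst z) (snd z)) / 2" by simp
    then obtain n where n: "1 / real (Suc n) < (r - dist (fst z) (snd z)) / 2"
      using nat_approx_posE by blast
    obtain q where q: "q \<in> D" "dist q (fst z) < 1 / real (Suc n)"
      using D(2)[of "1 / real (Suc n)" "fst z"] by auto
    have "dist q (snd z) < r - 1 / real (Suc n)"
      using dist_triangle[of q "snd z" "fst z"] q(2) n by argo
    with q have "z \<in> ball q (1 / real (Suc n)) \<times> ball q (r - 1 / real (Suc n))"
      by (simp add: mem_Times_iff)
    with q(1) show "z \<in> ?U" by blast
  next
    fix z assume "z \<in> ?U"
    then obtain q n where "dist q (fst z) < 1 / real (Suc n)" "dist q (snd z) < r - 1 / real (Suc n)"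
      by (auto simp: mem_Times_iff)
    then have "dist (fst z) (snd z) < r"
      using dist_triangle[of "fst z" "snd z" q] unfolding dist_commute[of "fst z" q] by argo
    then show "z \<in> {z. dist (fst z) (snd z) < r}" by simp
  qed
  also have "\<dots> \<in> sets (M \<Otimes>\<^sub>M M)"
    using D(1) by (intro sets.countable_UN' sets.countable_UN pair_measureI) auto
  finally show ?thesis .
qed

lemma indicator_ball_measurable:
  "(\<lambda>z. indicator (ball (fst z) r) (snd z) :: ennreal) \<in> borel_measurable (M \<Otimes>\<^sub>M M)"
proof -
  have "(\<lambda>z :: 'a \<times> 'a. indicator (ball (fst z) r) (snd z) :: ennreal) = indicator {z. dist (fst z) (snd z) < r}"
    by (auto simp: indicator_def)
  then show ?thesis by (simp only: borel_measurable_indicator[OF dist_less_sets])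
qed

lemma ball_integral_measurable:
  assumes "h \<in> borel_measurable borel"
  shows "(\<lambda>x. \<integral>\<^sup>+y\<in>ball x r. h y \<partial>M) \<in> borel_measurable M"
proof -
  interpret sigma_finite_measure M by (rule sigma_finite)
  have [measurable]: "h \<in> borel_measurable M" using assms by (rule borel_imp_measurable)
  note [measurable] = indicator_ball_measurable
  have "(\<lambda>x. \<integral>\<^sup>+y. (case (x, y) of z \<Rightarrow> h (snd z) * indicator (ball (fst z) r) (snd z)) \<partial>M) \<in> borel_measurable M"
    by (intro borel_measurable_nn_integral_fst) measurable
  then show ?thesis by simp
qed

lemma emeasure_ball_measurable: "(\<lambda>x. emeasure M (ball x r)) \<in> borel_measurable M"
  using ball_integral_measurable[of "\<lambda>_. 1" r] by simp

definition avg_pow :: "('a \<Rightarrow> ennreal) \<Rightarrow> 'a \<Rightarrow> real \<Rightarrow> ennreal" where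
  "avg_pow g x r = energy_on (ball x r) g / emeasure M (ball x r)"

lemma avg_pow_measurable:
  assumes "g \<in> borel_measurable borel"
  shows "(\<lambda>x. avg_pow g x r) \<in> borel_measurable M"
  unfolding avg_pow_def using assms
  by (intro borel_measurable_divide_ennreal ball_integral_measurable emeasure_ball_measurable
      measurable_epowr)

text \<open>By Fubini each point \<open>y\<close> is counted with weight close to 1, since
  \<open>ball x r\<close> and \<open>ball y r\<close> have comparable measures when
  \<open>y \<in> ball x r\<close>. The constant does not depend on \<open>r\<close>, so all scales
  can be summed with weights.\<close>

lemma nn_integral_avg_pow_le:
  assumes g: "g \<in> borel_measurable borel" and r: "0 < r"
  shows "(\<integral>\<^sup>+x. avg_pow g x r \<partial>M) \<le> ennreal C * energy g"
proof -
  interpret P: pair_sigma_finite M M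
    by (rule pair_sigma_finite.intro) (rule sigma_finite)+
  define h where "h y = epowr (g y) p" for y
  \<comment> \<open>Normalized by the ball around \<open>y\<close> instead of \<open>x\<close>:
    integration in \<open>x\<close> then cancels the measure exactly, and the price of the exchange
    is the factor \<open>C\<close>.\<close>
  define H where "H y = ennreal C * h y / emeasure M (ball y r)" for y
  note [measurable] = indicator_ball_measurable emeasure_ball_measurable
  have [measurable]: "h \<in> borel_measurable M"
    unfolding h_def by (intro borel_imp_measurable measurable_epowr g)
  have H_meas [measurable]: "H \<in> borel_measurable M" unfolding H_def by measurable
  have "avg_pow g x r \<le> (\<integral>\<^sup>+y. H y * indicator (ball x r) y \<partial>M)" for x
  proof -
    have "avg_pow g x r = (\<integral>\<^sup>+y. h y * indicator (ball x r) y / emeasure M (ball x r) \<partial>M)"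
      unfolding avg_pow_def h_def[symmetric] by (intro nn_integral_divide[symmetric]) measurable
    also have "\<dots> \<le> (\<integral>\<^sup>+y. H y * indicator (ball x r) y \<partial>M)"
    proof (intro nn_integral_mono)
      fix y
      show "h y * indicator (ball x r) y / emeasure M (ball x r) \<le> H y * indicator (ball x r) y"
      proof (cases "y \<in> ball x r")
        case True
        have "ball y r \<subseteq> ball x (2 * r)"
        proof
          fix z assume "z \<in> ball y r"
          then show "z \<in> ball x (2 * r)" using True dist_triangle[of x z y] by simp
        qed
        then have "emeasure M (ball y r) \<le> emeasure M (ball x (2 * r))" by (intro emeasure_mono) auto
        also have "\<dots> \<le> ennreal C * emeasure M (ball x r)" using r by (rule doubling)
        finally have le: "emeasure M (ball y r) \<le> ennreal C * emeasure M (ball x r)" .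
        have "1 / emeasure M (ball x r) \<le> ennreal C / emeasure M (ball y r)"
          using le measure_ball_pos[OF r, of x] measure_ball_pos[OF r, of y] C_pos unfolding emeasure_ball
          by (simp add: ennreal_mult[symmetric] ennreal_le_iff divide_ennreal field_simps
              flip: ennreal_1)
        then have "h y / emeasure M (ball x r) \<le> ennreal C * (h y / emeasure M (ball y r))"
          by (rule ennreal_divide_mono_ratio)
        then show ?thesis
          using True by (simp add: H_def ennreal_times_divide)
      qed simp
    qed
    finally show ?thesis .
  qed
  then have "(\<integral>\<^sup>+x. avg_pow g x r \<partial>M) \<le> (\<integral>\<^sup>+x. (\<integral>\<^sup>+y. H y * indicator (ball x r) y \<partial>M) \<partial>M)"
    by (intro nn_integral_mono)
  also have "\<dots> = (\<integral>\<^sup>+y. (\<integral>\<^sup>+x. H y * indicator (ball x r) y \<partial>M) \<partial>M)"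
  proof (rule P.Fubini'[symmetric])
    have "(\<lambda>z. H (snd z) * indicator (ball (fst z) r) (snd z)) \<in> borel_measurable (M \<Otimes>\<^sub>M M)"
      by measurable
    then show "(\<lambda>(x, y). H y * indicator (ball x r) y) \<in> borel_measurable (M \<Otimes>\<^sub>M M)"
      by (simp add: case_prod_beta')
  qed
  also have "\<dots> = (\<integral>\<^sup>+y. H y * emeasure M (ball y r) \<partial>M)"
  proof (intro nn_integral_cong)
    fix y
    have "(\<integral>\<^sup>+x. H y * indicator (ball x r) y \<partial>M) = (\<integral>\<^sup>+x. H y * indicator (ball y r) x \<partial>M)"
      by (intro nn_integral_cong) (auto simp: indicator_def dist_commute)
    then show "(\<integral>\<^sup>+x. H y * indicator (ball x r) y \<partial>M) = H y * emeasure M (ball y r)"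
      by (simp add: nn_integral_cmult_indicator)
  qed
  also have "\<dots> = (\<integral>\<^sup>+y. ennreal C * h y \<partial>M)"
  proof (intro nn_integral_cong)
    fix y
    show "H y * emeasure M (ball y r) = ennreal C * h y"
      unfolding H_def using ball_neq_0[OF r, of y] ball_neq_top[OF r, of y]
      by (simp add: ennreal_divide_times less_top)
  qed
  also have "\<dots> = ennreal C * (\<integral>\<^sup>+y. h y \<partial>M)" by (intro nn_integral_cmult) measurable
  finally show ?thesis by (simp add: h_def)
qed

end

section \<open>Ball means of bounded continuous functions\<close>

locale poincare_space = doubling_space +
  fixes K L :: real
  assumes K_pos: "0 < K" and L_ge_1: "1 \<le> L"
    and poincare: "\<lbrakk>r > 0; u \<in> borel_measurable (restrict_space M (ball x (L * r)));
        (\<integral>\<^sup>+y\<in>ball x (L * r). e2ennreal \<bar>u y\<bar> \<partial>M) < \<infinity>;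
        upper_gradient_on (ball x (L * r)) u g\<rbrakk> \<Longrightarrow>
      (\<integral>\<^sup>+y\<in>ball x r. e2ennreal \<bar>u y - ereal (mean_on M (ball x r) u)\<bar> \<partial>M) / emeasure M (ball x r)
        \<le> ennreal (K * r) * epowr ((\<integral>\<^sup>+y\<in>ball x (L * r). epowr (g y) p \<partial>M)
             / emeasure M (ball x (L * r))) (1 / p)"
begin

definition avg :: "('a \<Rightarrow> real) \<Rightarrow> 'a \<Rightarrow> real \<Rightarrow> real" where
  "avg w x r = (LINT y:ball x r|M. w y) / measure M (ball x r)"

lemma upper_gradient_on_subset:
  assumes "upper_gradient_on UNIV u g" shows "upper_gradient_on A u g"
proof -
  have "g \<in> borel_measurable borel"
    by (rule upper_gradient_measurable[OF assms])
  then show ?thesis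
    using assms curves_in_mono[of A UNIV] by (auto simp: upper_gradient_on_def intro: measurable_restrict_space1)
qed

text \<open>Boundedness supplies the integrability that the Poincare inequality asks for; general
  functions are reached through truncation.\<close>

lemma poincare_bounded:
  assumes w: "continuous_on UNIV w" "\<And>x. \<bar>w x\<bar> \<le> b"
    and ug: "upper_gradient_on UNIV (\<lambda>x. ereal (w x)) g" and r: "0 < r"
  shows "(\<integral>\<^sup>+y\<in>ball x r. ennreal \<bar>w y - avg w x r\<bar> \<partial>M) / emeasure M (ball x r)
    \<le> ennreal (K * r) * epowr (avg_pow g x (L * r)) (1 / p)"
proof -
  have wm: "w \<in> borel_measurable M"
    using w(1) by (intro borel_imp_measurable borel_measurable_continuous_onI)
  have "(\<integral>\<^sup>+y\<in>ball x (L * r). e2ennreal \<bar>ereal (w y)\<bar> \<partial>M) \<le> (\<integral>\<^sup>+y\<in>ball x (L * r). ennreal b \<partial>M)"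
    using w(2) by (intro nn_integral_mono mult_right_mono) (auto intro: ennreal_leI)
  also have "\<dots> = ennreal b * emeasure M (ball x (L * r))" by (intro nn_integral_cmult_indicator) simp
  also have "\<dots> < \<infinity>" using ball_finite by (simp add: ennreal_mult_less_top)
  finally have fin: "(\<integral>\<^sup>+y\<in>ball x (L * r). e2ennreal \<bar>ereal (w y)\<bar> \<partial>M) < \<infinity>" .
  have meas: "(\<lambda>y. ereal (w y)) \<in> borel_measurable (restrict_space M (ball x (L * r)))"
    using wm by (intro measurable_restrict_space1) measurable
  show ?thesis
    using poincare[OF r meas fin upper_gradient_on_subset[OF ug]]
    by (simp add: mean_on_def avg_def avg_pow_def)
qed

text \<open>The difference of means is the mean over the small ball of the deviation from the mean
  over the large one. Extending the integration to the large ball costs the ratio \<open>D\<close>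
  of the measures.\<close>

lemma avg_diff_bound:
  assumes w: "continuous_on UNIV w" "\<And>x. \<bar>w x\<bar> \<le> b"
    and ug: "upper_gradient_on UNIV (\<lambda>x. ereal (w x)) g"
    and rs: "0 < r" "0 < s" and sub: "ball y s \<subseteq> ball x r"
    and D: "0 \<le> D" "emeasure M (ball x r) \<le> ennreal D * emeasure M (ball y s)"
  shows "ennreal \<bar>avg w y s - avg w x r\<bar> \<le> ennreal (D * K * r) * epowr (avg_pow g x (L * r)) (1 / p)"
proof -
  define c where "c = avg w x r"
  have wm: "w \<in> borel_measurable M"
    using w(1) by (intro borel_imp_measurable borel_measurable_continuous_onI)
  have m: "0 < measure M (ball y s)" "0 < measure M (ball x r)" using rs measure_ball_pos by auto
  have fm: "ball y s \<in> fmeasurable M" using ball_finite by (intro fmeasurableI) auto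
  have int_w: "set_integrable M (ball y s) w" unfolding set_integrable_def
    using w(2) wm ball_finite[of y s]
    by (intro integrableI_bounded_set_indicator[where B = b]) (auto simp: less_top)
  have int_c: "set_integrable M (ball y s) (\<lambda>_. c)" unfolding set_integrable_def
    using ball_finite[of y s]
    by (intro integrableI_bounded_set_indicator[where B = "\<bar>c\<bar>"]) (auto simp: less_top)
  have "(LINT z:ball y s|M. w z - c) = (LINT z:ball y s|M. w z) - (LINT z:ball y s|M. c)"
    by (rule set_integral_diff(2)[OF int_w int_c])
  also have "(LINT z:ball y s|M. c) = measure M (ball y s) * c"
    using ball_finite[of y s] by (simp add: set_lebesgue_integral_def)
  finally have eq: "avg w y s - c = (LINT z:ball y s|M. w z - c) / measure M (ball y s)"
    using m by (simp add: avg_def diff_divide_distrib)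
  have "ennreal \<bar>LINT z:ball y s|M. w z - c\<bar> \<le> (\<integral>\<^sup>+z. ennreal (norm (indicator (ball y s) z *\<^sub>R (w z - c))) \<partial>M)"
    unfolding set_lebesgue_integral_def
    using integral_norm_bound_ennreal[of M "\<lambda>z. indicator (ball y s) z *\<^sub>R (w z - c)"]
      set_integral_diff(1)[OF int_w int_c] by (simp add: set_integrable_def)
  also have "\<dots> = (\<integral>\<^sup>+z\<in>ball y s. ennreal \<bar>w z - c\<bar> \<partial>M)"
    by (intro nn_integral_cong) (auto simp: indicator_def)
  also have "\<dots> \<le> (\<integral>\<^sup>+z\<in>ball x r. ennreal \<bar>w z - c\<bar> \<partial>M)" (is "_ \<le> ?I")
    using sub by (intro nn_integral_mono) (auto simp: indicator_def)
  finally have le: "ennreal \<bar>LINT z:ball y s|M. w z - c\<bar> \<le> ?I" .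
  have "ennreal \<bar>avg w y s - c\<bar> = ennreal \<bar>LINT z:ball y s|M. w z - c\<bar> / emeasure M (ball y s)"
    using m unfolding eq emeasure_ball by (simp add: divide_ennreal abs_divide)
  also have "\<dots> \<le> ?I / emeasure M (ball y s)" by (rule divide_right_mono_ennreal[OF le])
  also have "\<dots> \<le> ennreal D * (?I / emeasure M (ball x r))"
  proof -
    have "1 / emeasure M (ball y s) \<le> ennreal D / emeasure M (ball x r)"
      using D m unfolding emeasure_ball
      by (simp add: ennreal_mult[symmetric] ennreal_le_iff divide_ennreal field_simps flip: ennreal_1)
    then show ?thesis by (rule ennreal_divide_mono_ratio)
  qed
  also have "\<dots> \<le> ennreal D * (ennreal (K * r) * epowr (avg_pow g x (L * r)) (1 / p))"
    unfolding c_def by (intro mult_left_mono poincare_bounded[OF w ug rs(1)]) auto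
  also have "\<dots> = ennreal (D * K * r) * epowr (avg_pow g x (L * r)) (1 / p)"
    using D K_pos rs by (simp add: ennreal_mult[symmetric] mult.assoc[symmetric])
  finally show ?thesis by (simp add: c_def)
qed

lemma avg_tendsto:
  assumes w: "continuous_on UNIV w" "\<And>x. \<bar>w x\<bar> \<le> b" and R: "0 < R"
  shows "(\<lambda>j. avg w x (R / 4 ^ j)) \<longlonglongrightarrow> w x"
proof (rule LIMSEQ_I)
  fix e :: real assume e: "0 < e"
  have wm: "w \<in> borel_measurable M"
    using w(1) by (intro borel_imp_measurable borel_measurable_continuous_onI)
  obtain d where d: "0 < d" "\<And>y. dist y x < d \<Longrightarrow> \<bar>w y - w x\<bar> < e / 2"
    using w(1) e unfolding continuous_on_iff by (metis UNIV_I dist_real_def half_gt_zero)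
  have "(\<lambda>j. R * (1/4) ^ j) \<longlonglongrightarrow> R * 0" by (intro tendsto_intros) auto
  then have "eventually (\<lambda>j. R * (1/4) ^ j < d) sequentially" using d(1) by (intro order_tendstoD) auto
  then obtain N where N: "\<And>j. N \<le> j \<Longrightarrow> R / 4 ^ j < d"
    by (auto simp: eventually_sequentially power_divide)
  show "\<exists>N. \<forall>j\<ge>N. norm (avg w x (R / 4 ^ j) - w x) < e"
  proof (intro exI[of _ N] allI impI)
    fix j assume j: "N \<le> j"
    define s where "s = R / 4 ^ j"
    have s: "0 < s" "s < d" using R N[OF j] by (auto simp: s_def)
    have m: "0 < measure M (ball x s)" using s measure_ball_pos by auto
    have int_w: "set_integrable M (ball x s) w" unfolding set_integrable_def
      using w(2) wm ball_finite[of x s]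
      by (intro integrableI_bounded_set_indicator[where B = b]) (auto simp: less_top)
    have int_c: "set_integrable M (ball x s) (\<lambda>_. c)" for c :: real unfolding set_integrable_def
      using ball_finite[of x s]
      by (intro integrableI_bounded_set_indicator[where B = "\<bar>c\<bar>"]) (auto simp: less_top)
    have const: "(LINT z:ball x s|M. c) = measure M (ball x s) * c" for c :: real
      using ball_finite[of x s] by (simp add: set_lebesgue_integral_def)
    have near: "w z \<le> w x + e / 2" "w x - e / 2 \<le> w z" if "z \<in> ball x s" for z
    proof -
      have "\<bar>w z - w x\<bar> < e / 2" using that s by (intro d(2)) (simp add: dist_commute)
      then show "w z \<le> w x + e / 2" "w x - e / 2 \<le> w z" by linarith+
    qed
    have "(LINT z:ball x s|M. w z) \<le> (LINT z:ball x s|M. w x + e / 2)"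
      by (intro set_integral_mono int_w int_c near)
    moreover have "(LINT z:ball x s|M. w x - e / 2) \<le> (LINT z:ball x s|M. w z)"
      by (intro set_integral_mono int_w int_c near)
    ultimately have "measure M (ball x s) * (w x - e / 2) \<le> (LINT z:ball x s|M. w z)"
      "(LINT z:ball x s|M. w z) \<le> measure M (ball x s) * (w x + e / 2)"
      unfolding const by auto
    then have "w x - e / 2 \<le> avg w x s" "avg w x s \<le> w x + e / 2"
      using m by (simp_all add: avg_def pos_le_divide_eq pos_divide_le_eq mult.commute)
    then show "norm (avg w x (R / 4 ^ j) - w x) < e"
      using e unfolding s_def[symmetric] by simp
  qed
qed

end

section \<open>Telescoping over shrinking balls\<close>

lemma ennreal_abs_diff_triangle: "ennreal \<bar>a - c\<bar> \<le> ennreal \<bar>a - b\<bar> + ennreal \<bar>b - c\<bar>"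
proof -
  have "ennreal \<bar>a - c\<bar> \<le> ennreal (\<bar>a - b\<bar> + \<bar>b - c\<bar>)" by (intro ennreal_leI) auto
  also have "\<dots> = ennreal \<bar>a - b\<bar> + ennreal \<bar>b - c\<bar>" by (rule ennreal_plus) auto
  finally show ?thesis .
qed

lemma ennreal_mult_mult: "0 \<le> a \<Longrightarrow> 0 \<le> b \<Longrightarrow> ennreal a * (ennreal b * x) = ennreal (a * b) * x"
  by (simp add: ennreal_mult mult.assoc)

context poincare_space begin

text \<open>Radii shrink by the factor 4 so that the weight \<open>R / 4 ^ j\<close> splits into two
  factors \<open>1 / 2 ^ j\<close>: one turns the sum into a supremum, the other keeps the sum of
  the p-th powers convergent. The first term accounts for the step from \<open>ball x R\<close> to
  the fixed ball of radius \<open>2 * R\<close> around \<open>x0\<close>.\<close>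

definition osc_bound :: "('a \<Rightarrow> ennreal) \<Rightarrow> 'a \<Rightarrow> real \<Rightarrow> 'a \<Rightarrow> ennreal" where
  "osc_bound g x0 R x = ennreal (2 * (C\<^sup>2 * K * R)) * epowr (avg_pow g x0 (L * (2 * R))) (1 / p)
     + (\<Sum>j. ennreal (C\<^sup>2 * K * R / 4 ^ j) * epowr (avg_pow g x (L * (R / 4 ^ j))) (1 / p))"

lemma osc_bound_measurable:
  "g \<in> borel_measurable borel \<Longrightarrow> osc_bound g x0 R \<in> borel_measurable M"
  using avg_pow_measurable[of g] unfolding osc_bound_def by measurable

lemma abs_diff_avg_le_osc_bound:
  assumes w: "continuous_on UNIV w" "\<And>x. \<bar>w x\<bar> \<le> b"
    and ug: "upper_gradient_on UNIV (\<lambda>x. ereal (w x)) g"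
    and R: "0 < R" and x: "x \<in> ball x0 R"
  shows "ennreal \<bar>w x - avg w x0 (2 * R)\<bar> \<le> osc_bound g x0 R x"
proof -
  have "ennreal \<bar>w x - avg w x (R / 4 ^ 0)\<bar>
      \<le> (\<Sum>j. ennreal (C\<^sup>2 * K * R / 4 ^ j) * epowr (avg_pow g x (L * (R / 4 ^ j))) (1 / p))"
  proof (rule telescoping_bound)
    show "(\<lambda>j. avg w x (R / 4 ^ j)) \<longlonglongrightarrow> w x" by (rule avg_tendsto[OF w R])
    fix j
    have "ennreal \<bar>avg w x (R / 4 ^ Suc j) - avg w x (R / 4 ^ j)\<bar>
        \<le> ennreal (C\<^sup>2 * K * (R / 4 ^ j)) * epowr (avg_pow g x (L * (R / 4 ^ j))) (1 / p)"
    proof (rule avg_diff_bound[OF w ug])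
      show "0 < R / 4 ^ j" "0 < R / 4 ^ Suc j" using R by auto
      show "ball x (R / 4 ^ Suc j) \<subseteq> ball x (R / 4 ^ j)" using R by (intro subset_ball) (simp add: field_simps)
      show "0 \<le> C\<^sup>2" by simp
      show "emeasure M (ball x (R / 4 ^ j)) \<le> ennreal (C\<^sup>2) * emeasure M (ball x (R / 4 ^ Suc j))"
        using doubling_4[of "R / 4 ^ Suc j" x] R by simp
    qed
    then show "ennreal \<bar>avg w x (R / 4 ^ Suc j) - avg w x (R / 4 ^ j)\<bar>
        \<le> ennreal (C\<^sup>2 * K * R / 4 ^ j) * epowr (avg_pow g x (L * (R / 4 ^ j))) (1 / p)"
      by simp
  qed
  \<comment> \<open>\<open>ball x0 (2 * R)\<close> contains \<open>ball x R\<close> for each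
    \<open>x\<close> in \<open>ball x0 R\<close>, so its mean is a reference value common to all
    these \<open>x\<close>.\<close>
  moreover have "ennreal \<bar>avg w x R - avg w x0 (2 * R)\<bar>
      \<le> ennreal (C\<^sup>2 * K * (2 * R)) * epowr (avg_pow g x0 (L * (2 * R))) (1 / p)"
  proof (rule avg_diff_bound[OF w ug])
    show "0 < 2 * R" "0 < R" "0 \<le> C\<^sup>2" using R by auto
    show "ball x R \<subseteq> ball x0 (2 * R)"
    proof
      fix z assume "z \<in> ball x R"
      then show "z \<in> ball x0 (2 * R)" using x dist_triangle[of x0 z x] by simp
    qed
    have "ball x0 (2 * R) \<subseteq> ball x (4 * R)"
    proof
      fix z assume "z \<in> ball x0 (2 * R)"
      then show "z \<in> ball x (4 * R)" using x R dist_triangle[of x z x0] by (simp add: dist_commute)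
    qed
    then have "emeasure M (ball x0 (2 * R)) \<le> emeasure M (ball x (4 * R))" by (intro emeasure_mono) auto
    also have "\<dots> \<le> ennreal (C\<^sup>2) * emeasure M (ball x R)" by (rule doubling_4[OF R])
    finally show "emeasure M (ball x0 (2 * R)) \<le> ennreal (C\<^sup>2) * emeasure M (ball x R)" .
  qed
  moreover have "ennreal \<bar>w x - avg w x0 (2 * R)\<bar>
      \<le> ennreal \<bar>avg w x R - avg w x0 (2 * R)\<bar> + ennreal \<bar>w x - avg w x R\<bar>"
    by (subst add.commute) (rule ennreal_abs_diff_triangle)
  ultimately show ?thesis
    unfolding osc_bound_def by (auto intro: order_trans add_mono simp: mult.left_commute)
qed

text \<open>In the constant, 4 is the product of the 2 from \<open>epowr_add_le\<close> and a 2 that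
  is the first coefficient of \<open>osc_bound\<close> or the sum of the geometric weights. In
  \<open>1 + 2 * C\<close> the 1 belongs to the fixed ball and \<open>2 * C\<close> to the series,
  each scale of which costs \<open>C\<close> by Fubini.\<close>

lemma nn_integral_osc_bound:
  assumes g: "g \<in> borel_measurable borel" and R: "0 < R"
  shows "(\<integral>\<^sup>+x\<in>ball x0 R. epowr (osc_bound g x0 R x) p \<partial>M)
    \<le> ennreal ((4 * C\<^sup>2 * K) powr p * (1 + 2 * C) * R powr p) * energy g"
proof -
  define k where "k = C\<^sup>2 * K * R"
  define A where "A j x = avg_pow g x (L * (R / 4 ^ j))" for j x
  define A0 where "A0 = avg_pow g x0 (L * (2 * R))"
  define E where "E = energy g"
  have k: "0 < k" using C_pos K_pos R by (simp add: k_def)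
  have A_meas [measurable]: "A j \<in> borel_measurable M" for j
    unfolding A_def by (rule avg_pow_measurable[OF g])
  have pointwise: "epowr (osc_bound g x0 R x) p
      \<le> ennreal ((4 * k) powr p) * (A0 + (\<Sum>j. ennreal ((1/2) ^ j) * A j x))" for x
  proof -
    define e where "e j = epowr (A j x) (1 / p)" for j
    have e: "epowr (e j) p = A j x" for j using p_neq_0 by (simp add: e_def)
    have "(\<Sum>j. ennreal (k / 4 ^ j) * e j) = (\<Sum>j. ennreal ((1/2) ^ j) * (ennreal (k / 2 ^ j) * e j))"
    proof (intro suminf_cong)
      fix j
      have "k / 4 ^ j = (1/2) ^ j * (k / 2 ^ j)"
        by (simp add: power_divide power_mult_distrib[symmetric])
      then have "ennreal (k / 4 ^ j) = ennreal ((1/2) ^ j) * ennreal (k / 2 ^ j)"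
        using k by (simp add: ennreal_mult[symmetric])
      then show "ennreal (k / 4 ^ j) * e j = ennreal ((1/2) ^ j) * (ennreal (k / 2 ^ j) * e j)"
        by (simp add: mult.assoc)
    qed
    also have "\<dots> \<le> ennreal 2 * (SUP j. ennreal (k / 2 ^ j) * e j)"
      by (rule suminf_half_power_le_SUP)
    finally have "epowr (\<Sum>j. ennreal (k / 4 ^ j) * e j) p
        \<le> epowr (ennreal 2 * (SUP j. ennreal (k / 2 ^ j) * e j)) p"
      by (rule epowr_mono[OF _ p_nonneg])
    also have "\<dots> = ennreal (2 powr p) * epowr (SUP j. ennreal (k / 2 ^ j) * e j) p"
      by (simp only: epowr_mult[OF p_pos] epowr_ennreal[of 2 p])
    also have "\<dots> \<le> ennreal (2 powr p) * (\<Sum>j. epowr (ennreal (k / 2 ^ j) * e j) p)"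
      by (intro mult_left_mono epowr_SUP_le p_pos) auto
    also have "\<dots> \<le> ennreal (2 powr p) * (\<Sum>j. ennreal (k powr p) * (ennreal ((1/2) ^ j) * A j x))"
    proof (intro mult_left_mono suminf_le)
      fix j
      \<comment> \<open>For p at least 1 the p-th power of the second geometric factor is no larger
        than the factor itself, so summability survives.\<close>
      have "(1 / 2 ^ j) powr p \<le> (1 / 2 ^ j :: real) powr 1"
        using p_gt_1 by (intro powr_mono') auto
      then have "(k / 2 ^ j) powr p \<le> k powr p * (1/2) ^ j"
        using k by (simp add: powr_divide power_divide field_simps)
      then have "ennreal ((k / 2 ^ j) powr p) \<le> ennreal (k powr p) * ennreal ((1/2) ^ j)"
        using k by (simp add: ennreal_mult[symmetric] ennreal_leI)
      then have "ennreal ((k / 2 ^ j) powr p) * A j x \<le> ennreal (k powr p) * ennreal ((1/2) ^ j) * A j x"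
        by (intro mult_right_mono) auto
      then show "epowr (ennreal (k / 2 ^ j) * e j) p \<le> ennreal (k powr p) * (ennreal ((1/2) ^ j) * A j x)"
        using k e[of j] by (simp add: epowr_mult p_pos epowr_ennreal mult.assoc)
    qed auto
    also have "\<dots> = ennreal ((2 * k) powr p) * (\<Sum>j. ennreal ((1/2) ^ j) * A j x)"
      using k by (simp add: powr_mult ennreal_mult mult.assoc)
    finally have sum_le: "epowr (\<Sum>j. ennreal (k / 4 ^ j) * e j) p
      \<le> ennreal ((2 * k) powr p) * (\<Sum>j. ennreal ((1/2) ^ j) * A j x)" .
    have "epowr (osc_bound g x0 R x) p \<le> ennreal (2 powr p) *
        (epowr (ennreal (2 * k) * epowr A0 (1 / p)) p + epowr (\<Sum>j. ennreal (k / 4 ^ j) * e j) p)"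
      unfolding osc_bound_def k_def e_def A_def A0_def by (rule epowr_add_le[OF p_pos])
    also have "epowr (ennreal (2 * k) * epowr A0 (1 / p)) p = ennreal ((2 * k) powr p) * A0"
      using k p_neq_0 by (simp add: epowr_mult p_pos epowr_ennreal del: ennreal_numeral ennreal_mult')
    also have "ennreal (2 powr p) * (ennreal ((2 * k) powr p) * A0 + epowr (\<Sum>j. ennreal (k / 4 ^ j) * e j) p)
        \<le> ennreal (2 powr p) * (ennreal ((2 * k) powr p) * A0
            + ennreal ((2 * k) powr p) * (\<Sum>j. ennreal ((1/2) ^ j) * A j x))"
      by (intro mult_left_mono add_left_mono sum_le) auto
    also have "\<dots> = ennreal (2 powr p) * ennreal ((2 * k) powr p) * (A0 + (\<Sum>j. ennreal ((1/2) ^ j) * A j x))"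
      by (simp only: distrib_left mult.assoc)
    also have "ennreal (2 powr p) * ennreal ((2 * k) powr p) = ennreal ((4 * k) powr p)"
      using k by (simp add: ennreal_mult[symmetric] powr_mult[symmetric])
    finally show ?thesis .
  qed
  have A0_le: "A0 * emeasure M (ball x0 R) \<le> E"
  proof -
    have pos: "0 < L * (2 * R)" using L_ge_1 R by simp
    have "R * 1 \<le> (2 * R) * L" using L_ge_1 R by (intro mult_mono) auto
    then have "ball x0 R \<subseteq> ball x0 (L * (2 * R))" by (intro subset_ball) (simp add: mult.commute)
    then have "A0 * emeasure M (ball x0 R) \<le> A0 * emeasure M (ball x0 (L * (2 * R)))"
      by (intro mult_left_mono emeasure_mono) auto
    also have "\<dots> = energy_on (ball x0 (L * (2 * R))) g"
      unfolding A0_def avg_pow_def using ball_neq_0[OF pos, of x0] ball_neq_top[OF pos, of x0]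
      by (simp add: ennreal_divide_times less_top)
    also have "\<dots> \<le> E" unfolding E_def by (intro nn_integral_mono) (auto simp: indicator_def)
    finally show ?thesis .
  qed
  have "(\<integral>\<^sup>+x\<in>ball x0 R. epowr (osc_bound g x0 R x) p \<partial>M)
      \<le> (\<integral>\<^sup>+x. ennreal ((4 * k) powr p) * (A0 * indicator (ball x0 R) x + (\<Sum>j. ennreal ((1/2) ^ j) * A j x)) \<partial>M)"
    using pointwise by (intro nn_integral_mono) (auto simp: indicator_def)
  also have "\<dots> = ennreal ((4 * k) powr p) *
      (A0 * emeasure M (ball x0 R) + (\<Sum>j. ennreal ((1/2) ^ j) * (\<integral>\<^sup>+x. A j x \<partial>M)))"
    by (simp add: nn_integral_cmult nn_integral_add nn_integral_suminf nn_integral_cmult_indicator)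
  also have "\<dots> \<le> ennreal ((4 * k) powr p) * (E + (\<Sum>j. ennreal ((1/2) ^ j) * (ennreal C * E)))"
  proof (intro mult_left_mono add_mono A0_le suminf_le)
    show "(\<integral>\<^sup>+x. A j x \<partial>M) \<le> ennreal C * E" for j
      unfolding A_def E_def using R L_ge_1 by (intro nn_integral_avg_pow_le g) simp
  qed auto
  also have "(\<Sum>j. ennreal ((1/2) ^ j) * (ennreal C * E)) = ennreal 2 * (ennreal C * E)"
    by (simp only: ennreal_suminf_multc suminf_half_power)
  also have "E + ennreal 2 * (ennreal C * E) = ennreal (1 + 2 * C) * E"
    using C_pos by (simp add: ennreal_plus ennreal_mult distrib_right mult.assoc)
  also have "ennreal ((4 * k) powr p) * (ennreal (1 + 2 * C) * E)
      = ennreal ((4 * C\<^sup>2 * K) powr p * (1 + 2 * C) * R powr p) * E"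
  proof -
    have "(4 * k) powr p * (1 + 2 * C) = (4 * C\<^sup>2 * K) powr p * (1 + 2 * C) * R powr p"
      using C_pos K_pos R by (simp add: k_def powr_mult)
    then show ?thesis using C_pos by (subst ennreal_mult_mult) (simp_all add: mult_ac)
  qed
  finally show ?thesis by (simp add: E_def)
qed

section \<open>Truncation and the passage to unbounded functions\<close>

lemma upper_gradient_truncate:
  assumes "upper_gradient_on UNIV u g"
  shows "upper_gradient_on UNIV (\<lambda>x. max (- ereal b) (min (ereal b) (u x))) g"
proof -
  have lip: "\<bar>max (- ereal b) (min (ereal b) s) - max (- ereal b) (min (ereal b) t)\<bar> \<le> \<bar>s - t\<bar>" for s t
    by (cases s; cases t) (auto simp: min_def max_def)
  have "\<bar>max (- ereal b) (min (ereal b) (u (\<gamma> 0))) - max (- ereal b) (min (ereal b) (u (\<gamma> l)))\<bar>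
      \<le> enn2ereal (curve_integral (l, \<gamma>) g)" if "(l, \<gamma>) \<in> curves_in UNIV" for l \<gamma>
    using assms that lip by (fastforce simp: upper_gradient_on_def ug_ineq_def intro: order_trans)
  then show ?thesis using assms by (auto simp: upper_gradient_on_def ug_ineq_def)
qed

lemma truncation:
  assumes u: "continuous_on UNIV u" "upper_gradient_on UNIV u g" and b: "0 \<le> b"
  shows "\<exists>w. continuous_on UNIV w \<and> upper_gradient_on UNIV (\<lambda>x. ereal (w x)) g \<and>
    (\<forall>x. \<bar>w x\<bar> \<le> b \<and> ereal (w x) = max (- ereal b) (min (ereal b) (u x)))"
proof -
  define v where "v x = max (- ereal b) (min (ereal b) (u x))" for x
  define w where "w x = real_of_ereal (v x)" for x
  have v: "v x = ereal (w x)" "\<bar>w x\<bar> \<le> b" for x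
  proof -
    have "- ereal b \<le> v x" "v x \<le> ereal b" using b by (auto simp: v_def)
    then show "v x = ereal (w x)" "\<bar>w x\<bar> \<le> b"
      unfolding w_def by (cases "v x"; auto)+
  qed
  have "continuous_on UNIV v" unfolding v_def using u(1) by (intro continuous_intros)
  then have "continuous_on UNIV (\<lambda>x. ereal (w x))" by (simp add: v(1)[symmetric])
  then have "continuous_on UNIV w" by (simp add: continuous_on_def tendsto_ereal)
  moreover have "upper_gradient_on UNIV (\<lambda>x. ereal (w x)) g"
    using upper_gradient_truncate[OF u(2), of b] by (simp add: v(1)[symmetric] v_def)
  ultimately show ?thesis using v by (intro exI[of _ w]) (auto simp: v_def)
qed

text \<open>Were \<open>f\<close> above its mean wherever \<open>P\<close> holds on
  \<open>B\<close>, its excess over the mean would be positive almost everywhere on \<open>B\<close>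
  and yet have integral zero. The property \<open>P\<close> lets the point also avoid a null
  set.\<close>

lemma exists_point_below_average:
  assumes f: "f \<in> borel_measurable M" and B: "B \<in> sets M" "0 < emeasure M B"
    and fin: "(\<integral>\<^sup>+x\<in>B. f x \<partial>M) < \<infinity>" "emeasure M B < \<infinity>" and P: "AE x in M. P x"
  shows "\<exists>z\<in>B. P z \<and> f z * emeasure M B \<le> (\<integral>\<^sup>+x\<in>B. f x \<partial>M)"
proof (rule ccontr)
  define J where "J = (\<integral>\<^sup>+x\<in>B. f x \<partial>M)"
  define q where "q = J / emeasure M B"
  have qJ: "q * emeasure M B = J"
    using B fin unfolding q_def by (simp add: ennreal_divide_times less_top)
  assume contra: "\<not> (\<exists>z\<in>B. P z \<and> f z * emeasure M B \<le> (\<integral>\<^sup>+x\<in>B. f x \<partial>M))"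
  then have big: "q < f x" if "x \<in> B" "P x" for x
  proof -
    have "J < f x * emeasure M B" using contra that by (auto simp: J_def not_le)
    then have "q * emeasure M B < f x * emeasure M B" using qJ by simp
    then show ?thesis by (meson mult_right_mono not_le zero_le)
  qed
  note [measurable] = f B(1)
  have ae: "AE x in M. q * indicator B x \<le> f x * indicator B x"
    using P by eventually_elim (use big in \<open>auto simp: indicator_def intro: less_imp_le\<close>)
  have "(\<integral>\<^sup>+x. f x * indicator B x - q * indicator B x \<partial>M) = J - q * emeasure M B"
    unfolding J_def using ae fin qJ
    by (subst nn_integral_diff) (auto simp: nn_integral_cmult_indicator J_def)
  also have "\<dots> = 0" using qJ fin(1) by (simp add: J_def)
  finally have "AE x in M. f x * indicator B x - q * indicator B x = 0"
    by (subst (asm) nn_integral_0_iff_AE) auto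
  with P have "AE x in M. x \<notin> B"
  proof eventually_elim
    case (elim x)
    then show ?case using big[of x] by (auto simp: diff_eq_0_iff_ennreal)
  qed
  then have "emeasure M B = 0" using B(1) by (subst (asm) AE_iff_measurable[of B]) auto
  then show False using B by simp
qed

text \<open>
  The function \<open>u\<close> need not be integrable on balls, so its mean values are not available. Since
  \<^const>\<open>osc_bound\<close> does not depend on the truncation level, \<open>u z\<close> for a suitable point \<open>z\<close> serves as the
  constant instead.
\<close>

lemma Lp_poincare:
  assumes u: "continuous_on UNIV u" "upper_gradient_on UNIV u g" "Lp g"
    and fin: "AE x in M. \<bar>u x\<bar> \<noteq> \<infinity>" and R: "0 < R"
  shows "\<exists>c. (\<integral>\<^sup>+x\<in>ball x0 R. epowr (ennreal \<bar>real_of_ereal (u x) - c\<bar>) p \<partial>M)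
    \<le> ennreal (2 powr p * 2 * (4 * C\<^sup>2 * K) powr p * (1 + 2 * C) * R powr p) * energy g"
proof -
  define T where "T = osc_bound g x0 R"
  define J where "J = energy_on (ball x0 R) T"
  define E where "E = energy g"
  have T_meas [measurable]: "T \<in> borel_measurable M"
    unfolding T_def by (rule osc_bound_measurable[OF LpD(1)[OF u(3)]])
  have J_le: "J \<le> ennreal ((4 * C\<^sup>2 * K) powr p * (1 + 2 * C) * R powr p) * E"
    unfolding J_def T_def E_def by (rule nn_integral_osc_bound[OF LpD(1)[OF u(3)] R])
  have "E < \<infinity>" using LpD(2)[OF u(3)] by (simp add: E_def)
  then have "ennreal ((4 * C\<^sup>2 * K) powr p * (1 + 2 * C) * R powr p) * E < \<infinity>"
    by (simp add: ennreal_mult_less_top)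
  with J_le have J_fin: "J < \<infinity>" by order
  \<comment> \<open>With \<open>T z\<close> at most the mean in the p-th power, the constant term
    \<open>T z\<close> contributes no more than \<open>J\<close> to the final integral; this is the
    second factor 2 in the constant.\<close>
  have "\<exists>z\<in>ball x0 R. \<bar>u z\<bar> \<noteq> \<infinity> \<and> epowr (T z) p * emeasure M (ball x0 R) \<le> J"
    unfolding J_def using ball_measure[OF R, of x0] J_fin fin
    by (intro exists_point_below_average) (auto simp: J_def)
  then obtain z where z: "z \<in> ball x0 R" "\<bar>u z\<bar> \<noteq> \<infinity>" "epowr (T z) p * emeasure M (ball x0 R) \<le> J"
    by (elim bexE conjE)
  define c where "c = real_of_ereal (u z)"
  have diff: "ennreal \<bar>real_of_ereal (u x) - c\<bar> \<le> T x + T z" if x: "x \<in> ball x0 R" "\<bar>u x\<bar> \<noteq> \<infinity>" for x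
  proof -
    \<comment> \<open>The level is just high enough to leave \<open>u\<close> unchanged at
      \<open>x\<close> and \<open>z\<close>. It varies with \<open>x\<close>, which does no harm
      because \<open>T\<close> does not depend on it.\<close>
    define b where "b = max \<bar>real_of_ereal (u x)\<bar> \<bar>c\<bar>"
    have "0 \<le> b" by (simp add: b_def)
    from truncation[OF u(1,2) this] obtain w where w': "continuous_on UNIV w"
      "upper_gradient_on UNIV (\<lambda>x. ereal (w x)) g"
      "\<forall>x. \<bar>w x\<bar> \<le> b \<and> ereal (w x) = max (- ereal b) (min (ereal b) (u x))"
      by (elim exE conjE)
    then have w: "continuous_on UNIV w" "\<And>x. \<bar>w x\<bar> \<le> b" "upper_gradient_on UNIV (\<lambda>x. ereal (w x)) g"
      "\<And>x. ereal (w x) = max (- ereal b) (min (ereal b) (u x))" by auto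
    have w_eq: "w y = real_of_ereal (u y)" if y: "\<bar>u y\<bar> \<noteq> \<infinity>" "\<bar>real_of_ereal (u y)\<bar> \<le> b" for y
    proof -
      obtain r where r: "u y = ereal r" using y(1) by (cases "u y") auto
      with y(2) have "- b \<le> r" "r \<le> b" by auto
      then show ?thesis using w(4)[of y] r by (auto simp: min_def max_def split: if_splits)
    qed
    have "real_of_ereal (u x) = w x" "c = w z"
      using w_eq[of x] w_eq[of z] x(2) z(2) by (auto simp: b_def c_def)
    moreover have "ennreal \<bar>w x - w z\<bar>
      \<le> ennreal \<bar>w x - avg w x0 (2 * R)\<bar> + ennreal \<bar>w z - avg w x0 (2 * R)\<bar>"
      using ennreal_abs_diff_triangle[of "w x" "w z" "avg w x0 (2 * R)"] by (simp add: abs_minus_commute)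
    moreover have "ennreal \<bar>w x - avg w x0 (2 * R)\<bar> \<le> T x" "ennreal \<bar>w z - avg w x0 (2 * R)\<bar> \<le> T z"
      unfolding T_def using abs_diff_avg_le_osc_bound[OF w(1-3) R] x z by auto
    ultimately show ?thesis by (auto intro: order_trans add_mono)
  qed
  have "(\<integral>\<^sup>+x\<in>ball x0 R. epowr (ennreal \<bar>real_of_ereal (u x) - c\<bar>) p \<partial>M)
      \<le> (\<integral>\<^sup>+x. ennreal (2 powr p) * (epowr (T x) p * indicator (ball x0 R) x
            + epowr (T z) p * indicator (ball x0 R) x) \<partial>M)"
  proof (intro nn_integral_mono_AE, use fin in eventually_elim)
    case (elim x)
    show ?case
    proof (cases "x \<in> ball x0 R")
      case True
      have "epowr (ennreal \<bar>real_of_ereal (u x) - c\<bar>) p \<le> epowr (T x + T z) p"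
        using diff[OF True elim] by (rule epowr_mono[OF _ p_nonneg])
      also have "\<dots> \<le> ennreal (2 powr p) * (epowr (T x) p + epowr (T z) p)"
        by (rule epowr_add_le[OF p_pos])
      finally show ?thesis using True by simp
    qed simp
  qed
  also have "\<dots> = ennreal (2 powr p) * (J + epowr (T z) p * emeasure M (ball x0 R))"
    unfolding J_def
    by (simp add: nn_integral_cmult nn_integral_add nn_integral_cmult_indicator)
  also have "\<dots> \<le> ennreal (2 powr p) * (J + J)"
    by (intro mult_left_mono add_left_mono z) auto
  also have "\<dots> = ennreal (2 powr p * 2) * J"
    by (simp add: mult_2[symmetric] ennreal_mult mult.assoc)
  also have "\<dots> \<le> ennreal (2 powr p * 2) * (ennreal ((4 * C\<^sup>2 * K) powr p * (1 + 2 * C) * R powr p) * E)"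
    by (intro mult_left_mono J_le) auto
  also have "\<dots> = ennreal (2 powr p * 2 * (4 * C\<^sup>2 * K) powr p * (1 + 2 * C) * R powr p) * E"
    using C_pos by (simp add: ennreal_mult mult.assoc)
  finally show ?thesis unfolding E_def by blast
qed

end

section \<open>The averaged competitor\<close>

definition cutoff :: "'a::metric_space \<Rightarrow> real \<Rightarrow> 'a \<Rightarrow> real" where
  "cutoff x0 R x = min 1 (max 0 (2 - dist x0 x / R))"

lemma cutoff_bounds: "0 \<le> cutoff x0 R x" "cutoff x0 R x \<le> 1"
  by (auto simp: cutoff_def)

lemma cutoff_eq_1: "0 < R \<Longrightarrow> dist x0 x \<le> R \<Longrightarrow> cutoff x0 R x = 1"
  by (simp add: cutoff_def min_def max_def field_simps)

lemma cutoff_eq_0: "0 < R \<Longrightarrow> 2 * R \<le> dist x0 x \<Longrightarrow> cutoff x0 R x = 0"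
  by (simp add: cutoff_def field_simps)

lemma cutoff_lipschitz: "0 < R \<Longrightarrow> \<bar>cutoff x0 R x - cutoff x0 R y\<bar> \<le> dist x y / R"
proof -
  assume R: "0 < R"
  have clip: "\<bar>min 1 (max 0 a) - min 1 (max 0 b)\<bar> \<le> \<bar>a - b\<bar>" for a b :: real
    by (auto simp: min_def max_def)
  have "\<bar>cutoff x0 R x - cutoff x0 R y\<bar> \<le> \<bar>(2 - dist x0 x / R) - (2 - dist x0 y / R)\<bar>"
    unfolding cutoff_def by (rule clip)
  also have "\<dots> = \<bar>dist x0 y - dist x0 x\<bar> / R"
    using R by (simp add: abs_divide diff_divide_distrib[symmetric])
  also have "\<dots> \<le> dist x y / R"
    using R dist_triangle[of x0 y x] dist_triangle[of x0 x y]
    by (intro divide_right_mono) (auto simp: dist_commute abs_le_iff)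
  finally show ?thesis .
qed

lemma cutoff_continuous: "0 < R \<Longrightarrow> continuous_on UNIV (cutoff x0 R)"
  unfolding cutoff_def[abs_def] by (intro continuous_intros) auto

text \<open>The outer radius is 8 times the inner one, which is the growth factor of the scales:
  annuli belonging to different scales are disjoint.\<close>

definition annulus :: "'a::metric_space \<Rightarrow> real \<Rightarrow> 'a set" where
  "annulus x0 R = {x. R / 2 < dist x0 x \<and> dist x0 x < 4 * R}"

text \<open>
  The slack \<open>e > 0\<close> and the open annulus, which is larger than the region where the cutoff function
  varies, make the estimate along curves a local one, to which Bolzano's principle applies.
\<close>

definition cutoff_grad ::
  "('a::metric_space \<Rightarrow> ennreal) \<Rightarrow> ('a \<Rightarrow> real) \<Rightarrow> 'a \<Rightarrow> real \<Rightarrow> real \<Rightarrow> real \<Rightarrow> 'a \<Rightarrow> ennreal" where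
  "cutoff_grad g f x0 R c e x = g x * indicator {x. R / 2 < dist x0 x} x
     + ennreal (1 / R) * (ennreal (\<bar>f x - c\<bar> + e) * indicator (annulus x0 R) x)"

lemma dist_sets [measurable]: "{x. a < dist x0 x} \<in> sets borel" "{x. dist x0 x < a} \<in> sets borel"
  by (intro borel_open open_Collect_less continuous_intros)+

lemma annulus_sets [measurable]: "annulus x0 R \<in> sets borel"
  unfolding annulus_def by (intro borel_open open_Collect_conj open_Collect_less continuous_intros)

lemma cutoff_grad_measurable:
  assumes [measurable]: "g \<in> borel_measurable borel" "f \<in> borel_measurable borel"
  shows "cutoff_grad g f x0 R c e \<in> borel_measurable borel"
  unfolding cutoff_grad_def[abs_def] by measurable

lemma line_integral_const:
  "a \<le> b \<Longrightarrow> line_integral (\<lambda>_. k) \<gamma> a b = k * ennreal (b - a)"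
  by (simp add: line_integral_def nn_integral_cmult_indicator)

lemma ennreal_plus_mult:
  "0 \<le> x \<Longrightarrow> 0 \<le> y \<Longrightarrow> 0 \<le> z \<Longrightarrow> ennreal (x + y * z) = ennreal x + ennreal y * ennreal z"
  by (simp add: ennreal_mult)

text \<open>With \<eta> the cutoff, \<open>F\<close> is the convex combination (1 - \<eta>) f +
  \<eta> k along the curve, and the estimate is the product rule with \<eta> of Lipschitz constant 1
  / R. Well inside the ball \<open>F\<close> is constant and \<open>g\<close> drops out, so only
  energy of \<open>g\<close> away from \<open>x0\<close> enters.\<close>

lemma cutoff_interpolation_bound:
  fixes f :: "'a::metric_space \<Rightarrow> real" and k :: real and x0 :: 'a
  assumes c: "(l, \<gamma>) \<in> curves_in UNIV"
    and g: "g \<in> borel_measurable borel" and f: "f \<in> borel_measurable borel"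
    and cont: "continuous_on {0..l} (\<lambda>\<tau>. f (\<gamma> \<tau>))"
    and bound: "\<And>s t. 0 \<le> s \<Longrightarrow> s \<le> t \<Longrightarrow> t \<le> l \<Longrightarrow> ennreal \<bar>f (\<gamma> t) - f (\<gamma> s)\<bar> \<le> line_integral g \<gamma> s t"
    and R: "0 < R" and e: "0 < e" and st: "0 \<le> s" "s \<le> t" "t \<le> l"
  defines "F \<equiv> \<lambda>\<tau>. f (\<gamma> \<tau>) + cutoff x0 R (\<gamma> \<tau>) * (k - f (\<gamma> \<tau>))"
  shows "ennreal \<bar>F t - F s\<bar> \<le> line_integral (cutoff_grad g f x0 R k e) \<gamma> s t"
proof -
  let ?G = "cutoff_grad g f x0 R k e"
  have G_meas: "?G \<in> borel_measurable borel" by (rule cutoff_grad_measurable[OF g f])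
  define P where "P a b \<longleftrightarrow> (s \<le> a \<and> b \<le> t \<longrightarrow> ennreal \<bar>F b - F a\<bar> \<le> line_integral ?G \<gamma> a b)" for a b
  have near: "\<bar>dist x0 (\<gamma> \<sigma>) - dist x0 (\<gamma> \<tau>)\<bar> \<le> \<bar>\<sigma> - \<tau>\<bar>"
    if "s \<le> \<sigma>" "\<sigma> \<le> t" "s \<le> \<tau>" "\<tau> \<le> t" for \<sigma> \<tau>
  proof -
    have "dist (\<gamma> \<sigma>) (\<gamma> \<tau>) \<le> \<bar>\<sigma> - \<tau>\<bar>"
      using curve_dist_le[OF c, of \<sigma> \<tau>] curve_dist_le[OF c, of \<tau> \<sigma>] that st
      by (cases "\<sigma> \<le> \<tau>") (auto simp: dist_commute)
    then show ?thesis
      using dist_triangle[of x0 "\<gamma> \<sigma>" "\<gamma> \<tau>"] dist_triangle[of x0 "\<gamma> \<tau>" "\<gamma> \<sigma>"]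
      by (simp add: dist_commute)
  qed
  have "P s t"
    using st(2)
  proof (induction rule: Bolzano)
    case (trans a b d)
    show ?case unfolding P_def
    proof
      assume ad: "s \<le> a \<and> d \<le> t"
      have "ennreal \<bar>F d - F a\<bar> \<le> ennreal \<bar>F d - F b\<bar> + ennreal \<bar>F b - F a\<bar>"
        by (rule ennreal_abs_diff_triangle)
      also have "\<dots> \<le> line_integral ?G \<gamma> b d + line_integral ?G \<gamma> a b"
        using trans ad by (intro add_mono) (auto simp: P_def)
      also have "\<dots> = line_integral ?G \<gamma> a d"
        using trans ad st
        by (subst line_integral_add_interval[of a b d ?G])
           (auto simp: add.commute intro!: G_meas curve_continuous[OF c])
      finally show "ennreal \<bar>F d - F a\<bar> \<le> line_integral ?G \<gamma> a d" .
    qed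
  next
    case (local \<tau>)
    consider "dist x0 (\<gamma> \<tau>) < R" | "R \<le> dist x0 (\<gamma> \<tau>)" "dist x0 (\<gamma> \<tau>) \<le> 2 * R"
      | "2 * R < dist x0 (\<gamma> \<tau>)" by linarith
    then show ?case
    proof cases
      case 1
      show ?thesis
      proof (intro exI[of _ "R - dist x0 (\<gamma> \<tau>)"] conjI allI impI)
        show "0 < R - dist x0 (\<gamma> \<tau>)" using 1 by simp
        fix a b assume ab: "a \<le> \<tau> \<and> \<tau> \<le> b \<and> b - a < R - dist x0 (\<gamma> \<tau>)"
        show "P a b" unfolding P_def
        proof
          assume sab: "s \<le> a \<and> b \<le> t"
          have "dist x0 (\<gamma> a) \<le> R" "dist x0 (\<gamma> b) \<le> R"
            using near[of a \<tau>] near[of b \<tau>] ab sab local by auto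
          then show "ennreal \<bar>F b - F a\<bar> \<le> line_integral ?G \<gamma> a b"
            using R by (simp add: F_def cutoff_eq_1)
        qed
      qed
    next
      case 3
      show ?thesis
      proof (intro exI[of _ "dist x0 (\<gamma> \<tau>) - 2 * R"] conjI allI impI)
        show "0 < dist x0 (\<gamma> \<tau>) - 2 * R" using 3 by simp
        fix a b assume ab: "a \<le> \<tau> \<and> \<tau> \<le> b \<and> b - a < dist x0 (\<gamma> \<tau>) - 2 * R"
        show "P a b" unfolding P_def
        proof
          assume sab: "s \<le> a \<and> b \<le> t"
          have far: "2 * R < dist x0 (\<gamma> \<sigma>)" if "a \<le> \<sigma>" "\<sigma> \<le> b" for \<sigma>
            using near[of \<sigma> \<tau>] ab sab local that by auto
          have "F a = f (\<gamma> a)" "F b = f (\<gamma> b)"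
            using far[of a] far[of b] ab R by (auto simp: F_def cutoff_eq_0)
          then have "ennreal \<bar>F b - F a\<bar> \<le> line_integral g \<gamma> a b"
            using bound[of a b] ab sab st by auto
          also have "\<dots> \<le> line_integral ?G \<gamma> a b"
          proof (rule line_integral_mono_on)
            fix \<sigma> assume "a \<le> \<sigma>" "\<sigma> \<le> b"
            from far[OF this] R show "g (\<gamma> \<sigma>) \<le> ?G (\<gamma> \<sigma>)"
              by (simp add: cutoff_grad_def add_increasing2)
          qed
          finally show "ennreal \<bar>F b - F a\<bar> \<le> line_integral ?G \<gamma> a b" .
        qed
      qed
    next
      case 2
      have "0 \<le> \<tau>" "\<tau> \<le> l" using local st by auto
      then obtain d where d: "0 < d" "\<And>\<sigma>. 0 \<le> \<sigma> \<Longrightarrow> \<sigma> \<le> l \<Longrightarrow> \<bar>\<sigma> - \<tau>\<bar> < d \<Longrightarrow> \<bar>f (\<gamma> \<sigma>) - f (\<gamma> \<tau>)\<bar> < e / 2"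
        using cont e unfolding continuous_on_iff
        by (metis atLeastAtMost_iff dist_real_def half_gt_zero)
      \<comment> \<open>The bound \<open>R / 2\<close> keeps the short interval inside the open
        annulus, the bound \<open>d\<close> keeps the oscillation of \<open>f\<close> on it below
        the slack \<open>e\<close>.\<close>
      show ?thesis
      proof (intro exI[of _ "min d (R / 2)"] conjI allI impI)
        show "0 < min d (R / 2)" using R d by simp
        fix a b assume ab: "a \<le> \<tau> \<and> \<tau> \<le> b \<and> b - a < min d (R / 2)"
        show "P a b" unfolding P_def
        proof
          assume sab: "s \<le> a \<and> b \<le> t"
          have in_annulus: "\<gamma> \<sigma> \<in> annulus x0 R" if "a \<le> \<sigma>" "\<sigma> \<le> b" for \<sigma>
            using near[of \<sigma> \<tau>] ab sab local that 2 R by (auto simp: annulus_def)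
          have osc: "\<bar>f (\<gamma> a) - k\<bar> \<le> \<bar>f (\<gamma> \<sigma>) - k\<bar> + e" if "a \<le> \<sigma>" "\<sigma> \<le> b" for \<sigma>
          proof -
            have "\<bar>f (\<gamma> a) - f (\<gamma> \<tau>)\<bar> < e / 2" "\<bar>f (\<gamma> \<sigma>) - f (\<gamma> \<tau>)\<bar> < e / 2"
              using d(2)[of a] d(2)[of \<sigma>] ab sab st that by auto
            then show ?thesis by linarith
          qed
          define \<eta> where "\<eta> \<sigma> = cutoff x0 R (\<gamma> \<sigma>)" for \<sigma>
          have "dist (\<gamma> b) (\<gamma> a) \<le> b - a"
            using curve_dist_le[OF c, of a b] ab sab st by (auto simp: dist_commute)
          then have \<eta>_lip: "\<bar>\<eta> b - \<eta> a\<bar> \<le> (b - a) / R"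
            unfolding \<eta>_def using R by (intro order_trans[OF cutoff_lipschitz] divide_right_mono) auto
          have "F b - F a = (1 - \<eta> b) * (f (\<gamma> b) - f (\<gamma> a)) - (f (\<gamma> a) - k) * (\<eta> b - \<eta> a)"
            by (simp add: F_def \<eta>_def algebra_simps)
          also have "\<bar>\<dots>\<bar> \<le> \<bar>1 - \<eta> b\<bar> * \<bar>f (\<gamma> b) - f (\<gamma> a)\<bar> + \<bar>f (\<gamma> a) - k\<bar> * \<bar>\<eta> b - \<eta> a\<bar>"
            unfolding abs_mult[symmetric] by (rule abs_triangle_ineq4)
          also have "\<dots> \<le> 1 * \<bar>f (\<gamma> b) - f (\<gamma> a)\<bar> + \<bar>f (\<gamma> a) - k\<bar> * ((b - a) / R)"
            using cutoff_bounds[of x0 R "\<gamma> b"] \<eta>_lip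
            by (intro add_mono mult_right_mono mult_left_mono) (auto simp: \<eta>_def)
          finally have "ennreal \<bar>F b - F a\<bar>
              \<le> ennreal (\<bar>f (\<gamma> b) - f (\<gamma> a)\<bar> + (\<bar>f (\<gamma> a) - k\<bar> / R) * (b - a))"
            by (intro ennreal_leI) simp
          also have "\<dots> = ennreal \<bar>f (\<gamma> b) - f (\<gamma> a)\<bar> + ennreal (\<bar>f (\<gamma> a) - k\<bar> / R) * ennreal (b - a)"
            using R ab by (intro ennreal_plus_mult) auto
          also have "\<dots> = ennreal \<bar>f (\<gamma> b) - f (\<gamma> a)\<bar> + line_integral (\<lambda>_. ennreal (\<bar>f (\<gamma> a) - k\<bar> / R)) \<gamma> a b"
            using ab by (simp add: line_integral_const)
          also have "\<dots> \<le> line_integral g \<gamma> a b + line_integral (\<lambda>x. ennreal (1 / R) * ennreal (\<bar>f x - k\<bar> + e)) \<gamma> a b"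
          proof (intro add_mono line_integral_mono_on)
            show "ennreal \<bar>f (\<gamma> b) - f (\<gamma> a)\<bar> \<le> line_integral g \<gamma> a b"
              using bound[of a b] ab sab st by auto
            fix \<sigma> assume \<sigma>: "a \<le> \<sigma>" "\<sigma> \<le> b"
            have "\<bar>f (\<gamma> a) - k\<bar> / R \<le> 1 / R * (\<bar>f (\<gamma> \<sigma>) - k\<bar> + e)"
              using osc[OF \<sigma>] R by (simp add: divide_right_mono)
            then have "ennreal (\<bar>f (\<gamma> a) - k\<bar> / R) \<le> ennreal (1 / R * (\<bar>f (\<gamma> \<sigma>) - k\<bar> + e))"
              by (rule ennreal_leI)
            also have "\<dots> = ennreal (1 / R) * ennreal (\<bar>f (\<gamma> \<sigma>) - k\<bar> + e)"
              using R e by (intro ennreal_mult) auto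
            finally show "ennreal (\<bar>f (\<gamma> a) - k\<bar> / R) \<le> ennreal (1 / R) * ennreal (\<bar>f (\<gamma> \<sigma>) - k\<bar> + e)" .
          qed
          also have "\<dots> = line_integral (\<lambda>x. g x + ennreal (1 / R) * ennreal (\<bar>f x - k\<bar> + e)) \<gamma> a b"
          proof (rule line_integral_add[symmetric])
            show "(\<lambda>x. ennreal (1 / R) * ennreal (\<bar>f x - k\<bar> + e)) \<in> borel_measurable borel"
              using f by measurable
            show "continuous_on {a..b} \<gamma>" using sab st by (intro curve_continuous[OF c]) auto
          qed (rule g)
          also have "\<dots> \<le> line_integral ?G \<gamma> a b"
          proof (rule line_integral_mono_on)
            fix \<sigma> assume "a \<le> \<sigma>" "\<sigma> \<le> b"
            from in_annulus[OF this] show "g (\<gamma> \<sigma>) + ennreal (1 / R) * ennreal (\<bar>f (\<gamma> \<sigma>) - k\<bar> + e) \<le> ?G (\<gamma> \<sigma>)"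
              by (simp add: cutoff_grad_def annulus_def)
          qed
          finally show "ennreal \<bar>F b - F a\<bar> \<le> line_integral ?G \<gamma> a b" .
        qed
      qed
    qed
  qed
  then show ?thesis by (simp add: P_def)
qed

text \<open>The perturbation, not the competitor: for \<open>n > 0\<close>, adding \<open>f\<close>
  gives the mean of the n functions obtained by moving \<open>f\<close> to the constant
  \<open>c i\<close> inside radius \<open>R i\<close>.\<close>

definition test_sum ::
  "('a::metric_space \<Rightarrow> real) \<Rightarrow> 'a \<Rightarrow> (nat \<Rightarrow> real) \<Rightarrow> (nat \<Rightarrow> real) \<Rightarrow> nat \<Rightarrow> 'a \<Rightarrow> real" where
  "test_sum f x0 R c n x = (\<Sum>i<n. 1 / real n * (cutoff x0 (R i) x * (c i - f x)))"

definition test_grad ::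
  "('a::metric_space \<Rightarrow> ennreal) \<Rightarrow> ('a \<Rightarrow> real) \<Rightarrow> 'a \<Rightarrow> (nat \<Rightarrow> real) \<Rightarrow> (nat \<Rightarrow> real) \<Rightarrow>
    (nat \<Rightarrow> real) \<Rightarrow> nat \<Rightarrow> 'a \<Rightarrow> ennreal" where
  "test_grad g f x0 R c e n x = (\<Sum>i<n. ennreal (1 / real n) * cutoff_grad g f x0 (R i) (c i) (e i) x)"

lemma test_grad_measurable:
  assumes "g \<in> borel_measurable borel" "f \<in> borel_measurable borel"
  shows "test_grad g f x0 R c e n \<in> borel_measurable borel"
  using cutoff_grad_measurable[OF assms] unfolding test_grad_def[abs_def] by measurable

lemma test_sum_bound:
  fixes u :: "'a::metric_space \<Rightarrow> ereal" and x0 :: 'a and k :: "nat \<Rightarrow> real"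
  assumes u: "continuous_on UNIV u" "ug_along u g (l, \<gamma>)" "g \<in> borel_measurable borel"
    and c: "(l, \<gamma>) \<in> curves_in UNIV" and fin: "line_integral g \<gamma> 0 l < \<infinity>"
    and Re: "\<And>i. 0 < R i" "\<And>i. 0 < e i" and n: "0 < n"
    and st: "0 \<le> s" "s \<le> t" "t \<le> l"
  defines "f \<equiv> \<lambda>x. real_of_ereal (u x)"
  defines "V \<equiv> \<lambda>\<tau>. f (\<gamma> \<tau>) + test_sum f x0 R k n (\<gamma> \<tau>)"
  shows "ennreal \<bar>V t - V s\<bar> \<le> line_integral (test_grad g f x0 R k e n) \<gamma> s t"
proof -
  have f_meas: "f \<in> borel_measurable borel"
    using u(1) by (simp add: f_def[abs_def] continuous_real_of_ereal_measurable)
  have "continuous_on {0..l} (\<lambda>\<tau>. u (\<gamma> \<tau>))"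
    using c by (intro continuous_on_compose2[OF u(1)]) (auto simp: curves_in_def)
  then have cont: "continuous_on {0..l} (\<lambda>\<tau>. f (\<gamma> \<tau>))"
    using ug_along_finite[OF u(2) c fin] continuous_on_iff_real[of "{0..l}" "\<lambda>\<tau>. u (\<gamma> \<tau>)"]
    by (simp add: f_def comp_def)
  define F where "F i \<tau> = f (\<gamma> \<tau>) + cutoff x0 (R i) (\<gamma> \<tau>) * (k i - f (\<gamma> \<tau>))" for i \<tau>
  have F: "ennreal \<bar>F i t - F i s\<bar> \<le> line_integral (cutoff_grad g f x0 (R i) (k i) (e i)) \<gamma> s t" for i
    unfolding F_def
    by (rule cutoff_interpolation_bound[OF c u(3) f_meas cont _ Re st])
       (use ug_along_real[OF u(2) c fin] in \<open>simp add: f_def\<close>)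
  \<comment> \<open>The weights add up to 1, so \<open>f\<close> distributes over the n
    modifications and each difference can be estimated separately.\<close>
  have V: "V \<tau> = (\<Sum>i<n. 1 / real n * F i \<tau>)" for \<tau>
    using n by (simp add: V_def F_def test_sum_def distrib_left sum.distrib)
  have "V t - V s = (\<Sum>i<n. 1 / real n * (F i t - F i s))"
    unfolding V by (simp add: sum_subtractf right_diff_distrib)
  then have "\<bar>V t - V s\<bar> \<le> (\<Sum>i<n. 1 / real n * \<bar>F i t - F i s\<bar>)"
    using sum_abs[of "\<lambda>i. 1 / real n * (F i t - F i s)" "{..<n}"] by (simp add: abs_mult)
  then have "ennreal \<bar>V t - V s\<bar> \<le> ennreal (\<Sum>i<n. 1 / real n * \<bar>F i t - F i s\<bar>)"
    by (rule ennreal_leI)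
  also have "\<dots> = (\<Sum>i<n. ennreal (1 / real n * \<bar>F i t - F i s\<bar>))"
    by (intro sum_ennreal[symmetric]) auto
  also have "\<dots> = (\<Sum>i<n. ennreal (1 / real n) * ennreal \<bar>F i t - F i s\<bar>)"
    by (intro sum.cong refl ennreal_mult) auto
  also have "\<dots> \<le> (\<Sum>i<n. ennreal (1 / real n) * line_integral (cutoff_grad g f x0 (R i) (k i) (e i)) \<gamma> s t)"
    by (intro sum_mono mult_left_mono F) auto
  also have "\<dots> = line_integral (test_grad g f x0 R k e n) \<gamma> s t"
  proof -
    have cont': "continuous_on {s..t} \<gamma>" using st by (intro curve_continuous[OF c]) auto
    have m: "cutoff_grad g f x0 (R i) (k i) (e i) \<in> borel_measurable borel" for i
      by (rule cutoff_grad_measurable[OF u(3) f_meas])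
    have m': "(\<lambda>x. ennreal (1 / real n) * cutoff_grad g f x0 (R i) (k i) (e i) x) \<in> borel_measurable borel" for i
      using m[of i] by measurable
    show ?thesis
      unfolding test_grad_def[abs_def]
      by (simp only: line_integral_sum[OF m' cont'] line_integral_cmult[OF m cont'])
  qed
  finally show ?thesis .
qed

text \<open>
  The summand \<open>k * g\<close> takes care of the curves on which \<open>g\<close> has infinite integral, where \<open>u\<close> may be
  infinite; its energy is negligible as \<open>k \<longrightarrow> 0\<close>.
\<close>

lemma upper_gradient_onI_finite:
  fixes v :: "'a::metric_space \<Rightarrow> ereal"
  assumes g: "g \<in> borel_measurable borel" and h: "h \<in> borel_measurable borel" and k: "0 < k"
    and ug: "\<And>l \<gamma>. (l, \<gamma>) \<in> curves_in UNIV \<Longrightarrow> line_integral g \<gamma> 0 l < \<infinity> \<Longrightarrow> ug_ineq v h (l, \<gamma>)"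
  shows "upper_gradient_on UNIV v (\<lambda>x. ennreal k * g x + h x)"
proof -
  have m: "(\<lambda>x. ennreal k * g x + h x) \<in> borel_measurable borel" using g h by measurable
  moreover have "ug_ineq v (\<lambda>x. ennreal k * g x + h x) (l, \<gamma>)" if c: "(l, \<gamma>) \<in> curves_in UNIV" for l \<gamma>
  proof (cases "line_integral g \<gamma> 0 l < \<infinity>")
    case True
    have "\<bar>v (\<gamma> 0) - v (\<gamma> l)\<bar> \<le> enn2ereal (curve_integral (l, \<gamma>) h)"
      using ug[OF c True] by (simp add: ug_ineq_def)
    also have "\<dots> \<le> enn2ereal (curve_integral (l, \<gamma>) (\<lambda>x. ennreal k * g x + h x))"
      unfolding less_eq_ennreal.rep_eq[symmetric] curve_integral_eq
      by (intro line_integral_mono) (auto simp: add_increasing)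
    finally show ?thesis by (simp add: ug_ineq_def)
  next
    case False
    then have "line_integral g \<gamma> 0 l = \<infinity>" by (metis less_top infinity_ennreal_def)
    moreover have "line_integral (\<lambda>x. ennreal k * g x) \<gamma> 0 l = ennreal k * line_integral g \<gamma> 0 l"
      using c by (intro line_integral_cmult g curve_continuous[OF c]) auto
    ultimately have "line_integral (\<lambda>x. ennreal k * g x) \<gamma> 0 l = \<infinity>"
      using k by (simp add: ennreal_mult_top)
    moreover have "line_integral (\<lambda>x. ennreal k * g x) \<gamma> 0 l \<le> line_integral (\<lambda>x. ennreal k * g x + h x) \<gamma> 0 l"
      by (intro line_integral_mono) (auto simp: add_increasing2)
    ultimately have "curve_integral (l, \<gamma>) (\<lambda>x. ennreal k * g x + h x) = \<infinity>"
      by (simp add: curve_integral_eq top_unique)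
    then show ?thesis by (simp add: ug_ineq_def)
  qed
  ultimately show ?thesis
    by (auto simp: upper_gradient_on_def measurable_cong_sets[OF sets_restrict_UNIV refl])
qed

text \<open>The first gradient enters the energy comparison, where \<open>a\<close> can be made
  small. The second only has to show that the test function lies in N^{1,p}, so a crude bound is
  enough there.\<close>

lemma upper_gradient_test_sum:
  fixes u :: "'a::metric_space \<Rightarrow> ereal" and x0 :: 'a and k :: "nat \<Rightarrow> real"
  assumes u: "continuous_on UNIV u" "upper_gradient_on UNIV u g"
    and Re: "\<And>i. 0 < R i" "\<And>i. 0 < e i" and n: "0 < n" and a: "0 < a"
  defines "f \<equiv> \<lambda>x. real_of_ereal (u x)"
  shows "upper_gradient_on UNIV (\<lambda>x. u x + ereal (test_sum f x0 R k n x))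
      (\<lambda>x. ennreal a * g x + test_grad g f x0 R k e n x)" (is ?A)
    and "upper_gradient_on UNIV (\<lambda>x. ereal (test_sum f x0 R k n x))
      (\<lambda>x. ennreal 1 * g x + (g x + test_grad g f x0 R k e n x))" (is ?B)
proof -
  have g: "g \<in> borel_measurable borel" by (rule upper_gradient_measurable[OF u(2)])
  have f: "f \<in> borel_measurable borel"
    using u(1) by (simp add: f_def[abs_def] continuous_real_of_ereal_measurable)
  have T: "test_grad g f x0 R k e n \<in> borel_measurable borel" by (rule test_grad_measurable[OF g f])
  have gT: "(\<lambda>x. g x + test_grad g f x0 R k e n x) \<in> borel_measurable borel" using g T by measurable
  define \<phi> where "\<phi> = test_sum f x0 R k n"
  have key: "ennreal \<bar>(f (\<gamma> l) + \<phi> (\<gamma> l)) - (f (\<gamma> 0) + \<phi> (\<gamma> 0))\<bar> \<le> line_integral (test_grad g f x0 R k e n) \<gamma> 0 l"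
    "ennreal \<bar>f (\<gamma> 0) - f (\<gamma> l)\<bar> \<le> line_integral g \<gamma> 0 l"
    "u (\<gamma> 0) = ereal (f (\<gamma> 0))" "u (\<gamma> l) = ereal (f (\<gamma> l))"
    if c: "(l, \<gamma>) \<in> curves_in UNIV" and fin: "line_integral g \<gamma> 0 l < \<infinity>" for l \<gamma>
  proof -
    have l: "0 \<le> l" using c by (auto simp: curves_in_def)
    have ug: "ug_along u g (l, \<gamma>)" by (rule ug_along_upper_gradient[OF u(2) c])
    show "ennreal \<bar>(f (\<gamma> l) + \<phi> (\<gamma> l)) - (f (\<gamma> 0) + \<phi> (\<gamma> 0))\<bar> \<le> line_integral (test_grad g f x0 R k e n) \<gamma> 0 l"
      using test_sum_bound[OF u(1) ug g c fin Re n order_refl l order_refl] by (simp add: f_def \<phi>_def)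
    show "ennreal \<bar>f (\<gamma> 0) - f (\<gamma> l)\<bar> \<le> line_integral g \<gamma> 0 l"
      using ug_along_real[OF ug c fin order_refl l order_refl] by (simp add: f_def abs_minus_commute)
    have "\<bar>u (\<gamma> 0)\<bar> \<noteq> \<infinity>" "\<bar>u (\<gamma> l)\<bar> \<noteq> \<infinity>" using ug_along_finite[OF ug c fin] l by auto
    then show "u (\<gamma> 0) = ereal (f (\<gamma> 0))" "u (\<gamma> l) = ereal (f (\<gamma> l))"
      by (auto simp: f_def ereal_real)
  qed
  show ?A
  proof (rule upper_gradient_onI_finite[OF g T a])
    fix l \<gamma> assume *: "(l, \<gamma>) \<in> curves_in (UNIV :: 'a set)" "line_integral g \<gamma> 0 l < \<infinity>"
    from key[OF this] show "ug_ineq (\<lambda>x. u x + ereal (test_sum f x0 R k n x)) (test_grad g f x0 R k e n) (l, \<gamma>)"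
      by (simp add: ug_ineq_def curve_integral_eq \<phi>_def less_eq_ennreal.rep_eq enn2ereal_ennreal abs_minus_commute)
  qed
  show ?B
  proof (rule upper_gradient_onI_finite[OF g gT zero_less_one])
    fix l \<gamma> assume *: "(l, \<gamma>) \<in> curves_in (UNIV :: 'a set)" "line_integral g \<gamma> 0 l < \<infinity>"
    have cont: "continuous_on {0..l} \<gamma>" using *(1) by (intro curve_continuous[OF *(1)]) auto
    \<comment> \<open>\<phi> is the competitor minus \<open>f\<close>, so the two gradients
      add.\<close>
    have "ennreal \<bar>\<phi> (\<gamma> 0) - \<phi> (\<gamma> l)\<bar> \<le> ennreal (\<bar>f (\<gamma> 0) - f (\<gamma> l)\<bar>
        + \<bar>(f (\<gamma> l) + \<phi> (\<gamma> l)) - (f (\<gamma> 0) + \<phi> (\<gamma> 0))\<bar>)"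
      by (intro ennreal_leI) linarith
    also have "\<dots> = ennreal \<bar>f (\<gamma> 0) - f (\<gamma> l)\<bar>
        + ennreal \<bar>(f (\<gamma> l) + \<phi> (\<gamma> l)) - (f (\<gamma> 0) + \<phi> (\<gamma> 0))\<bar>"
      by (rule ennreal_plus) auto
    also have "\<dots> \<le> line_integral g \<gamma> 0 l + line_integral (test_grad g f x0 R k e n) \<gamma> 0 l"
      by (intro add_mono key *)
    also have "\<dots> = line_integral (\<lambda>x. g x + test_grad g f x0 R k e n x) \<gamma> 0 l"
      by (rule line_integral_add[OF g T cont, symmetric])
    finally show "ug_ineq (\<lambda>x. ereal (test_sum f x0 R k n x)) (\<lambda>x. g x + test_grad g f x0 R k e n x) (l, \<gamma>)"
      by (simp add: ug_ineq_def curve_integral_eq \<phi>_def less_eq_ennreal.rep_eq enn2ereal_ennreal)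
  qed
qed

section \<open>Energy of the averaged competitor\<close>

lemma abs_diff_indicator_ball_measurable:
  assumes "f \<in> borel_measurable borel"
  shows "(\<lambda>x. ennreal (\<bar>f x - c\<bar> + e) * indicator (ball x0 r) x) \<in> borel_measurable borel"
proof -
  have [measurable]: "ball x0 r \<in> sets borel" by simp
  show ?thesis using assms by measurable
qed

context doubling_space begin

lemma Lp_sum:
  assumes "finite I" "\<And>i. i \<in> I \<Longrightarrow> Lp (h i)" shows "Lp (\<lambda>x. \<Sum>i\<in>I. h i x)"
  using assms by (induction I rule: finite_induct) (auto intro: Lp_zero Lp_add)

lemma Lp_cutoff_grad:
  assumes g: "Lp g" and f: "f \<in> borel_measurable borel"
    and fin: "(\<integral>\<^sup>+x\<in>ball x0 (4 * R). epowr (ennreal (\<bar>f x - c\<bar> + e)) p \<partial>M) < \<infinity>"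
  shows "Lp (\<lambda>x. ennreal (\<bar>f x - c\<bar> + e) * indicator (ball x0 (4 * R)) x)"
    and "Lp (cutoff_grad g f x0 R c e)"
proof -
  have "(\<integral>\<^sup>+x. epowr (ennreal (\<bar>f x - c\<bar> + e) * indicator (ball x0 (4 * R)) x) p \<partial>M)
      = (\<integral>\<^sup>+x\<in>ball x0 (4 * R). epowr (ennreal (\<bar>f x - c\<bar> + e)) p \<partial>M)"
    by (intro nn_integral_cong) (auto simp: indicator_def)
  moreover have "(\<lambda>x. ennreal (\<bar>f x - c\<bar> + e) * indicator (ball x0 (4 * R)) x) \<in> borel_measurable borel"
    by (rule abs_diff_indicator_ball_measurable[OF f])
  ultimately show *: "Lp (\<lambda>x. ennreal (\<bar>f x - c\<bar> + e) * indicator (ball x0 (4 * R)) x)"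
    using fin by (simp add: Lp_def)
  have "Lp (\<lambda>x. g x + ennreal (1 / R) * (ennreal (\<bar>f x - c\<bar> + e) * indicator (ball x0 (4 * R)) x))"
    by (intro Lp_add g Lp_cmult(1) *) auto
  then show "Lp (cutoff_grad g f x0 R c e)"
  proof (rule Lp_mono[OF _ cutoff_grad_measurable[OF LpD(1)[OF g] f]])
    fix x
    show "cutoff_grad g f x0 R c e x \<le> g x + ennreal (1 / R) * (ennreal (\<bar>f x - c\<bar> + e) * indicator (ball x0 (4 * R)) x)"
      unfolding cutoff_grad_def
      by (intro add_mono mult_left_mono) (auto simp: indicator_def annulus_def)
  qed
qed

text \<open>\<open>u\<close> itself need not be p-integrable over the whole space. The test function
  is, because each summand is supported in a ball on which the deviation of \<open>u\<close> from
  the constant is p-integrable.\<close>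

lemma test_sum_N1p:
  fixes u :: "'a \<Rightarrow> ereal"
  assumes u: "continuous_on UNIV u" "upper_gradient_on UNIV u g" and g: "Lp g"
    and Re: "\<And>i. 0 < R i" "\<And>i. 0 < e i" and n: "0 < n"
    and fin: "\<And>i. (\<integral>\<^sup>+x\<in>ball x0 (4 * R i). epowr (ennreal (\<bar>real_of_ereal (u x) - k i\<bar> + e i)) p \<partial>M) < \<infinity>"
  defines "f \<equiv> \<lambda>x. real_of_ereal (u x)"
  shows "(\<lambda>x. ereal (test_sum f x0 R k n x)) \<in> N1p_on M p UNIV"
    and "Lp (test_grad g f x0 R k e n)"
proof -
  have f: "f \<in> borel_measurable borel"
    using u(1) by (simp add: f_def[abs_def] continuous_real_of_ereal_measurable)
  have fin': "(\<integral>\<^sup>+x\<in>ball x0 (4 * R i). epowr (ennreal (\<bar>f x - k i\<bar> + e i)) p \<partial>M) < \<infinity>" for i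
    using fin[of i] by (simp add: f_def)
  define \<phi> where "\<phi> = test_sum f x0 R k n"
  show T: "Lp (test_grad g f x0 R k e n)"
    unfolding test_grad_def[abs_def]
    by (intro Lp_sum Lp_cmult(1) Lp_cutoff_grad(2) g f fin') auto
  have \<phi>_meas: "\<phi> \<in> borel_measurable borel"
    using f borel_measurable_continuous_onI[OF cutoff_continuous[OF Re(1)]]
    unfolding \<phi>_def test_sum_def[abs_def] by measurable
  have "Lp (\<lambda>x. ennreal \<bar>\<phi> x\<bar>)"
  proof (rule Lp_mono)
    show "Lp (\<lambda>x. \<Sum>i<n. ennreal (1 / real n) * (ennreal (\<bar>f x - k i\<bar> + e i) * indicator (ball x0 (4 * R i)) x))"
      by (intro Lp_sum Lp_cmult(1) Lp_cutoff_grad(1)[OF g f fin']) auto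
    show "(\<lambda>x. ennreal \<bar>\<phi> x\<bar>) \<in> borel_measurable borel" using \<phi>_meas by measurable
    fix x
    have "\<bar>\<phi> x\<bar> \<le> (\<Sum>i<n. 1 / real n * (cutoff x0 (R i) x * \<bar>f x - k i\<bar>))"
      unfolding \<phi>_def test_sum_def
      by (rule order_trans[OF sum_abs]) (simp add: abs_mult cutoff_bounds abs_minus_commute)
    then have "ennreal \<bar>\<phi> x\<bar> \<le> ennreal (\<Sum>i<n. 1 / real n * (cutoff x0 (R i) x * \<bar>f x - k i\<bar>))"
      by (rule ennreal_leI)
    also have "\<dots> = (\<Sum>i<n. ennreal (1 / real n * (cutoff x0 (R i) x * \<bar>f x - k i\<bar>)))"
      by (intro sum_ennreal[symmetric] mult_nonneg_nonneg cutoff_bounds) auto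
    also have "\<dots> \<le> (\<Sum>i<n. ennreal (1 / real n) * (ennreal (\<bar>f x - k i\<bar> + e i) * indicator (ball x0 (4 * R i)) x))"
    proof (rule sum_mono)
      fix i
      have "ennreal (cutoff x0 (R i) x * \<bar>f x - k i\<bar>) \<le> ennreal (\<bar>f x - k i\<bar> + e i) * indicator (ball x0 (4 * R i)) x"
      proof (cases "dist x0 x < 4 * R i")
        case True
        have "cutoff x0 (R i) x * \<bar>f x - k i\<bar> \<le> 1 * \<bar>f x - k i\<bar>"
          by (intro mult_right_mono cutoff_bounds) auto
        also have "\<dots> \<le> \<bar>f x - k i\<bar> + e i" using Re(2)[of i] by simp
        finally show ?thesis using True by (simp add: ennreal_leI)
      next
        case False
        then have "cutoff x0 (R i) x = 0" using Re(1)[of i] by (intro cutoff_eq_0) auto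
        then show ?thesis by simp
      qed
      then have "ennreal (1 / real n) * ennreal (cutoff x0 (R i) x * \<bar>f x - k i\<bar>)
          \<le> ennreal (1 / real n) * (ennreal (\<bar>f x - k i\<bar> + e i) * indicator (ball x0 (4 * R i)) x)"
        by (intro mult_left_mono) auto
      moreover have "ennreal (1 / real n) * ennreal (cutoff x0 (R i) x * \<bar>f x - k i\<bar>)
          = ennreal (1 / real n * (cutoff x0 (R i) x * \<bar>f x - k i\<bar>))"
        using cutoff_bounds(1)[of x0 "R i" x] by (intro ennreal_mult[symmetric]) auto
      ultimately show "ennreal (1 / real n * (cutoff x0 (R i) x * \<bar>f x - k i\<bar>))
          \<le> ennreal (1 / real n) * (ennreal (\<bar>f x - k i\<bar> + e i) * indicator (ball x0 (4 * R i)) x)" by simp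
    qed
    finally show "ennreal \<bar>\<phi> x\<bar> \<le> (\<Sum>i<n. ennreal (1 / real n) * (ennreal (\<bar>f x - k i\<bar> + e i) * indicator (ball x0 (4 * R i)) x))" .
  qed
  then have fin1: "(\<integral>\<^sup>+x. epowr (e2ennreal \<bar>ereal (\<phi> x)\<bar>) p \<partial>M) < \<infinity>"
    by (simp add: Lp_def)
  define G where "G x = ennreal 1 * g x + (g x + test_grad g f x0 R k e n x)" for x
  have ug: "upper_gradient_on UNIV (\<lambda>x. ereal (\<phi> x)) G"
    unfolding G_def \<phi>_def f_def by (rule upper_gradient_test_sum(2)[OF u Re n zero_less_one])
  have "Lp G" unfolding G_def using g T by (intro Lp_add Lp_cmult(1)) auto
  then have "energy G < \<infinity>" by (rule LpD(2))
  then have fin2: "(INF h \<in> {h. upper_gradient_on UNIV (\<lambda>x. ereal (\<phi> x)) h}. \<integral>\<^sup>+x. epowr (h x) p \<partial>M) < \<infinity>"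
    using ug by (intro le_less_trans[OF INF_lower[of G]]) auto
  have "(\<lambda>x. ereal (\<phi> x)) \<in> borel_measurable (restrict_space M UNIV)"
    using borel_imp_measurable[OF \<phi>_meas] by (intro measurable_restrict_space1) measurable
  then show "(\<lambda>x. ereal (test_sum f x0 R k n x)) \<in> N1p_on M p UNIV"
    using fin1 fin2 unfolding \<phi>_def[symmetric] N1p_on_def by simp
qed

text \<open>The weighted copies of \<open>g\<close> add up to at most one copy outside radius
  \<open>R0 / 2\<close>. The cutoff parts have disjoint supports; in each, the power of
  \<open>R i\<close> cancels and \<open>D * real n powr (- p)\<close> remains, and there are n of
  them.\<close>

lemma test_grad_energy:
  fixes R :: "nat \<Rightarrow> real"
  assumes g: "Lp g" and f: "f \<in> borel_measurable borel"
    and R: "\<And>i. R i = 8 ^ i * R0" "0 < R0" and n: "0 < n" and a: "0 < a" and D: "0 \<le> D"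
    and bound: "\<And>i. (\<integral>\<^sup>+x\<in>ball x0 (4 * R i). epowr (ennreal (\<bar>f x - k i\<bar> + e i)) p \<partial>M)
      \<le> ennreal (D * R i powr p)"
  shows "(\<integral>\<^sup>+x. epowr (ennreal a * g x + test_grad g f x0 R k e n x) p \<partial>M)
    \<le> ennreal (4 powr p) * (ennreal (a powr p) * energy g
        + (energy_on {x. R0 / 2 < dist x0 x} g + ennreal (D * real n powr (1 - p))))"
proof -
  define H where "H i x = ennreal (\<bar>f x - k i\<bar> + e i)" for i x
  define A where "A i = annulus x0 (R i)" for i
  define Z where "Z = {x. R0 / 2 < dist x0 x}"
  define s where "s i x = ennreal (1 / real n * (1 / R i)) * (H i x * indicator (A i) x)" for i x
  have Rpos: "0 < R i" for i using R by simp
  have R_ge: "R0 \<le> R i" for i using R by simp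
  note [measurable] = Lp_measurable[OF g] f
  have [measurable]: "Z \<in> sets M" "A i \<in> sets M" for i
    unfolding Z_def A_def by (intro borel_sets_M dist_sets annulus_sets)+
  have [measurable]: "H i \<in> borel_measurable M" for i
    unfolding H_def by (intro borel_imp_measurable) measurable
  have "test_grad g f x0 R k e n x \<le> g x * indicator Z x + (\<Sum>i<n. s i x)" for x
  proof -
    have "test_grad g f x0 R k e n x
        \<le> (\<Sum>i<n. ennreal (1 / real n) * (g x * indicator Z x) + s i x)"
      unfolding test_grad_def
    proof (rule sum_mono)
      fix i
      have gZ: "g x * indicator {x. R i / 2 < dist x0 x} x \<le> g x * indicator Z x"
        using R_ge[of i] by (intro mult_left_mono) (auto simp: indicator_def Z_def)
      have s_eq: "ennreal (1 / real n) * (ennreal (1 / R i) * (H i x * indicator (A i) x)) = s i x"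
        unfolding s_def using Rpos[of i] by (intro ennreal_mult_mult) auto
      show "ennreal (1 / real n) * cutoff_grad g f x0 (R i) (k i) (e i) x
          \<le> ennreal (1 / real n) * (g x * indicator Z x) + s i x"
        unfolding cutoff_grad_def H_def[symmetric] A_def[symmetric] distrib_left s_eq
        by (intro add_right_mono mult_left_mono gZ) simp
    qed
    also have "\<dots> = of_nat n * (ennreal (1 / real n) * (g x * indicator Z x)) + (\<Sum>i<n. s i x)"
      by (simp add: sum.distrib)
    also have "of_nat n * (ennreal (1 / real n) * (g x * indicator Z x)) = g x * indicator Z x"
      unfolding ennreal_of_nat_eq_real_of_nat using n by (subst ennreal_mult_mult) auto
    finally show ?thesis .
  qed
  then have le: "ennreal a * g x + test_grad g f x0 R k e n x
      \<le> ennreal a * g x + (g x * indicator Z x + (\<Sum>i<n. s i x))" for x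
    by (intro add_left_mono)
  have pow_le: "epowr (ennreal a * g x + test_grad g f x0 R k e n x) p
    \<le> ennreal (4 powr p) * (ennreal (a powr p) * epowr (g x) p
        + (epowr (g x) p * indicator Z x + (\<Sum>i<n. epowr (s i x) p)))" for x
  proof -
    have disj: "s i x = 0 \<or> s j x = 0" if "i \<noteq> j" for i j
    proof -
      have *: "A i \<inter> A j = {}" if "i < j" for i j
      proof -
        \<comment> \<open>For i < j the outer radius \<open>4 * R i\<close> of one annulus does not
          exceed the inner radius \<open>R j / 2\<close> of the other.\<close>
        have "8 * 8 ^ i \<le> (8 :: real) ^ j" using that power_increasing[of "Suc i" j "8 :: real"] by simp
        then have "8 * R i \<le> R j" using R by (simp add: mult.assoc[symmetric])
        then show ?thesis by (auto simp: A_def annulus_def)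
      qed
      have "A i \<inter> A j = {}"
        using *[of i j] *[of j i] that by (metis inf_commute linorder_neqE_nat)
      then show ?thesis by (auto simp: s_def indicator_def)
    qed
    have "epowr (ennreal a * g x + test_grad g f x0 R k e n x) p
        \<le> epowr (ennreal a * g x + (g x * indicator Z x + (\<Sum>i<n. s i x))) p"
      by (rule epowr_mono[OF le p_nonneg])
    also have "\<dots> \<le> ennreal (2 powr p) * (epowr (ennreal a * g x) p + epowr (g x * indicator Z x + (\<Sum>i<n. s i x)) p)"
      by (rule epowr_add_le[OF p_pos])
    also have "\<dots> \<le> ennreal (2 powr p) * (ennreal (2 powr p) * epowr (ennreal a * g x) p
        + ennreal (2 powr p) * (epowr (g x * indicator Z x) p + epowr (\<Sum>i<n. s i x) p))"
    proof (intro mult_left_mono add_mono epowr_add_le p_pos)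
      have "1 \<le> ennreal (2 powr p)" using p_pos by (simp add: ge_one_powr_ge_zero)
      from mult_right_mono[OF this, of "epowr (ennreal a * g x) p"]
      show "epowr (ennreal a * g x) p \<le> ennreal (2 powr p) * epowr (ennreal a * g x) p" by simp
    qed auto
    also have "\<dots> = ennreal (2 powr p) * ennreal (2 powr p) *
        (epowr (ennreal a * g x) p + (epowr (g x * indicator Z x) p + epowr (\<Sum>i<n. s i x) p))"
      by (simp only: distrib_left mult.assoc)
    also have "ennreal (2 powr p) * ennreal (2 powr p) = ennreal (4 powr p)"
      by (simp add: ennreal_mult[symmetric] powr_mult[symmetric])
    also have "epowr (ennreal a * g x) p = ennreal (a powr p) * epowr (g x) p"
      using a by (simp add: epowr_mult p_pos epowr_ennreal)
    also have "epowr (g x * indicator Z x) p = epowr (g x) p * indicator Z x"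
      by (simp add: indicator_def)
    also have "epowr (\<Sum>i<n. s i x) p = (\<Sum>i<n. epowr (s i x) p)"
      using disj by (intro epowr_sum_single p_pos) auto
    finally show ?thesis .
  qed
  have s_int: "energy (s i) \<le> ennreal (D * real n powr (- p))" for i
  proof -
    have "energy (s i)
        \<le> (\<integral>\<^sup>+x. ennreal ((1 / real n * (1 / R i)) powr p) * (epowr (H i x) p * indicator (ball x0 (4 * R i)) x) \<partial>M)"
    proof (rule nn_integral_mono)
      fix x
      have "epowr (s i x) p = ennreal ((1 / real n * (1 / R i)) powr p) * epowr (H i x * indicator (A i) x) p"
        unfolding s_def using Rpos[of i] n by (simp only: epowr_mult[OF p_pos]) (simp add: epowr_ennreal)
      also have "\<dots> \<le> ennreal ((1 / real n * (1 / R i)) powr p) * (epowr (H i x) p * indicator (ball x0 (4 * R i)) x)"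
        by (intro mult_left_mono) (auto simp: indicator_def A_def annulus_def)
      finally show "epowr (s i x) p \<le> ennreal ((1 / real n * (1 / R i)) powr p) * (epowr (H i x) p * indicator (ball x0 (4 * R i)) x)" .
    qed
    also have "\<dots> = ennreal ((1 / real n * (1 / R i)) powr p) * energy_on (ball x0 (4 * R i)) (H i)"
      by (rule nn_integral_cmult) measurable
    also have "\<dots> \<le> ennreal ((1 / real n * (1 / R i)) powr p) * ennreal (D * R i powr p)"
      using bound[of i] unfolding H_def by (intro mult_left_mono) auto
    also have "\<dots> = ennreal ((1 / real n * (1 / R i)) powr p * (D * R i powr p))"
      using D by (intro ennreal_mult[symmetric]) auto
    also have "(1 / real n * (1 / R i)) powr p * (D * R i powr p) = D * real n powr (- p)"
      using Rpos[of i] n by (simp add: powr_mult powr_divide powr_minus field_simps)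
    finally show ?thesis .
  qed
  have [measurable]: "s i \<in> borel_measurable M" for i unfolding s_def by measurable
  have "(\<integral>\<^sup>+x. epowr (ennreal a * g x + test_grad g f x0 R k e n x) p \<partial>M)
    \<le> (\<integral>\<^sup>+x. ennreal (4 powr p) * (ennreal (a powr p) * epowr (g x) p
        + (epowr (g x) p * indicator Z x + (\<Sum>i<n. epowr (s i x) p))) \<partial>M)"
    by (rule nn_integral_mono) (rule pow_le)
  also have "\<dots> = ennreal (4 powr p) * (ennreal (a powr p) * energy g
        + (energy_on Z g + (\<Sum>i<n. \<integral>\<^sup>+x. epowr (s i x) p \<partial>M)))"
    by (simp add: nn_integral_cmult nn_integral_add nn_integral_sum)
  also have "\<dots> \<le> ennreal (4 powr p) * (ennreal (a powr p) * energy g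
        + (energy_on Z g + (\<Sum>i<n. ennreal (D * real n powr (- p)))))"
    by (intro mult_left_mono add_left_mono sum_mono s_int) auto
  also have "(\<Sum>i<n. ennreal (D * real n powr (- p))) = ennreal (D * real n powr (1 - p))"
  proof -
    have "(\<Sum>i<n. ennreal (D * real n powr (- p))) = ennreal (real n * (D * real n powr (- p)))"
      using D by (simp add: ennreal_of_nat_eq_real_of_nat ennreal_mult)
    also have "real n * (D * real n powr (- p)) = D * (real n powr 1 * real n powr (- p))" using n by simp
    also have "\<dots> = D * real n powr (1 - p)" by (simp only: powr_add[symmetric]) simp
    finally show ?thesis .
  qed
  finally show ?thesis by (simp add: Z_def)
qed

section \<open>Quasiminimizers of finite energy\<close>

text \<open>Continuity into the extended reals permits infinite values; local p-integrability
  confines them to a null set.\<close>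

lemma N1p_loc_AE_finite:
  assumes u: "continuous_on UNIV u" "u \<in> N1p_loc M p"
  shows "AE x in M. \<bar>u x\<bar> \<noteq> \<infinity>"
proof -
  have um: "u \<in> borel_measurable M"
    using u(1) by (intro borel_imp_measurable borel_measurable_continuous_onI)
  define P where "P A \<longleftrightarrow> (AE y in M. y \<in> A \<longrightarrow> \<bar>u y\<bar> \<noteq> \<infinity>)" for A
  have "\<exists>r>0. P (ball x r)" for x
  proof -
    obtain r where r: "0 < r" "u \<in> N1p_on M p (ball x r)"
      using u(2) by (auto simp: N1p_loc_def)
    have "(\<integral>\<^sup>+y\<in>ball x r. epowr (e2ennreal \<bar>u y\<bar>) p \<partial>M) < \<infinity>"
      using r(2) by (auto simp: N1p_on_def)
    moreover have "(\<lambda>y. epowr (e2ennreal \<bar>u y\<bar>) p * indicator (ball x r) y) \<in> borel_measurable M"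
      using um by measurable
    ultimately have "AE y in M. epowr (e2ennreal \<bar>u y\<bar>) p * indicator (ball x r) y \<noteq> \<infinity>"
      by (intro nn_integral_noteq_infinite) auto
    then have "P (ball x r)"
      unfolding P_def by eventually_elim auto
    with r(1) show ?thesis by blast
  qed
  moreover have "P A" if "A \<subseteq> B" "P B" for A B
    using that(2) unfolding P_def
  proof eventually_elim
    case (elim y)
    then show ?case using subsetD[OF that(1), of y] by simp
  qed
  ultimately have "\<exists>B :: nat \<Rightarrow> 'a set. (\<forall>n. open (B n) \<and> P (B n)) \<and> (\<Union>n. B n) = UNIV"
    by (rule countable_ball_cover)
  then obtain B :: "nat \<Rightarrow> 'a set" where B: "\<forall>n. open (B n) \<and> P (B n)" "(\<Union>n. B n) = UNIV"
    by (elim exE conjE)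
  have "AE y in M. \<forall>n. y \<in> B n \<longrightarrow> \<bar>u y\<bar> \<noteq> \<infinity>"
    using B(1) unfolding AE_all_countable P_def by (intro allI) simp
  then show ?thesis
  proof eventually_elim
    case (elim x)
    have "x \<in> (\<Union>n. B n)" using B(2) by simp
    then obtain n where "x \<in> B n" by (elim UN_E)
    with elim show ?case by auto
  qed
qed

text \<open>On \<open>ball x0 R0\<close> all cutoffs are 1, so the test function there is the mean
  of the constants minus \<open>u\<close>. The level set of \<open>u\<close> at that mean has to be
  left out, since the quasiminimizing inequality does not see it.\<close>

lemma quasiminimizer_test:
  fixes u :: "'a \<Rightarrow> ereal" and k :: "nat \<Rightarrow> real"
  assumes u: "continuous_on UNIV u" "upper_gradient_on UNIV u g" and g: "Lp g"
    and quasi: "\<forall>\<phi>\<in>N1p_on M p UNIV.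
          energy_on {x. \<phi> x \<noteq> 0} (min_wug M p u)
            \<le> ennreal Q * energy_on {x. \<phi> x \<noteq> 0} (min_wug M p (\<lambda>y. u y + \<phi> y))"
    and R: "\<And>i. R i = 8 ^ i * R0" "0 < R0" and e: "\<And>i. 0 < e i"
    and n: "0 < n" and a: "0 < a" and D: "0 \<le> D"
    and bound: "\<And>i. (\<integral>\<^sup>+x\<in>ball x0 (4 * R i). epowr (ennreal (\<bar>real_of_ereal (u x) - k i\<bar> + e i)) p \<partial>M)
      \<le> ennreal (D * R i powr p)"
  shows "energy_on {x \<in> ball x0 R0. real_of_ereal (u x) \<noteq> (\<Sum>i<n. k i) / real n} (min_wug M p u)
    \<le> ennreal Q * (ennreal (4 powr p) * (ennreal (a powr p) * energy g
        + (energy_on {x. R0 / 2 < dist x0 x} g + ennreal (D * real n powr (1 - p)))))"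
proof -
  define f where "f x = real_of_ereal (u x)" for x
  define \<phi> where "\<phi> x = ereal (test_sum f x0 R k n x)" for x
  define G where "G x = ennreal a * g x + test_grad g f x0 R k e n x" for x
  have f: "f \<in> borel_measurable borel"
    using u(1) by (simp add: f_def[abs_def] continuous_real_of_ereal_measurable)
  have Rpos: "0 < R i" for i using R by simp
  have bound': "(\<integral>\<^sup>+x\<in>ball x0 (4 * R i). epowr (ennreal (\<bar>f x - k i\<bar> + e i)) p \<partial>M)
      \<le> ennreal (D * R i powr p)" for i
    using bound[of i] by (simp add: f_def)
  have fin: "(\<integral>\<^sup>+x\<in>ball x0 (4 * R i). epowr (ennreal (\<bar>real_of_ereal (u x) - k i\<bar> + e i)) p \<partial>M) < \<infinity>" for i
    by (rule le_less_trans[OF bound[of i]]) simp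
  have \<phi>: "\<phi> \<in> N1p_on M p UNIV" and T: "Lp (test_grad g f x0 R k e n)"
    using test_sum_N1p[OF u g Rpos e n fin] by (simp_all add: \<phi>_def[abs_def] f_def[abs_def])
  have ug: "upper_gradient_on UNIV (\<lambda>x. u x + \<phi> x) G"
    using upper_gradient_test_sum(1)[OF u Rpos e n a] by (simp add: \<phi>_def G_def[abs_def] f_def[abs_def])
  have G: "Lp G" unfolding G_def using g T by (intro Lp_add Lp_cmult(1)) auto
  have wugG: "wug (\<lambda>x. u x + \<phi> x) G" by (rule upper_gradient_imp_wug[OF ug])
  have "AE x in M. min_wug M p (\<lambda>x. u x + \<phi> x) x \<le> G x"
    using min_wug_minimal[OF wugG G] wug_imp_weak_upper_gradient[OF wugG] Lp_imp_Lp_loc[OF G]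
    by (simp add: is_minimal_weak_upper_gradient_def)
  then have "energy_on {x. \<phi> x \<noteq> 0} (min_wug M p (\<lambda>y. u y + \<phi> y)) \<le> energy G"
    by (intro nn_integral_mono_AE, elim eventually_mono)
       (auto simp: indicator_def intro: epowr_mono p_nonneg)
  also have "\<dots> \<le> ennreal (4 powr p) * (ennreal (a powr p) * energy g
        + (energy_on {x. R0 / 2 < dist x0 x} g + ennreal (D * real n powr (1 - p))))"
    unfolding G_def by (rule test_grad_energy[OF g f R n a D bound'])
  finally have energy: "energy_on {x. \<phi> x \<noteq> 0} (min_wug M p (\<lambda>y. u y + \<phi> y)) \<le> \<dots>" .
  have \<phi>_eq: "test_sum f x0 R k n x = (\<Sum>i<n. k i) / real n - f x" if "x \<in> ball x0 R0" for x
  proof -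
    have "cutoff x0 (R i) x = 1" for i
    proof (rule cutoff_eq_1[OF Rpos])
      have "R0 \<le> R i" using R by simp
      then show "dist x0 x \<le> R i" using that by simp
    qed
    then have "test_sum f x0 R k n x = (\<Sum>i<n. k i / real n - f x / real n)"
      by (simp add: test_sum_def diff_divide_distrib)
    also have "\<dots> = (\<Sum>i<n. k i) / real n - f x"
      using n by (simp add: sum_subtractf sum_divide_distrib)
    finally show ?thesis .
  qed
  have "energy_on {x \<in> ball x0 R0. f x \<noteq> (\<Sum>i<n. k i) / real n} (min_wug M p u)
      \<le> energy_on {x. \<phi> x \<noteq> 0} (min_wug M p u)"
    using \<phi>_eq by (intro nn_integral_mono mult_left_mono) (auto simp: indicator_def \<phi>_def)
  also have "\<dots> \<le> ennreal Q * energy_on {x. \<phi> x \<noteq> 0} (min_wug M p (\<lambda>y. u y + \<phi> y))"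
    using quasi \<phi> by blast
  also have "\<dots> \<le> ennreal Q * (ennreal (4 powr p) * (ennreal (a powr p) * energy g
        + (energy_on {x. R0 / 2 < dist x0 x} g + ennreal (D * real n powr (1 - p)))))"
    by (intro mult_left_mono energy) auto
  finally show ?thesis by (simp add: f_def)
qed

lemma tail_energy_small:
  assumes g: "Lp g" and "0 < \<epsilon>" "0 < r"
  shows "\<exists>R0\<ge>r. energy_on {x. R0 / 2 < dist x0 x} g \<le> ennreal \<epsilon>"
proof -
  define h where "h m x = epowr (g x) p * indicator {x. real m / 2 < dist x0 x} x" for m :: nat and x
  note [measurable] = Lp_measurable[OF g]
  have [measurable]: "{x. b < dist x0 x} \<in> sets M" for b by (intro borel_sets_M dist_sets)
  have "(\<integral>\<^sup>+x. (INF m. h m x) \<partial>M) = (INF m. integral\<^sup>N M (h m))"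
  proof (rule nn_integral_monotone_convergence_INF_decseq[where i = 0])
    show "decseq h"
      by (rule decseq_SucI) (auto simp: h_def le_fun_def indicator_def)
    show "h m \<in> borel_measurable M" for m unfolding h_def by measurable
    have "(\<integral>\<^sup>+x. h 0 x \<partial>M) \<le> energy g"
      by (intro nn_integral_mono) (auto simp: h_def indicator_def)
    then show "(\<integral>\<^sup>+x. h 0 x \<partial>M) < \<infinity>" using LpD(2)[OF g] by order
  qed
  moreover have "(INF m. h m x) = 0" for x
  proof -
    obtain m where "2 * dist x0 x < real m" using reals_Archimedean2 by blast
    then have "h m x = 0" by (simp add: h_def)
    then show ?thesis by (metis INF_lower UNIV_I le_zero_eq)
  qed
  ultimately have "(INF m. integral\<^sup>N M (h m)) < ennreal \<epsilon>" using assms(2) by simp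
  then obtain m where m: "integral\<^sup>N M (h m) < ennreal \<epsilon>" by (auto simp: INF_less_iff)
  have "energy_on {x. max (real m) r / 2 < dist x0 x} g \<le> integral\<^sup>N M (h m)"
    unfolding h_def by (intro nn_integral_mono mult_left_mono) (auto simp: indicator_def)
  with m show ?thesis by (intro exI[of _ "max (real m) r"]) (auto intro: order_trans less_imp_le)
qed

end

section \<open>Vanishing energy and constancy\<close>

context poincare_space begin

text \<open>Three independent parameters make the bound small: \<open>R0\<close> the tail energy of
  \<open>g\<close>, \<open>a\<close> the term for curves of infinite integral, and \<open>n\<close>
  the cutoff part. They can be chosen independently because \<open>D\<close> depends only on the
  total energy and the structural constants.\<close>

lemma quasiminimizer_energy_zero:
  fixes u :: "'a \<Rightarrow> ereal"
  assumes u: "continuous_on UNIV u" "upper_gradient_on UNIV u g" and g: "Lp g"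
    and fin: "AE x in M. \<bar>u x\<bar> \<noteq> \<infinity>" and Q: "1 \<le> Q"
    and quasi: "\<forall>\<phi>\<in>N1p_on M p UNIV.
          energy_on {x. \<phi> x \<noteq> 0} (min_wug M p u)
            \<le> ennreal Q * energy_on {x. \<phi> x \<noteq> 0} (min_wug M p (\<lambda>y. u y + \<phi> y))"
    and r: "0 < r"
  shows "energy_on (ball x0 r) (min_wug M p u) = 0"
proof -
  define f where "f x = real_of_ereal (u x)" for x
  define E where "E = enn2real (energy g)"
  define B where "B = 2 powr p * 2 * (4 * C\<^sup>2 * K) powr p * (1 + 2 * C)"
  define D where "D = 2 powr p * (B * 4 powr p * E + 1)"
  have E: "energy g = ennreal E" "0 \<le> E"
    using LpD(2)[OF g] by (simp_all add: E_def)
  have B: "0 \<le> B" using C_pos by (simp add: B_def)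
  have D: "0 \<le> D" using B E by (simp add: D_def)
  have um: "u \<in> borel_measurable M"
    using u(1) by (intro borel_imp_measurable borel_measurable_continuous_onI)
  have f_meas [measurable]: "f \<in> borel_measurable M"
    unfolding f_def using um by measurable
  have gu_meas [measurable]: "min_wug M p u \<in> borel_measurable M"
    using min_wug_minimal[OF upper_gradient_imp_wug[OF u(2)] g]
    by (simp add: is_minimal_weak_upper_gradient_def weak_upper_gradient_def)
  have scale: "\<exists>k d. 0 < d \<and> (\<integral>\<^sup>+x\<in>ball x0 (4 * R). epowr (ennreal (\<bar>f x - k\<bar> + 2 * d)) p \<partial>M)
      \<le> ennreal (D * R powr p)" if R: "0 < R" for R
  proof -
    obtain k where k: "(\<integral>\<^sup>+x\<in>ball x0 (4 * R). epowr (ennreal \<bar>f x - k\<bar>) p \<partial>M)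
        \<le> ennreal (B * (4 * R) powr p) * ennreal E"
      using Lp_poincare[OF u g fin, of "4 * R" x0] R unfolding f_def B_def E(1) by auto
    define \<mu> where "\<mu> = measure M (ball x0 (4 * R))"
    have \<mu>: "0 < \<mu>" using R measure_ball_pos by (simp add: \<mu>_def)
    \<comment> \<open>Normalized so that the slack \<open>2 * d\<close> contributes exactly
      \<open>R powr p\<close> to the integral, which is the \<open>+ 1\<close> in \<open>D\<close>.
      One test function uses only \<open>d\<close> of it; the rest leaves room for shifting the
      constant by \<open>d\<close>.\<close>
    define d where "d = R / (2 * \<mu> powr (1 / p))"
    have d: "0 < d" using R \<mu> by (simp add: d_def)
    have d_pow: "(2 * d) powr p * \<mu> = R powr p"
    proof -
      have "2 * d = R / \<mu> powr (1 / p)" by (simp add: d_def)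
      then have "(2 * d) powr p = R powr p / \<mu>"
        using R \<mu> p_neq_0 by (simp add: powr_divide powr_powr)
      then show ?thesis using \<mu> by simp
    qed
    have "(\<integral>\<^sup>+x\<in>ball x0 (4 * R). epowr (ennreal (\<bar>f x - k\<bar> + 2 * d)) p \<partial>M)
        \<le> (\<integral>\<^sup>+x. ennreal (2 powr p) * (epowr (ennreal \<bar>f x - k\<bar>) p * indicator (ball x0 (4 * R)) x
            + ennreal ((2 * d) powr p) * indicator (ball x0 (4 * R)) x) \<partial>M)"
    proof (rule nn_integral_mono)
      fix x
      have "epowr (ennreal (\<bar>f x - k\<bar> + 2 * d)) p = epowr (ennreal \<bar>f x - k\<bar> + ennreal (2 * d)) p"
        using d by (subst ennreal_plus) auto
      also have "\<dots> \<le> ennreal (2 powr p) * (epowr (ennreal \<bar>f x - k\<bar>) p + epowr (ennreal (2 * d)) p)"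
        by (rule epowr_add_le[OF p_pos])
      also have "epowr (ennreal (2 * d)) p = ennreal ((2 * d) powr p)"
        using d by (intro epowr_ennreal) simp
      finally show "epowr (ennreal (\<bar>f x - k\<bar> + 2 * d)) p * indicator (ball x0 (4 * R)) x
          \<le> ennreal (2 powr p) * (epowr (ennreal \<bar>f x - k\<bar>) p * indicator (ball x0 (4 * R)) x
            + ennreal ((2 * d) powr p) * indicator (ball x0 (4 * R)) x)"
        by (auto simp: indicator_def)
    qed
    also have "\<dots> = ennreal (2 powr p) * ((\<integral>\<^sup>+x\<in>ball x0 (4 * R). epowr (ennreal \<bar>f x - k\<bar>) p \<partial>M)
        + ennreal ((2 * d) powr p) * emeasure M (ball x0 (4 * R)))"
      by (simp add: nn_integral_cmult nn_integral_add nn_integral_cmult_indicator)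
    also have "\<dots> \<le> ennreal (2 powr p) * (ennreal (B * (4 * R) powr p) * ennreal E
        + ennreal ((2 * d) powr p) * emeasure M (ball x0 (4 * R)))"
      by (intro mult_left_mono add_right_mono k) auto
    also have "ennreal ((2 * d) powr p) * emeasure M (ball x0 (4 * R)) = ennreal (R powr p)"
      unfolding emeasure_ball \<mu>_def[symmetric] d_pow[symmetric] using \<mu> by (intro ennreal_mult[symmetric]) auto
    also have "ennreal (B * (4 * R) powr p) * ennreal E = ennreal (B * (4 * R) powr p * E)"
      using B E by (intro ennreal_mult[symmetric]) auto
    also have "ennreal (B * (4 * R) powr p * E) + ennreal (R powr p) = ennreal (B * (4 * R) powr p * E + R powr p)"
      using B E by (intro ennreal_plus[symmetric]) auto
    also have "ennreal (2 powr p) * \<dots> = ennreal (2 powr p * (B * (4 * R) powr p * E + R powr p))"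
      using B E by (intro ennreal_mult[symmetric]) auto
    also have "2 powr p * (B * (4 * R) powr p * E + R powr p) = D * R powr p"
      using R by (simp add: D_def powr_mult algebra_simps)
    finally show ?thesis using d by blast
  qed
  have main: "energy_on (ball x0 r) (min_wug M p u)
      \<le> ennreal (2 * Q * 4 powr p) * (ennreal (a powr p) * ennreal E
        + (energy_on {x. R0 / 2 < dist x0 x} g + ennreal (D * real n powr (1 - p))))"
    if R0: "r \<le> R0" and a: "0 < a" and n: "0 < n" for R0 a n
  proof -
    have R0_pos: "0 < R0" using r R0 by simp
    define R where "R i = 8 ^ i * R0" for i :: nat
    define S where "S i k d \<longleftrightarrow> 0 < d \<and> (\<integral>\<^sup>+x\<in>ball x0 (4 * R i). epowr (ennreal (\<bar>f x - k\<bar> + 2 * d)) p \<partial>M)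
      \<le> ennreal (D * R i powr p)" for i k d
    have "\<forall>i. \<exists>k d. S i k d"
      unfolding S_def using R0_pos by (intro allI scale) (simp add: R_def)
    then obtain k d where "\<forall>i. S i (k i) (d i)" by metis
    then have kd: "\<And>i. 0 < d i"
      "\<And>i. (\<integral>\<^sup>+x\<in>ball x0 (4 * R i). epowr (ennreal (\<bar>f x - k i\<bar> + 2 * d i)) p \<partial>M) \<le> ennreal (D * R i powr p)"
      by (simp_all add: S_def)
    define T where "T = ennreal (4 powr p) * (ennreal (a powr p) * energy g
        + (energy_on {x. R0 / 2 < dist x0 x} g + ennreal (D * real n powr (1 - p))))"
    have half: "energy_on {x \<in> ball x0 R0. f x \<noteq> (\<Sum>i<n. k' i) / real n} (min_wug M p u) \<le> ennreal Q * T"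
      if k': "\<And>i x. \<bar>f x - k' i\<bar> + d i \<le> \<bar>f x - k i\<bar> + 2 * d i" for k'
      unfolding T_def f_def
    proof (rule quasiminimizer_test[OF u g quasi R_def R0_pos kd(1) n a D])
      fix i
      have "(\<integral>\<^sup>+x\<in>ball x0 (4 * R i). epowr (ennreal (\<bar>real_of_ereal (u x) - k' i\<bar> + d i)) p \<partial>M)
          \<le> (\<integral>\<^sup>+x\<in>ball x0 (4 * R i). epowr (ennreal (\<bar>f x - k i\<bar> + 2 * d i)) p \<partial>M)"
        using k' by (intro nn_integral_mono mult_right_mono epowr_mono p_nonneg ennreal_leI) (auto simp: f_def)
      then show "(\<integral>\<^sup>+x\<in>ball x0 (4 * R i). epowr (ennreal (\<bar>real_of_ereal (u x) - k' i\<bar> + d i)) p \<partial>M)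
          \<le> ennreal (D * R i powr p)" using kd(2)[of i] by order
    qed
    \<comment> \<open>The test function vanishes on the ball exactly where \<open>f\<close> equals the mean of the constants; perturbing
      the constants changes that value, so two test functions cover the ball.\<close>
    define b1 where "b1 = (\<Sum>i<n. k i) / real n"
    define b2 where "b2 = (\<Sum>i<n. k i + d i) / real n"
    have "0 < (\<Sum>i<n. d i)" using kd(1) n by (intro sum_pos) auto
    then have "b1 \<noteq> b2" using n by (simp add: b1_def b2_def sum.distrib add_divide_distrib)
    have set_meas [measurable]: "{x \<in> ball x0 R0. f x \<noteq> b} \<in> sets M" for b
    proof -
      have "{x \<in> ball x0 R0. f x \<noteq> b} = {x \<in> space M. x \<in> ball x0 R0 \<and> f x \<noteq> b}" by simp
      also have "\<dots> \<in> sets M" by measurable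
      finally show ?thesis .
    qed
    have "energy_on (ball x0 r) (min_wug M p u)
        \<le> (\<integral>\<^sup>+x. (epowr (min_wug M p u x) p * indicator {x \<in> ball x0 R0. f x \<noteq> b1} x
            + epowr (min_wug M p u x) p * indicator {x \<in> ball x0 R0. f x \<noteq> b2} x) \<partial>M)"
      using \<open>b1 \<noteq> b2\<close> R0 by (intro nn_integral_mono) (auto simp: indicator_def)
    also have "\<dots> = energy_on {x \<in> ball x0 R0. f x \<noteq> b1} (min_wug M p u)
        + energy_on {x \<in> ball x0 R0. f x \<noteq> b2} (min_wug M p u)"
      by (intro nn_integral_add) measurable
    also have "\<dots> \<le> ennreal Q * T + ennreal Q * T"
    proof (rule add_mono)
      show "energy_on {x \<in> ball x0 R0. f x \<noteq> b1} (min_wug M p u) \<le> ennreal Q * T"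
        unfolding b1_def using kd(1) by (intro half) (simp add: less_imp_le)
      have "\<bar>f x - (k i + d i)\<bar> + d i \<le> \<bar>f x - k i\<bar> + 2 * d i" for i x
        using kd(1)[of i] by linarith
      then show "energy_on {x \<in> ball x0 R0. f x \<noteq> b2} (min_wug M p u) \<le> ennreal Q * T"
        unfolding b2_def by (rule half)
    qed
    also have "\<dots> = ennreal 2 * (ennreal Q * T)" by (simp add: mult_2)
    also have "\<dots> = ennreal (2 * Q) * T" using Q by (intro ennreal_mult_mult) auto
    finally show ?thesis
      unfolding T_def E(1) using Q by (subst (asm) ennreal_mult_mult) auto
  qed
  define c where "c = 2 * Q * 4 powr p"
  have c: "0 < c" using Q by (simp add: c_def)
  have "energy_on (ball x0 r) (min_wug M p u) \<le> 0"
  proof (rule ennreal_le_epsilon)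
    fix \<epsilon> :: real assume \<epsilon>: "0 < \<epsilon>"
    define \<delta> where "\<delta> = \<epsilon> / (3 * c)"
    have \<delta>: "0 < \<delta>" using \<epsilon> c by (simp add: \<delta>_def)
    obtain R0 where R0: "r \<le> R0" "energy_on {x. R0 / 2 < dist x0 x} g \<le> ennreal \<delta>"
      using tail_energy_small[OF g \<delta> r] by blast
    define a where "a = (\<delta> / (E + 1)) powr (1 / p)"
    have a: "0 < a" using \<delta> E by (simp add: a_def)
    have "a powr p = \<delta> / (E + 1)" using \<delta> E p_neq_0 by (simp add: a_def powr_powr)
    then have aE: "a powr p * E \<le> \<delta>" using divide_add_one_mult_le[of \<delta> E] \<delta> E by simp
    have "(\<lambda>n. D * real n powr (1 - p)) \<longlonglongrightarrow> D * 0"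
      using p_gt_1 by (intro tendsto_intros tendsto_neg_powr filterlim_real_sequentially) auto
    then have "eventually (\<lambda>n. D * real n powr (1 - p) < \<delta>) sequentially"
      using \<delta> by (intro order_tendstoD) auto
    then obtain N where N: "\<And>n. N \<le> n \<Longrightarrow> D * real n powr (1 - p) < \<delta>"
      by (auto simp: eventually_sequentially)
    define n where "n = Suc N"
    have n: "0 < n" "D * real n powr (1 - p) < \<delta>" using N[of n] by (auto simp: n_def)
    have "energy_on (ball x0 r) (min_wug M p u)
      \<le> ennreal c * (ennreal (a powr p) * ennreal E
        + (energy_on {x. R0 / 2 < dist x0 x} g + ennreal (D * real n powr (1 - p))))"
      unfolding c_def by (rule main[OF R0(1) a n(1)])
    also have "\<dots> \<le> ennreal c * (ennreal \<delta> + (ennreal \<delta> + ennreal \<delta>))"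
    proof (intro mult_left_mono add_mono R0(2))
      show "ennreal (a powr p) * ennreal E \<le> ennreal \<delta>"
        using aE E by (simp add: ennreal_mult[symmetric] ennreal_leI)
      show "ennreal (D * real n powr (1 - p)) \<le> ennreal \<delta>" using n(2) by (intro ennreal_leI) simp
    qed auto
    also have "ennreal \<delta> + (ennreal \<delta> + ennreal \<delta>) = ennreal (3 * \<delta>)"
      using \<delta> by (simp flip: ennreal_plus)
    also have "ennreal c * ennreal (3 * \<delta>) = ennreal (c * (3 * \<delta>))"
      using c \<delta> by (intro ennreal_mult[symmetric]) auto
    also have "c * (3 * \<delta>) = \<epsilon>" using c by (simp add: \<delta>_def)
    finally show "energy_on (ball x0 r) (min_wug M p u) \<le> 0 + ennreal \<epsilon>" by simp
  qed
  then show ?thesis by simp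
qed

text \<open>A weak upper gradient that vanishes almost everywhere becomes an upper gradient after
  adding \<epsilon> \<rho>, where \<rho> has infinite integral on the exceptional curves. The
  right-hand side of the Poincare inequality is then \<epsilon> times a fixed finite number, so
  every truncation of \<open>u\<close> equals its mean almost everywhere on the ball.\<close>

lemma constant_if_zero_gradient:
  fixes u :: "'a \<Rightarrow> ereal"
  assumes u: "continuous_on UNIV u" and h: "wug u h" "AE x in M. h x = 0"
  shows "u x = u y"
proof -
  have h_meas: "h \<in> borel_measurable borel" using h(1) by (simp add: wug_def)
  obtain \<rho> where \<rho>: "Lp \<rho>" "\<And>c. c \<in> curves_in UNIV \<Longrightarrow> curve_integral c \<rho> < \<infinity> \<Longrightarrow> ug_along u h c"
    using h(1) unfolding wug_def ae_curve_def by blast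
  note \<rho>_meas = LpD(1)[OF \<rho>(1)]
  have ug: "upper_gradient_on UNIV u (\<lambda>z. ennreal \<epsilon> * \<rho> z + h z)" if "0 < \<epsilon>" for \<epsilon>
    using that \<rho>(2) by (intro upper_gradient_onI_finite \<rho>_meas h_meas ug_along_imp_ug_ineq[where A = UNIV])
      (auto simp: curve_integral_eq)
  have const: "w x = w y" if b: "0 \<le> b" and w: "continuous_on UNIV w" "\<And>x. \<bar>w x\<bar> \<le> b"
    "\<And>x. ereal (w x) = max (- ereal b) (min (ereal b) (u x))" for w b
  proof -
    \<comment> \<open>Chosen so that the ball around \<open>x\<close> contains
      \<open>y\<close>.\<close>
    define r where "r = dist x y + 1"
    have r: "0 < r" by (simp add: r_def add_nonneg_pos)
    have Lr: "0 < L * r" using L_ge_1 r by simp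
    define X where "X = (\<integral>\<^sup>+z\<in>ball x r. ennreal \<bar>w z - avg w x r\<bar> \<partial>M) / emeasure M (ball x r)"
    define q where "q = avg_pow \<rho> x (L * r)"
    have "energy_on (ball x (L * r)) \<rho> \<le> energy \<rho>"
      by (intro nn_integral_mono) (auto simp: indicator_def)
    then have "energy_on (ball x (L * r)) \<rho> < \<infinity>" using LpD(2)[OF \<rho>(1)] by order
    then have "q \<noteq> top"
      unfolding q_def avg_pow_def using ball_neq_0[OF Lr, of x]
      by (auto simp: ennreal_divide_eq_top_iff)
    then have "q < \<infinity>" by (simp add: less_top)
    then have "ennreal (K * r) * epowr q (1 / p) < \<infinity>"
      by (simp add: ennreal_mult_less_top epowr_less_top_iff)
    then obtain Y where Y: "0 \<le> Y" "ennreal (K * r) * epowr q (1 / p) = ennreal Y"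
      by (cases "ennreal (K * r) * epowr q (1 / p)") auto
    have X_le: "X \<le> ennreal \<epsilon> * ennreal Y" if \<epsilon>: "0 < \<epsilon>" for \<epsilon>
    proof -
      have "upper_gradient_on UNIV (\<lambda>z. ereal (w z)) (\<lambda>z. ennreal \<epsilon> * \<rho> z + h z)"
        unfolding w(3) by (rule upper_gradient_truncate[OF ug[OF \<epsilon>]])
      from poincare_bounded[OF w(1,2) this r]
      have "X \<le> ennreal (K * r) * epowr (avg_pow (\<lambda>z. ennreal \<epsilon> * \<rho> z + h z) x (L * r)) (1 / p)"
        by (simp add: X_def)
      also have "avg_pow (\<lambda>z. ennreal \<epsilon> * \<rho> z + h z) x (L * r) = epowr (ennreal \<epsilon>) p * q"
      proof -
        have "(\<integral>\<^sup>+z\<in>ball x (L * r). epowr (ennreal \<epsilon> * \<rho> z + h z) p \<partial>M)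
            = (\<integral>\<^sup>+z. epowr (ennreal \<epsilon>) p * (epowr (\<rho> z) p * indicator (ball x (L * r)) z) \<partial>M)"
        proof (rule nn_integral_cong_AE)
          show "AE z in M. epowr (ennreal \<epsilon> * \<rho> z + h z) p * indicator (ball x (L * r)) z
            = epowr (ennreal \<epsilon>) p * (epowr (\<rho> z) p * indicator (ball x (L * r)) z)"
            using h(2) by eventually_elim (simp add: epowr_mult[OF p_pos] mult.assoc)
        qed
        also have "\<dots> = epowr (ennreal \<epsilon>) p * energy_on (ball x (L * r)) \<rho>"
          using Lp_measurable[OF \<rho>(1)]
          by (intro nn_integral_cmult borel_measurable_times_ennreal borel_measurable_indicator ball_sets)
        finally show ?thesis by (simp add: avg_pow_def q_def ennreal_times_divide)
      qed
      also have "epowr (epowr (ennreal \<epsilon>) p * q) (1 / p) = ennreal \<epsilon> * epowr q (1 / p)"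
        using p_pos by (simp add: epowr_mult)
      also have "ennreal (K * r) * (ennreal \<epsilon> * epowr q (1 / p)) = ennreal \<epsilon> * ennreal Y"
        unfolding Y(2)[symmetric] by (simp only: mult.left_commute)
      finally show ?thesis .
    qed
    have "X \<le> 0"
    proof (rule ennreal_le_epsilon)
      fix \<epsilon> :: real assume \<epsilon>: "0 < \<epsilon>"
      have "0 < \<epsilon> / (Y + 1)" using \<epsilon> Y by simp
      from X_le[OF this] have "X \<le> ennreal (\<epsilon> / (Y + 1) * Y)"
        using \<epsilon> Y(1) by (subst ennreal_mult) auto
      also have "\<dots> \<le> ennreal \<epsilon>" using divide_add_one_mult_le[of \<epsilon> Y] \<epsilon> Y(1) by (intro ennreal_leI) auto
      finally show "X \<le> 0 + ennreal \<epsilon>" by simp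
    qed
    then have "(\<integral>\<^sup>+z\<in>ball x r. ennreal \<bar>w z - avg w x r\<bar> \<partial>M) = 0"
      using ball_neq_top[OF r, of x] unfolding X_def by simp
    moreover have wm [measurable]: "w \<in> borel_measurable M"
      using w(1) by (intro borel_imp_measurable borel_measurable_continuous_onI)
    ultimately have ae: "AE z in M. z \<in> ball x r \<longrightarrow> w z = avg w x r"
      by (subst (asm) nn_integral_0_iff_AE) (auto elim!: eventually_mono)
    \<comment> \<open>By continuity an exception would fill a whole ball, and balls have positive
      measure.\<close>
    have "w z = avg w x r" if z: "z \<in> ball x r" for z
    proof (rule ccontr)
      assume ne: "w z \<noteq> avg w x r"
      define U where "U = ball x r \<inter> {z. w z \<noteq> avg w x r}"
      have "open U" unfolding U_def
        using w(1) by (intro open_Int open_ball open_Collect_neq continuous_on_const)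
      moreover have "z \<in> U" using z ne by (simp add: U_def)
      ultimately obtain s where s: "0 < s" "ball z s \<subseteq> U" by (meson openE)
      have "AE z' in M. z' \<notin> ball z s"
        using ae s(2) by (auto elim!: eventually_mono simp: U_def)
      then have "emeasure M (ball z s) = 0"
        by (subst (asm) AE_iff_measurable[of "ball z s"]) auto
      with ball_neq_0[OF s(1), of z] show False by simp
    qed
    from this[of x] this[of y] show ?thesis using r by (simp add: r_def)
  qed
  have trunc_eq: "max (- ereal b) (min (ereal b) (u x)) = max (- ereal b) (min (ereal b) (u y))" if b: "0 \<le> b" for b
  proof -
    obtain w where w: "continuous_on UNIV w"
      "\<forall>x. \<bar>w x\<bar> \<le> b \<and> ereal (w x) = max (- ereal b) (min (ereal b) (u x))"
      using truncation[OF u ug[OF zero_less_one] b] by (elim exE conjE)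
    then have "w x = w y" by (intro const[OF b]) auto
    with w(2) show ?thesis by metis
  qed
  show ?thesis
  proof (rule ccontr)
    assume "u x \<noteq> u y"
    moreover have "False" if lt: "u x < u y" "\<And>b. 0 \<le> b \<Longrightarrow> max (- ereal b) (min (ereal b) (u x)) = max (- ereal b) (min (ereal b) (u y))" for x y
    proof -
      \<comment> \<open>\<open>u x\<close> or \<open>u y\<close> may be infinite, so two real levels
        strictly between them are used: a truncation reaching both levels still separates the two
        values.\<close>
      obtain s where s: "u x < ereal s" "ereal s < u y" using ereal_dense2[OF lt(1)] by blast
      obtain t where t: "ereal s < ereal t" "ereal t < u y" using ereal_dense2[OF s(2)] by blast
      define b where "b = max \<bar>s\<bar> \<bar>t\<bar>"
      have b: "0 \<le> b" "- b \<le> s" "s \<le> b" "t \<le> b" by (auto simp: b_def)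
      have "max (- ereal b) (min (ereal b) (u x)) \<le> ereal s"
        using s(1) b by (auto simp: min_le_iff_disj less_imp_le)
      moreover have "ereal t \<le> max (- ereal b) (min (ereal b) (u y))"
        using t(2) b by (auto simp: le_max_iff_disj less_imp_le)
      ultimately show False using lt(2)[OF b(1)] t(1) by (metis not_le order_trans)
    qed
    ultimately show False using trunc_eq by (metis linorder_neqE)
  qed
qed

end

theorem theorem9p1:
  fixes M :: "'a::metric_space measure" and p :: real and u :: "'a \<Rightarrow> ereal"
  assumes "1 < p"
    and "complete_borel_measure M"
    and "\<And>x r. r > 0 \<Longrightarrow> 0 < emeasure M (ball x r) \<and> emeasure M (ball x r) < \<infinity>"
    and "globally_doubling M"
    and "global_Poincare M p"
    and "u \<in> Dp M p"
    and "quasiharmonic M p u"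
    and "finite_energy M p u"
  shows "u constant_on UNIV"
proof -
  obtain C where C: "0 < C" "\<And>x r. r > 0 \<Longrightarrow> emeasure M (ball x (2 * r)) \<le> ennreal C * emeasure M (ball x r)"
    using assms(4) unfolding globally_doubling_def by blast
  obtain K L where KL: "0 < K" "1 \<le> L"
    and P: "\<forall>x r u g. r > 0 \<and>
          u \<in> borel_measurable (restrict_space M (ball x (L * r))) \<and>
          (\<integral>\<^sup>+y\<in>ball x (L * r). e2ennreal \<bar>u y\<bar> \<partial>M) < \<infinity> \<and>
          upper_gradient_on (ball x (L * r)) u g \<longrightarrow>
          (\<integral>\<^sup>+y\<in>ball x r. e2ennreal \<bar>u y - ereal (mean_on M (ball x r) u)\<bar> \<partial>M) / emeasure M (ball x r)
            \<le> ennreal (K * r) * epowr ((\<integral>\<^sup>+y\<in>ball x (L * r). epowr (g y) p \<partial>M)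
                 / emeasure M (ball x (L * r))) (1 / p)"
    using assms(5) unfolding global_Poincare_def by (elim exE conjE)
  interpret poincare_space M p C K L
    by unfold_locales (use assms(1-3) C KL P in \<open>blast+\<close>)
  obtain g where g: "upper_gradient_on UNIV u g" "(\<integral>\<^sup>+x. epowr (g x) p \<partial>M) < \<infinity>"
    using assms(6) by (auto simp: Dp_def)
  have Lp_g: "Lp g" using g upper_gradient_measurable by (simp add: Lp_def)
  have cont: "continuous_on UNIV u" and loc: "u \<in> N1p_loc M p"
    using assms(7) by (auto simp: quasiharmonic_def quasiminimizer_def)
  obtain Q where Q: "1 \<le> Q" and quasi: "\<forall>\<phi>\<in>N1p_on M p UNIV.
          (\<integral>\<^sup>+x\<in>{x. \<phi> x \<noteq> 0}. epowr (min_wug M p u x) p \<partial>M)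
            \<le> ennreal Q * (\<integral>\<^sup>+x\<in>{x. \<phi> x \<noteq> 0}. epowr (min_wug M p (\<lambda>y. u y + \<phi> y) x) p \<partial>M)"
    using assms(7) unfolding quasiharmonic_def quasiminimizer_def by blast
  have fin: "AE x in M. \<bar>u x\<bar> \<noteq> \<infinity>" by (rule N1p_loc_AE_finite[OF cont loc])
  have weak: "weak_upper_gradient M p u (min_wug M p u)"
    using min_wug_minimal[OF upper_gradient_imp_wug[OF g(1)] Lp_g]
    by (simp add: is_minimal_weak_upper_gradient_def)
  then have [measurable]: "min_wug M p u \<in> borel_measurable M" by (simp add: weak_upper_gradient_def)
  fix x0 :: 'a
  have "AE x in M. x \<in> ball x0 (real (Suc n)) \<longrightarrow> min_wug M p u x = 0" for n
  proof -
    have "(\<integral>\<^sup>+x\<in>ball x0 (real (Suc n)). epowr (min_wug M p u x) p \<partial>M) = 0"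
      by (rule quasiminimizer_energy_zero[OF cont g(1) Lp_g fin Q quasi]) simp
    then show ?thesis
      by (subst (asm) nn_integral_0_iff_AE) (auto elim!: eventually_mono)
  qed
  then have "AE x in M. \<forall>n. x \<in> ball x0 (real (Suc n)) \<longrightarrow> min_wug M p u x = 0"
    unfolding AE_all_countable by (rule allI)
  then have zero: "AE x in M. min_wug M p u x = 0"
  proof eventually_elim
    case (elim x)
    obtain n where "dist x0 x < real n" using reals_Archimedean2 by blast
    then have "x \<in> ball x0 (real (Suc n))" by simp
    with elim show ?case by blast
  qed
  \<comment> \<open>\<open>min_wug\<close> need not be Borel, nor be controlled on subcurves. A
    majorant that agrees with it almost everywhere has both properties and still vanishes almost
    everywhere.\<close>
  obtain h where h: "wug u h" "AE x in M. min_wug M p u x = h x"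
    using weak_upper_gradient_majorant[OF weak] by metis
  have "AE x in M. h x = 0" using zero h(2) by eventually_elim simp
  then have "u x = u x0" for x by (intro constant_if_zero_gradient[OF cont h(1)])
  then show ?thesis unfolding constant_on_def by blast
qed

end
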